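(* Let $1\le\gamma\le 4$ and set $$\beta_\gamma=\left(-\frac12+\frac{3}{\gamma}-\frac{\sqrt{12-3\gamma}}{2\sqrt{\gamma}}\right)^{1/2}\ \ge 0 .$$ Let $s>3/2$, let $u_0\in H^s(\mathbb{R})$ be real-valued, and let $T^*\in(0,\infty]$ be the maximal existence time of the unique solution $u\in C([0,T^* ),H^s(\mathbb{R}))\cap C^1([0,T^* ),H^{s-1}(\mathbb{R}))$ of the Cauchy problem $$u_t+\gamma u u_x=-\partial_x p*\left(\frac{3-\gamma}{2}u^2+\frac{\gamma}{2}u_x^2\right),\qquad u(0,x)=u_0(x),\qquad x\in\mathbb{R},$$ where $p(x)=\frac12 e^{-|x|}$. If there exists $x_0\in\mathbb{R}$ such that $$u_0'(x_0)<-\beta_\gamma\,|u_0(x_0)|,$$ then $T^*<\infty$.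
   Context: All functions are real-valued, $*$ denotes convolution in the space variable $x\in\mathbb{R}$, and $p(x)=\frac12e^{-|x|}$ is the fundamental solution of $1-\partial_x^2$. For $s>3/2$, $H^s(\mathbb{R})$ embeds in $C^1(\mathbb{R})$, so $u_0(x_0)$ and $u_0'(x_0)$ are meaningful pointwise. It is known that for every $\gamma\in\mathbb{R}$ the Cauchy problem is locally well-posed in $H^s(\mathbb{R})$, $s>3/2$: for every $u_0\in H^s(\mathbb{R})$ there is a maximal time $0<T^*\le\infty$ and a unique solution $u\in C([0,T^* ),H^s)\cap C^1([0,T^* ),H^{s-1})$, depending continuously on $u_0$; $T^*$ is the supremum of the times up to which a solution in this class exists. The equation is the weak (nonlocal) form of the hyper-elastic rod equation $u_t-u_{xxt}+3uu_x=\gamma(2u_xu_{xx}+uu_{xxx})$. *)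

theory Defs
  imports "HOL-Analysis.Analysis"
begin

text \<open>
  Functions in \<open>L\<^sup>2\<close> and in Sobolev spaces are represented by Borel functions on the line, not by
  equivalence classes.  Where point values matter, continuity is required separately in order
  to select the continuous representative.
\<close>

definition square_integrable :: "(real \<Rightarrow> 'b::real_normed_vector) \<Rightarrow> bool" where
  "square_integrable f \<longleftrightarrow>
     f \<in> borel_measurable lborel \<and> integrable lborel (\<lambda>x. (norm (f x))\<^sup>2)"

definition truncated_fourier :: "(real \<Rightarrow> real) \<Rightarrow> real \<Rightarrow> real \<Rightarrow> complex" where
  "truncated_fourier f R \<xi> = (LINT x:{-R..R}|lborel. complex_of_real (f x) * cis (- (\<xi> * x)))"

text \<open>
  Plancherel's definition of the Fourier transform on \<open>L\<^sup>2\<close>: the \<open>L\<^sup>2\<close>-limit, as \<open>R\<close> tends to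
  infinity, of the integral of \<open>f(x) exp(-i \<xi> x)\<close> over \<open>[-R, R]\<close>.  The nonnegative integral
  is used because, unlike the Bochner integral, it does not vanish on non-integrable functions.
\<close>

definition has_fourier_transform :: "(real \<Rightarrow> real) \<Rightarrow> (real \<Rightarrow> complex) \<Rightarrow> bool" where
  "has_fourier_transform f g \<longleftrightarrow>
     square_integrable f \<and> square_integrable g \<and>
     ((\<lambda>R. \<integral>\<^sup>+\<xi>. ennreal ((cmod (truncated_fourier f R \<xi> - g \<xi>))\<^sup>2) \<partial>lborel) \<longlongrightarrow> 0) at_top"

definition fourier_transform :: "(real \<Rightarrow> real) \<Rightarrow> real \<Rightarrow> complex" where
  "fourier_transform f = (SOME g. has_fourier_transform f g)"

text \<open>
  The real-valued part of \<open>H\<^sup>s\<close>, for \<open>s \<ge> 0\<close> only: for negative \<open>s\<close> the space \<open>H\<^sup>s\<close> also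
  contains distributions that are not in \<open>L\<^sup>2\<close>.
\<close>

definition sobolev_space :: "real \<Rightarrow> (real \<Rightarrow> real) set" where
  "sobolev_space s =
     {f. \<exists>g. has_fourier_transform f g \<and>
             integrable lborel (\<lambda>\<xi>. (1 + \<xi>\<^sup>2) powr s * (cmod (g \<xi>))\<^sup>2)}"

text \<open>
  The transform is unique up to null sets, so the choice in \<^const>\<open>fourier_transform\<close> does not
  affect the norm.  The factor \<open>1 / (2 pi)\<close> makes the norm for \<open>s = 0\<close> the \<open>L\<^sup>2\<close> norm.
\<close>

definition sobolev_norm :: "real \<Rightarrow> (real \<Rightarrow> real) \<Rightarrow> real" where
  "sobolev_norm s f =
     sqrt ((LINT \<xi>|lborel. (1 + \<xi>\<^sup>2) powr s * (cmod (fourier_transform f \<xi>))\<^sup>2) / (2 * pi))"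

definition sobolev_continuous :: "real \<Rightarrow> real set \<Rightarrow> (real \<Rightarrow> real \<Rightarrow> real) \<Rightarrow> bool" where
  "sobolev_continuous s I u \<longleftrightarrow>
     (\<forall>t\<in>I. u t \<in> sobolev_space s \<and>
        ((\<lambda>r. sobolev_norm s (\<lambda>x. u r x - u t x)) \<longlongrightarrow> 0) (at t within I))"

definition sobolev_time_derivative ::
  "real \<Rightarrow> real set \<Rightarrow> (real \<Rightarrow> real \<Rightarrow> real) \<Rightarrow> (real \<Rightarrow> real \<Rightarrow> real) \<Rightarrow> bool" where
  "sobolev_time_derivative s I u v \<longleftrightarrow>
     (\<forall>t\<in>I. u t \<in> sobolev_space s \<and> v t \<in> sobolev_space s \<and>
        ((\<lambda>r. sobolev_norm s (\<lambda>x. (u r x - u t x) / (r - t) - v t x)) \<longlongrightarrow> 0) (at t within I))"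

definition convolution :: "(real \<Rightarrow> real) \<Rightarrow> (real \<Rightarrow> real) \<Rightarrow> real \<Rightarrow> real" where
  "convolution f g x = (LINT y|lborel. f (x - y) * g y)"

definition rod_kernel :: "real \<Rightarrow> real" where
  "rod_kernel x = exp (- \<bar>x\<bar>) / 2"

definition rod_interval :: "ereal \<Rightarrow> real set" where
  "rod_interval T = {t. 0 \<le> t \<and> ereal t < T}"

text \<open>
  A solution in \<open>C([0,T), H\<^sup>s) \<inter> C\<^sup>1([0,T), H\<^sup>s\<^sup>-\<^sup>1)\<close> for \<open>s > 3/2\<close>, where \<open>v\<close> is the time
  derivative in \<open>H\<^sup>s\<^sup>-\<^sup>1\<close>.  Each \<open>u t\<close> is the continuous representative of its class; by Sobolev
  embedding it is continuously differentiable, so \<open>deriv (u t)\<close> is its classical derivative.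
  The equation is an identity in \<open>H\<^sup>s\<^sup>-\<^sup>1\<close>, hence holds almost everywhere at each time.
  The kernel is not differentiable at \<open>0\<close>; the value of \<open>deriv rod_kernel 0\<close> does not affect the
  convolution.
\<close>

definition rod_solution ::
  "real \<Rightarrow> real \<Rightarrow> (real \<Rightarrow> real) \<Rightarrow> ereal \<Rightarrow> (real \<Rightarrow> real \<Rightarrow> real) \<Rightarrow> bool" where
  "rod_solution \<gamma> s u\<^sub>0 T u \<longleftrightarrow>
     (\<forall>t\<in>rod_interval T. continuous_on UNIV (u t)) \<and>
     sobolev_continuous s (rod_interval T) u \<and>
     (\<exists>v. sobolev_time_derivative (s - 1) (rod_interval T) u v \<and>
          sobolev_continuous (s - 1) (rod_interval T) v \<and>
          (\<forall>t\<in>rod_interval T. AE x in lborel.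
             v t x + \<gamma> * u t x * deriv (u t) x =
               - convolution (deriv rod_kernel)
                   (\<lambda>y. (3 - \<gamma>) / 2 * (u t y)\<^sup>2 + \<gamma> / 2 * (deriv (u t) y)\<^sup>2) x)) \<and>
     (\<forall>x. u 0 x = u\<^sub>0 x)"

definition rod_max_time :: "real \<Rightarrow> real \<Rightarrow> (real \<Rightarrow> real) \<Rightarrow> ereal" where
  "rod_max_time \<gamma> s u\<^sub>0 = Sup {T. 0 < T \<and> (\<exists>u. rod_solution \<gamma> s u\<^sub>0 T u)}"

definition rod_beta :: "real \<Rightarrow> real" where
  "rod_beta \<gamma> = sqrt (- 1 / 2 + 3 / \<gamma> - sqrt (12 - 3 * \<gamma>) / (2 * sqrt \<gamma>))"

end

theory Submission
  imports Defs "HOL-Probability.Characteristic_Functions"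
begin

text \<open>
  Suppose that the solution is global.  Let \<open>q' = \<gamma> u(t, q)\<close>, \<open>q(0) = x\<^sub>0\<close>, and put
  \<open>F = (3 - \<gamma>)/2 u\<^sup>2 + \<gamma>/2 u\<^sub>x\<^sup>2\<close>.  Along \<open>q\<close> the functions \<open>u\<close> and \<open>u\<^sub>x\<close> have the time derivatives
  \<open>- \<partial>\<^sub>x p * F\<close> and \<open>F - p * F - \<gamma> u\<^sub>x\<^sup>2\<close>.  If \<open>\<gamma> (\<kappa>\<^sup>2 + \<kappa>) = 3 - \<gamma>\<close>, completing a square shows that the parts of
  \<open>p * F\<close> to the left and to the right of a point are both at least \<open>(\<gamma> \<kappa> / 4) u\<^sup>2\<close>.  For
  \<open>\<beta> = \<bar>\<kappa>\<bar> \<le> 1\<close> it follows that \<open>A = \<beta> u - u\<^sub>x\<close> and \<open>B = - \<beta> u - u\<^sub>x\<close> satisfy \<open>A', B' \<ge> (\<gamma>/2) A B\<close>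
  along \<open>q\<close>.  Both are positive initially, hence \<open>(1/A + 1/B)' \<le> - \<gamma>\<close>, which is impossible for all times.
\<close>

section \<open>The Fourier transform on \<open>L\<^sup>2\<close>\<close>

text \<open>Why \<beta> = |\<kappa>|: for |\<sigma>| \<le> 1 the derivative of \<sigma> u - u_x
  along q contains the left and right parts of p * F with the nonnegative weights 1 + \<sigma> and 1
  - \<sigma>, whose sum is 2. Their lower bounds contribute (\<gamma> \<kappa> / 2) u^2. Together
  with -(3 - \<gamma>)/2 u^2 from -F the coefficient of u^2 becomes -\<gamma> \<kappa>^2 / 2, so the
  total bound is (\<gamma>/2) (u_x^2 - \<kappa>^2 u^2), which factors as (\<gamma>/2) A B when
  \<beta> = |\<kappa>|. The choices \<sigma> = \<beta> and \<sigma> = -\<beta> give A and B. The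
  condition \<gamma> \<le> 4 makes \<kappa> real and 1 \<le> \<gamma> makes it at most 1; for
  \<gamma> > 3 it is negative, and there F may take negative values.

  The obstacle is regularity: the solution is controlled only in Sobolev norms, whereas the argument
  needs values along a moving curve. The Sobolev embedding, applied to differences, turns
  convergence in H^s and H^(s-1) into uniform convergence of u, of u_x and of the time difference
  quotients of u.\<close>

lemma measurable_cis [measurable]: "cis \<in> borel_measurable borel"
  by (intro borel_measurable_continuous_onI continuous_intros)

lemma square_integrable_mult:
  fixes f g :: "real \<Rightarrow> 'b::{real_normed_algebra, banach, second_countable_topology}"
  assumes "square_integrable f" "square_integrable g"
  shows "integrable lborel (\<lambda>x. f x * g x)"
proof -
  have [measurable]: "f \<in> borel_measurable borel" "g \<in> borel_measurable borel"
    using assms unfolding square_integrable_def by auto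
  show ?thesis
  proof (rule Bochner_Integration.integrable_bound)
    show "integrable lborel (\<lambda>x. (norm (f x))\<^sup>2 + (norm (g x))\<^sup>2)"
      using assms unfolding square_integrable_def by auto
    show "(\<lambda>x. f x * g x) \<in> borel_measurable lborel"
      by measurable
    have "norm (f x * g x) \<le> (norm (f x))\<^sup>2 + (norm (g x))\<^sup>2" for x
    proof -
      have "norm (f x * g x) \<le> norm (f x) * norm (g x)"
        by (rule norm_mult_ineq)
      also have "\<dots> \<le> (norm (f x))\<^sup>2 + (norm (g x))\<^sup>2"
        using sum_squares_bound[of "norm (f x)" "norm (g x)"]
          zero_le_power2[of "norm (f x)"] zero_le_power2[of "norm (g x)"] by linarith
      finally show ?thesis .
    qed
    then show "AE x in lborel. norm (f x * g x) \<le> norm ((norm (f x))\<^sup>2 + (norm (g x))\<^sup>2)"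
      by auto
  qed
qed

lemma cauchy_schwarz_real_integral:
  fixes f g :: "real \<Rightarrow> real"
  assumes f: "square_integrable f" and g: "square_integrable g"
  shows "(LINT x|lborel. \<bar>f x\<bar> * \<bar>g x\<bar>) \<le> sqrt (LINT x|lborel. (f x)\<^sup>2) * sqrt (LINT x|lborel. (g x)\<^sup>2)"
proof -
  have int: "integrable lborel (\<lambda>x. (f x)\<^sup>2)" "integrable lborel (\<lambda>x. (g x)\<^sup>2)"
    and [measurable]: "f \<in> borel_measurable borel" "g \<in> borel_measurable borel"
    using assms unfolding square_integrable_def by auto
  have "integrable lborel (\<lambda>x. f x * g x)"
    using assms by (rule square_integrable_mult)
  then have i: "integrable lborel (\<lambda>x. \<bar>f x\<bar> * \<bar>g x\<bar>)"
    by (auto dest: integrable_abs simp: abs_mult)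
  have "ennreal ((LINT x|lborel. \<bar>f x\<bar> * \<bar>g x\<bar>)\<^sup>2) = (\<integral>\<^sup>+x. ennreal \<bar>f x\<bar> * ennreal \<bar>g x\<bar> \<partial>lborel)\<^sup>2"
    using i by (simp add: nn_integral_eq_integral ennreal_power flip: ennreal_mult)
  also have "\<dots> \<le> (\<integral>\<^sup>+x. (ennreal \<bar>f x\<bar>)\<^sup>2 \<partial>lborel) * (\<integral>\<^sup>+x. (ennreal \<bar>g x\<bar>)\<^sup>2 \<partial>lborel)"
    by (rule Cauchy_Schwarz_nn_integral) auto
  also have "\<dots> = ennreal ((LINT x|lborel. (f x)\<^sup>2) * (LINT x|lborel. (g x)\<^sup>2))"
    using int by (simp add: ennreal_power nn_integral_eq_integral ennreal_mult)
  finally have "(LINT x|lborel. \<bar>f x\<bar> * \<bar>g x\<bar>)\<^sup>2 \<le> (LINT x|lborel. (f x)\<^sup>2) * (LINT x|lborel. (g x)\<^sup>2)"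
    by (subst (asm) ennreal_le_iff) auto
  then show ?thesis
    by (metis real_le_rsqrt real_sqrt_mult)
qed

lemma square_integrable_imp_integrable_Icc:
  fixes f :: "real \<Rightarrow> real"
  assumes "square_integrable f"
  shows "integrable lborel (\<lambda>x. indicat_real {a..b} x * f x)"
proof -
  have "square_integrable (indicat_real {a..b})"
  proof -
    have "(\<lambda>x. (norm (indicat_real {a..b} x))\<^sup>2) = indicat_real {a..b}"
      by (auto simp: indicator_def)
    then show ?thesis
      unfolding square_integrable_def by (simp add: integrable_real_indicator emeasure_lborel_Icc_eq)
  qed
  then show ?thesis
    using assms by (rule square_integrable_mult)
qed

lemma truncated_fourier_integrable:
  assumes "square_integrable f"
  shows "integrable lborel (\<lambda>x. indicat_real {-R..R} x *\<^sub>R (complex_of_real (f x) * cis (- (\<xi> * x))))"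
proof (rule Bochner_Integration.integrable_bound[OF square_integrable_imp_integrable_Icc[OF assms]])
  have [measurable]: "f \<in> borel_measurable borel"
    using assms unfolding square_integrable_def by auto
  show "(\<lambda>x. indicat_real {-R..R} x *\<^sub>R (complex_of_real (f x) * cis (- (\<xi> * x)))) \<in> borel_measurable lborel"
    by measurable
qed (auto simp: norm_mult abs_mult)

lemma truncated_fourier_measurable:
  assumes "f \<in> borel_measurable borel"
  shows "truncated_fourier f R \<in> borel_measurable borel"
proof -
  note assms[measurable]
  show ?thesis
    unfolding truncated_fourier_def[abs_def] set_lebesgue_integral_def by measurable
qed

lemma truncated_fourier_lincomb:
  assumes "square_integrable f" "square_integrable g"
  shows "truncated_fourier (\<lambda>x. a * f x + b * g x) R \<xi> = a * truncated_fourier f R \<xi> + b * truncated_fourier g R \<xi>"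
proof -
  let ?F = "\<lambda>f x. indicat_real {-R..R} x *\<^sub>R (complex_of_real (f x) * cis (- (\<xi> * x)))"
  have "(LINT x|lborel. ?F (\<lambda>x. a * f x + b * g x) x) = (LINT x|lborel. a * ?F f x + b * ?F g x)"
    by (intro Bochner_Integration.integral_cong) (auto simp: algebra_simps scaleR_conv_of_real)
  also have "\<dots> = a * (LINT x|lborel. ?F f x) + b * (LINT x|lborel. ?F g x)"
    using truncated_fourier_integrable[OF assms(1), of R \<xi>] truncated_fourier_integrable[OF assms(2), of R \<xi>]
    by (simp only: Bochner_Integration.integral_add integrable_mult_right integral_mult_right_zero)
  finally show ?thesis
    unfolding truncated_fourier_def set_lebesgue_integral_def .
qed

lemma square_integrable_lincomb:
  fixes f g :: "real \<Rightarrow> 'b::{real_normed_algebra, banach, second_countable_topology}"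
  assumes "square_integrable f" "square_integrable g"
  shows "square_integrable (\<lambda>x. a * f x + b * g x)"
  unfolding square_integrable_def
proof
  have [measurable]: "f \<in> borel_measurable borel" "g \<in> borel_measurable borel"
    using assms unfolding square_integrable_def by auto
  show "(\<lambda>x. a * f x + b * g x) \<in> borel_measurable lborel"
    by measurable
  show "integrable lborel (\<lambda>x. (norm (a * f x + b * g x))\<^sup>2)"
  proof (rule Bochner_Integration.integrable_bound)
    show "integrable lborel (\<lambda>x. 2 * (norm a)\<^sup>2 * (norm (f x))\<^sup>2 + 2 * (norm b)\<^sup>2 * (norm (g x))\<^sup>2)"
      using assms unfolding square_integrable_def by auto
    have "(norm (a * f x + b * g x))\<^sup>2 \<le> 2 * (norm a)\<^sup>2 * (norm (f x))\<^sup>2 + 2 * (norm b)\<^sup>2 * (norm (g x))\<^sup>2" for x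
    proof -
      have "norm (a * f x + b * g x) \<le> norm a * norm (f x) + norm b * norm (g x)"
        by (meson add_mono norm_mult_ineq norm_triangle_ineq order_trans)
      then have "(norm (a * f x + b * g x))\<^sup>2 \<le> (norm a * norm (f x) + norm b * norm (g x))\<^sup>2"
        by (intro power_mono) auto
      also have "\<dots> \<le> 2 * (norm a * norm (f x))\<^sup>2 + 2 * (norm b * norm (g x))\<^sup>2"
        using sum_squares_bound[of "norm a * norm (f x)" "norm b * norm (g x)"]
        unfolding power2_sum by linarith
      finally show ?thesis
        by (simp add: power_mult_distrib mult.assoc)
    qed
    then show "AE x in lborel. norm ((norm (a * f x + b * g x))\<^sup>2) \<le> norm (2 * (norm a)\<^sup>2 * (norm (f x))\<^sup>2 + 2 * (norm b)\<^sup>2 * (norm (g x))\<^sup>2)"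
      by auto
    show "(\<lambda>x. (norm (a * f x + b * g x))\<^sup>2) \<in> borel_measurable lborel"
      by measurable
  qed
qed

text \<open>The inequality (x + y)^2 \<le> 2 x^2 + 2 y^2 replaces the triangle inequality in L^2.
  Stated in \<open>ennreal\<close>, it applies under nonnegative integrals without first knowing
  that truncated transforms are square integrable.\<close>

lemma ennreal_norm_lincomb_square_le:
  fixes z w :: complex
  shows "ennreal ((cmod (a * z + b * w))\<^sup>2) \<le> ennreal (2 * (cmod a)\<^sup>2) * ennreal ((cmod z)\<^sup>2) + ennreal (2 * (cmod b)\<^sup>2) * ennreal ((cmod w)\<^sup>2)"
proof -
  have "cmod (a * z + b * w) \<le> cmod a * cmod z + cmod b * cmod w"
    by (metis norm_mult norm_triangle_ineq)
  then have "(cmod (a * z + b * w))\<^sup>2 \<le> (cmod a * cmod z + cmod b * cmod w)\<^sup>2"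
    by (intro power_mono) auto
  also have "\<dots> \<le> 2 * (cmod a * cmod z)\<^sup>2 + 2 * (cmod b * cmod w)\<^sup>2"
    using sum_squares_bound[of "cmod a * cmod z" "cmod b * cmod w"]
    unfolding power2_sum by linarith
  also have "\<dots> = (2 * (cmod a)\<^sup>2) * (cmod z)\<^sup>2 + (2 * (cmod b)\<^sup>2) * (cmod w)\<^sup>2"
    by (simp add: power_mult_distrib mult.assoc)
  finally have "ennreal ((cmod (a * z + b * w))\<^sup>2) \<le> ennreal ((2 * (cmod a)\<^sup>2) * (cmod z)\<^sup>2 + (2 * (cmod b)\<^sup>2) * (cmod w)\<^sup>2)"
    by (rule ennreal_leI)
  then show ?thesis
    by (simp add: ennreal_mult)
qed

lemma has_fourier_transform_lincomb:
  fixes a b :: real and f' g' :: "real \<Rightarrow> complex"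
  assumes f: "has_fourier_transform f f'" and g: "has_fourier_transform g g'"
  shows "has_fourier_transform (\<lambda>x. a * f x + b * g x) (\<lambda>\<xi>. a * f' \<xi> + b * g' \<xi>)"
  unfolding has_fourier_transform_def
proof (intro conjI)
  have sf: "square_integrable f" "square_integrable g" "square_integrable f'" "square_integrable g'"
    using assms unfolding has_fourier_transform_def by auto
  show "square_integrable (\<lambda>x. a * f x + b * g x)"
    by (rule square_integrable_lincomb) fact+
  show "square_integrable (\<lambda>\<xi>. a * f' \<xi> + b * g' \<xi>)"
    by (rule square_integrable_lincomb) fact+
  have [measurable]: "f \<in> borel_measurable borel" "g \<in> borel_measurable borel"
    "f' \<in> borel_measurable borel" "g' \<in> borel_measurable borel"
    using sf unfolding square_integrable_def by auto
  have [measurable]: "truncated_fourier f R \<in> borel_measurable borel" "truncated_fourier g R \<in> borel_measurable borel" for R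
    by (auto intro: truncated_fourier_measurable)
  let ?e = "\<lambda>f f' R. \<integral>\<^sup>+\<xi>. ennreal ((cmod (truncated_fourier f R \<xi> - f' \<xi>))\<^sup>2) \<partial>lborel"
  have le: "?e (\<lambda>x. a * f x + b * g x) (\<lambda>\<xi>. a * f' \<xi> + b * g' \<xi>) R \<le>
     ennreal (2 * \<bar>a\<bar>\<^sup>2) * ?e f f' R + ennreal (2 * \<bar>b\<bar>\<^sup>2) * ?e g g' R" for R
  proof -
    have "?e (\<lambda>x. a * f x + b * g x) (\<lambda>\<xi>. a * f' \<xi> + b * g' \<xi>) R \<le>
      (\<integral>\<^sup>+\<xi>. ennreal (2 * \<bar>a\<bar>\<^sup>2) * ennreal ((cmod (truncated_fourier f R \<xi> - f' \<xi>))\<^sup>2)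
       + ennreal (2 * \<bar>b\<bar>\<^sup>2) * ennreal ((cmod (truncated_fourier g R \<xi> - g' \<xi>))\<^sup>2) \<partial>lborel)"
    proof (rule nn_integral_mono)
      fix \<xi>
      have "truncated_fourier (\<lambda>x. a * f x + b * g x) R \<xi> - (a * f' \<xi> + b * g' \<xi>) =
         a * (truncated_fourier f R \<xi> - f' \<xi>) + b * (truncated_fourier g R \<xi> - g' \<xi>)"
        using sf by (simp add: truncated_fourier_lincomb algebra_simps)
      then show "ennreal ((cmod (truncated_fourier (\<lambda>x. a * f x + b * g x) R \<xi> - (a * f' \<xi> + b * g' \<xi>)))\<^sup>2) \<le>
          ennreal (2 * \<bar>a\<bar>\<^sup>2) * ennreal ((cmod (truncated_fourier f R \<xi> - f' \<xi>))\<^sup>2)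
       + ennreal (2 * \<bar>b\<bar>\<^sup>2) * ennreal ((cmod (truncated_fourier g R \<xi> - g' \<xi>))\<^sup>2)"
        using ennreal_norm_lincomb_square_le[of "complex_of_real a" "truncated_fourier f R \<xi> - f' \<xi>"
            "complex_of_real b" "truncated_fourier g R \<xi> - g' \<xi>"] by simp
    qed
    also have "\<dots> = ennreal (2 * \<bar>a\<bar>\<^sup>2) * ?e f f' R + ennreal (2 * \<bar>b\<bar>\<^sup>2) * ?e g g' R"
      by (subst nn_integral_add) (auto simp: nn_integral_cmult)
    finally show ?thesis .
  qed
  have "((\<lambda>R. ennreal (2 * \<bar>a\<bar>\<^sup>2) * ?e f f' R + ennreal (2 * \<bar>b\<bar>\<^sup>2) * ?e g g' R) \<longlongrightarrow>
      ennreal (2 * \<bar>a\<bar>\<^sup>2) * 0 + ennreal (2 * \<bar>b\<bar>\<^sup>2) * 0) at_top"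
    using assms unfolding has_fourier_transform_def
    by (intro tendsto_add ennreal_tendsto_cmult) auto
  then have lim: "((\<lambda>R. ennreal (2 * \<bar>a\<bar>\<^sup>2) * ?e f f' R + ennreal (2 * \<bar>b\<bar>\<^sup>2) * ?e g g' R) \<longlongrightarrow> 0) at_top"
    by simp
  show "(?e (\<lambda>x. a * f x + b * g x) (\<lambda>\<xi>. a * f' \<xi> + b * g' \<xi>) \<longlongrightarrow> 0) at_top"
    by (rule tendsto_sandwich[OF _ _ tendsto_const lim]) (simp, rule always_eventually, rule allI, rule le)
qed

text \<open>The squared L^2 distance between \<open>g\<close> and \<open>g'\<close> does not depend
  on \<open>R\<close>, yet it is bounded by the two truncation errors at every \<open>R\<close>,
  which tend to 0.\<close>

lemma has_fourier_transform_unique: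
  assumes f: "has_fourier_transform f g" and f': "has_fourier_transform f g'"
  shows "AE \<xi> in lborel. g \<xi> = g' \<xi>"
proof -
  have [measurable]: "f \<in> borel_measurable borel" "g \<in> borel_measurable borel"
    "g' \<in> borel_measurable borel"
    using assms unfolding has_fourier_transform_def square_integrable_def by auto
  have [measurable]: "truncated_fourier f R \<in> borel_measurable borel" for R
    by (auto intro: truncated_fourier_measurable)
  let ?e = "\<lambda>f' R. \<integral>\<^sup>+\<xi>. ennreal ((cmod (truncated_fourier f R \<xi> - f' \<xi>))\<^sup>2) \<partial>lborel"
  have "(\<integral>\<^sup>+\<xi>. ennreal ((cmod (g \<xi> - g' \<xi>))\<^sup>2) \<partial>lborel) \<le> 2 * ?e g R + 2 * ?e g' R" for R
  proof -
    have "(\<integral>\<^sup>+\<xi>. ennreal ((cmod (g \<xi> - g' \<xi>))\<^sup>2) \<partial>lborel) \<le>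
      (\<integral>\<^sup>+\<xi>. 2 * ennreal ((cmod (truncated_fourier f R \<xi> - g \<xi>))\<^sup>2)
       + 2 * ennreal ((cmod (truncated_fourier f R \<xi> - g' \<xi>))\<^sup>2) \<partial>lborel)"
    proof (rule nn_integral_mono)
      fix \<xi>
      show "ennreal ((cmod (g \<xi> - g' \<xi>))\<^sup>2) \<le>
          2 * ennreal ((cmod (truncated_fourier f R \<xi> - g \<xi>))\<^sup>2)
       + 2 * ennreal ((cmod (truncated_fourier f R \<xi> - g' \<xi>))\<^sup>2)"
        using ennreal_norm_lincomb_square_le[of "-1" "truncated_fourier f R \<xi> - g \<xi>"
            1 "truncated_fourier f R \<xi> - g' \<xi>"] by simp
    qed
    also have "\<dots> = 2 * ?e g R + 2 * ?e g' R"
      by (subst nn_integral_add) (auto simp: nn_integral_cmult)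
    finally show ?thesis .
  qed
  moreover have "((\<lambda>R. 2 * ?e g R + 2 * ?e g' R) \<longlongrightarrow> 2 * 0 + 2 * 0) at_top"
    using assms unfolding has_fourier_transform_def
    by (intro tendsto_add ennreal_tendsto_cmult) auto
  ultimately have "(\<integral>\<^sup>+\<xi>. ennreal ((cmod (g \<xi> - g' \<xi>))\<^sup>2) \<partial>lborel) \<le> 2 * 0 + 2 * 0"
    by (intro tendsto_lowerbound) auto
  then show ?thesis
    by (simp add: nn_integral_0_iff_AE)
qed

text \<open>Truncated transforms are integrals, so functions equal almost everywhere have identical
  ones. This later permits passing to a continuous representative.\<close>

lemma has_fourier_transform_cong_AE:
  assumes f: "has_fourier_transform f g" and ae: "AE x in lborel. f x = f' x"
    and [measurable]: "f' \<in> borel_measurable borel"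
  shows "has_fourier_transform f' g"
proof -
  have [measurable]: "f \<in> borel_measurable borel"
    using assms unfolding has_fourier_transform_def square_integrable_def by auto
  have "truncated_fourier f R \<xi> = truncated_fourier f' R \<xi>" for R \<xi>
    unfolding truncated_fourier_def set_lebesgue_integral_def
    by (intro integral_cong_AE) (use ae in auto)
  then have "truncated_fourier f = truncated_fourier f'"
    by auto
  moreover have "square_integrable f'"
  proof -
    have "integrable lborel (\<lambda>x. (norm (f x))\<^sup>2)"
      using f unfolding has_fourier_transform_def square_integrable_def by auto
    then have "integrable lborel (\<lambda>x. (norm (f' x))\<^sup>2)"
      by (subst integrable_cong_AE[of _ _ "\<lambda>x. (norm (f x))\<^sup>2"]) (use ae in auto)
    then show ?thesis
      unfolding square_integrable_def by auto
  qed
  ultimately show ?thesis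
    using f unfolding has_fourier_transform_def by auto
qed

section \<open>Gaussian test functions and the inversion formula\<close>

lemma gaussian_integral_cis:
  assumes "0 < e"
  shows "(LINT \<xi>|lborel. complex_of_real (exp (- (e * \<xi>)\<^sup>2 / 2)) * cis (z * \<xi>)) =
    complex_of_real (2 * pi * normal_density 0 e z)"
proof -
  \<comment> \<open>The characteristic function of the standard normal distribution at
    \<open>z / e\<close>, read backwards; the substitution by \<open>e * x\<close> below turns it
    into the Gaussian of the claim.\<close>
  have "exp (- ((z/e)\<^sup>2) / 2) = char std_normal_distribution (z/e)"
    by (simp add: char_std_normal_distribution)
  also have "\<dots> = (LINT x|lborel. std_normal_density x *\<^sub>R iexp (z / e * x))"
    unfolding char_def by (subst integral_density) auto
  also have "\<dots> = (LINT x|lborel. complex_of_real (std_normal_density x) * cis (z / e * x))"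
    by (simp add: cis_conv_exp scaleR_conv_of_real)
  also have "\<dots> = \<bar>e\<bar> *\<^sub>R (LINT x|lborel. complex_of_real (std_normal_density (0 + e * x)) * cis (z / e * (0 + e * x)))"
    using assms by (intro lborel_integral_real_affine) auto
  also have "\<dots> = complex_of_real e * (LINT x|lborel. complex_of_real (1 / sqrt (2 * pi)) * (complex_of_real (exp (- (e * x)\<^sup>2 / 2)) * cis (z * x)))"
    using assms by (simp add: scaleR_conv_of_real std_normal_density_def mult.assoc)
  also have "\<dots> = complex_of_real (e / sqrt (2 * pi)) * (LINT x|lborel. complex_of_real (exp (- (e * x)\<^sup>2 / 2)) * cis (z * x))"
    by (subst integral_mult_right_zero) simp
  finally have "complex_of_real (e / sqrt (2 * pi)) * (LINT x|lborel. complex_of_real (exp (- (e * x)\<^sup>2 / 2)) * cis (z * x)) = complex_of_real (exp (- ((z/e)\<^sup>2) / 2))"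
    by simp
  then have "(LINT x|lborel. complex_of_real (exp (- (e * x)\<^sup>2 / 2)) * cis (z * x)) = complex_of_real (exp (- ((z/e)\<^sup>2) / 2)) / complex_of_real (e / sqrt (2 * pi))"
    using assms by (simp add: field_simps)
  also have "\<dots> = complex_of_real (exp (- ((z/e)\<^sup>2) / 2) / (e / sqrt (2 * pi)))"
    by simp
  also have "exp (- ((z/e)\<^sup>2) / 2) / (e / sqrt (2 * pi)) = 2 * pi * normal_density 0 e z"
  proof -
    have "sqrt (2 * pi) * sqrt (2 * pi) = 2 * pi" by simp
    moreover have "sqrt (2 * pi * e\<^sup>2) = sqrt (2 * pi) * e"
      using assms by (simp add: real_sqrt_mult)
    ultimately show ?thesis
      using assms unfolding normal_density_def by (simp add: field_simps power_divide)
  qed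
  finally show ?thesis .
qed

lemma integrable_gaussian:
  assumes "0 < e"
  shows "integrable lborel (\<lambda>x::real. exp (- (e * x)\<^sup>2 / 2))"
proof -
  have "integrable lborel (\<lambda>x. sqrt (2 * pi) / e * normal_density 0 (1 / e) x)"
    by (intro integrable_mult_right integrable_normal_density) (use assms in auto)
  moreover have "(\<lambda>x. sqrt (2 * pi) / e * normal_density 0 (1 / e) x) = (\<lambda>x. exp (- (e * x)\<^sup>2 / 2))"
    using assms by (auto simp: normal_density_def real_sqrt_divide real_sqrt_mult power_mult_distrib power_divide field_simps)
  ultimately show ?thesis by simp
qed

lemma truncated_fourier_bound:
  "cmod (truncated_fourier f R \<xi>) \<le> (LINT x|lborel. \<bar>indicat_real {-R..R} x * f x\<bar>)"
  unfolding truncated_fourier_def set_lebesgue_integral_def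
  by (rule order_trans[OF integral_norm_bound]) (simp add: norm_mult abs_mult)

text \<open>Strong L^2 convergence implies convergence of pairings, by Cauchy-Schwarz. For each
  fixed \<open>R\<close> the truncated transform is bounded, so integrability of \<open>h\<close>
  makes the pairing a genuine integral.\<close>

lemma fourier_pairing_tendsto:
  assumes ft: "has_fourier_transform f g"
    and h: "square_integrable h" "integrable lborel h"
  shows "((\<lambda>R. LINT \<xi>|lborel. truncated_fourier f R \<xi> * h \<xi>) \<longlongrightarrow> (LINT \<xi>|lborel. g \<xi> * h \<xi>)) at_top"
proof -
  have [measurable]: "f \<in> borel_measurable borel" "g \<in> borel_measurable borel" "h \<in> borel_measurable borel"
    using assms unfolding has_fourier_transform_def square_integrable_def by auto
  have tm [measurable]: "truncated_fourier f R \<in> borel_measurable borel" for R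
    by (auto intro: truncated_fourier_measurable)
  let ?e = "\<lambda>R. \<integral>\<^sup>+\<xi>. ennreal ((cmod (truncated_fourier f R \<xi> - g \<xi>))\<^sup>2) \<partial>lborel"
  let ?d = "\<lambda>R. (LINT \<xi>|lborel. truncated_fourier f R \<xi> * h \<xi>) - (LINT \<xi>|lborel. g \<xi> * h \<xi>)"
  have gh: "integrable lborel (\<lambda>\<xi>. g \<xi> * h \<xi>)"
    using ft h(1) unfolding has_fourier_transform_def by (intro square_integrable_mult) auto
  have th: "integrable lborel (\<lambda>\<xi>. truncated_fourier f R \<xi> * h \<xi>)" for R
  proof (rule Bochner_Integration.integrable_bound)
    let ?C = "(LINT x|lborel. \<bar>indicat_real {-R..R} x * f x\<bar>)"
    show "integrable lborel (\<lambda>\<xi>. complex_of_real ?C * h \<xi>)"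
      by (rule integrable_mult_right) (rule h)
    show "AE \<xi> in lborel. cmod (truncated_fourier f R \<xi> * h \<xi>) \<le> cmod (complex_of_real ?C * h \<xi>)"
    proof (rule AE_I2)
      fix \<xi>
      have "cmod (truncated_fourier f R \<xi> * h \<xi>) = cmod (truncated_fourier f R \<xi>) * cmod (h \<xi>)"
        by (rule norm_mult)
      also have "\<dots> \<le> ?C * cmod (h \<xi>)"
        by (rule mult_right_mono[OF truncated_fourier_bound]) simp
      also have "\<dots> = cmod (complex_of_real ?C * h \<xi>)"
        by (simp only: norm_mult norm_of_real abs_of_nonneg Bochner_Integration.integral_nonneg abs_ge_zero)
      finally show "cmod (truncated_fourier f R \<xi> * h \<xi>) \<le> cmod (complex_of_real ?C * h \<xi>)" .
    qed
    show "(\<lambda>\<xi>. truncated_fourier f R \<xi> * h \<xi>) \<in> borel_measurable lborel"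
      by measurable
  qed
  have bound: "(ennreal (cmod (?d R)))\<^sup>2 \<le> ?e R * (\<integral>\<^sup>+\<xi>. ennreal ((cmod (h \<xi>))\<^sup>2) \<partial>lborel)" for R
  proof -
    have "?d R = (LINT \<xi>|lborel. (truncated_fourier f R \<xi> - g \<xi>) * h \<xi>)"
      using th[of R] gh by (simp add: left_diff_distrib)
    also have "ennreal (cmod \<dots>) \<le> (\<integral>\<^sup>+\<xi>. ennreal (cmod ((truncated_fourier f R \<xi> - g \<xi>) * h \<xi>)) \<partial>lborel)"
      using th[of R] gh by (intro integral_norm_bound_ennreal) (simp add: left_diff_distrib)
    also have "\<dots> = (\<integral>\<^sup>+\<xi>. ennreal (cmod (truncated_fourier f R \<xi> - g \<xi>)) * ennreal (cmod (h \<xi>)) \<partial>lborel)"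
      by (simp add: norm_mult ennreal_mult)
    finally have "(ennreal (cmod (?d R)))\<^sup>2 \<le> (\<integral>\<^sup>+\<xi>. ennreal (cmod (truncated_fourier f R \<xi> - g \<xi>)) * ennreal (cmod (h \<xi>)) \<partial>lborel)\<^sup>2"
      by (intro power_mono) auto
    also have "\<dots> \<le> (\<integral>\<^sup>+\<xi>. (ennreal (cmod (truncated_fourier f R \<xi> - g \<xi>)))\<^sup>2 \<partial>lborel) * (\<integral>\<^sup>+\<xi>. (ennreal (cmod (h \<xi>)))\<^sup>2 \<partial>lborel)"
      by (rule Cauchy_Schwarz_nn_integral) auto
    finally show ?thesis
      by (simp add: ennreal_power)
  qed
  have fin: "(\<integral>\<^sup>+\<xi>. ennreal ((cmod (h \<xi>))\<^sup>2) \<partial>lborel) < \<infinity>"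
    using h(1) unfolding square_integrable_def by (auto simp: integrable_iff_bounded)
  have "((\<lambda>R. (\<integral>\<^sup>+\<xi>. ennreal ((cmod (h \<xi>))\<^sup>2) \<partial>lborel) * ?e R) \<longlongrightarrow>
      (\<integral>\<^sup>+\<xi>. ennreal ((cmod (h \<xi>))\<^sup>2) \<partial>lborel) * 0) at_top"
    using ft fin unfolding has_fourier_transform_def by (intro ennreal_tendsto_cmult) auto
  then have lim: "((\<lambda>R. ?e R * (\<integral>\<^sup>+\<xi>. ennreal ((cmod (h \<xi>))\<^sup>2) \<partial>lborel)) \<longlongrightarrow> 0) at_top"
    by (simp add: mult.commute)
  have "((\<lambda>R. ennreal ((cmod (?d R))\<^sup>2)) \<longlongrightarrow> ennreal 0) at_top"
    unfolding ennreal_0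
  proof (rule tendsto_sandwich[OF _ _ tendsto_const lim])
    show "\<forall>\<^sub>F R in at_top. ennreal ((cmod (?d R))\<^sup>2) \<le> ?e R * (\<integral>\<^sup>+\<xi>. ennreal ((cmod (h \<xi>))\<^sup>2) \<partial>lborel)"
      using bound by (intro always_eventually allI) (simp only: ennreal_power norm_ge_zero)
  qed simp
  then have "((\<lambda>R. (cmod (?d R))\<^sup>2) \<longlongrightarrow> 0) at_top"
    by (subst (asm) tendsto_ennreal_iff) auto
  then have "((\<lambda>R. sqrt ((cmod (?d R))\<^sup>2)) \<longlongrightarrow> sqrt 0) at_top"
    by (rule tendsto_real_sqrt)
  then have "((\<lambda>R. ?d R) \<longlongrightarrow> 0) at_top"
    by (simp add: tendsto_norm_zero_iff)
  then show ?thesis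
    by (rule LIM_zero_cancel)
qed

text \<open>Fubini: on [-R, R] the square-integrable \<open>f\<close> is integrable, and the
  Gaussian is integrable in \<open>\<xi>\<close>. Since \<open>f\<close> need not be integrable on
  the whole line, the cutoff is kept until a limit can be taken.\<close>

lemma truncated_fourier_gaussian:
  assumes f: "square_integrable f" and e: "0 < e"
  shows "(LINT \<xi>|lborel. truncated_fourier f R \<xi> * (complex_of_real (exp (- (e * \<xi>)\<^sup>2 / 2)) * cis (x * \<xi>))) =
    complex_of_real (LINT y|lborel. indicat_real {-R..R} y * f y * (2 * pi * normal_density 0 e (x - y)))"
proof -
  have [measurable]: "f \<in> borel_measurable borel"
    using f unfolding square_integrable_def by auto
  let ?F = "\<lambda>y. indicat_real {-R..R} y * f y"
  let ?h = "\<lambda>\<xi>. complex_of_real (exp (- (e * \<xi>)\<^sup>2 / 2)) * cis (x * \<xi>)"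
  let ?k = "\<lambda>(\<xi>, y). complex_of_real (?F y) * (complex_of_real (exp (- (e * \<xi>)\<^sup>2 / 2)) * cis ((x - y) * \<xi>))"
  have F: "integrable lborel ?F"
    using f by (rule square_integrable_imp_integrable_Icc)
  have g: "integrable lborel (\<lambda>\<xi>. exp (- (e * \<xi>)\<^sup>2 / 2))"
    using e by (rule integrable_gaussian)
  have "integrable (lborel \<Otimes>\<^sub>M lborel) ?k"
  proof (rule lborel_pair.Fubini_integrable)
    show "?k \<in> borel_measurable (lborel \<Otimes>\<^sub>M lborel)"
      by measurable
    have "integrable lborel (\<lambda>\<xi>. (LINT y|lborel. \<bar>?F y\<bar>) * exp (- (e * \<xi>)\<^sup>2 / 2))"
      by (rule integrable_mult_right) (rule g)
    also have "(\<lambda>\<xi>. (LINT y|lborel. \<bar>?F y\<bar>) * exp (- (e * \<xi>)\<^sup>2 / 2)) = (\<lambda>\<xi>. (LINT y|lborel. norm (?k (\<xi>, y))))"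
      by (simp add: norm_mult abs_mult)
    finally show "integrable lborel (\<lambda>\<xi>. (LINT y|lborel. norm (?k (\<xi>, y))))" .
    show "AE \<xi> in lborel. integrable lborel (\<lambda>y. ?k (\<xi>, y))"
    proof (rule AE_I2)
      fix \<xi>
      have "integrable lborel (\<lambda>y. ?F y * exp (- (e * \<xi>)\<^sup>2 / 2))"
        by (rule integrable_mult_left) (rule F)
      then show "integrable lborel (\<lambda>y. ?k (\<xi>, y))"
        by (rule Bochner_Integration.integrable_bound) (auto simp: norm_mult abs_mult)
    qed
  qed
  then have "(LINT y|lborel. (LINT \<xi>|lborel. ?k (\<xi>, y))) = (LINT \<xi>|lborel. (LINT y|lborel. ?k (\<xi>, y)))"
    by (intro lborel_pair.Fubini_integral) simp
  also have "\<dots> = (LINT \<xi>|lborel. truncated_fourier f R \<xi> * ?h \<xi>)"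
  proof (rule Bochner_Integration.integral_cong[OF refl])
    fix \<xi>
    have "(LINT y|lborel. ?k (\<xi>, y)) = (LINT y|lborel. indicat_real {-R..R} y *\<^sub>R (complex_of_real (f y) * cis (- (\<xi> * y))) * ?h \<xi>)"
    proof (rule Bochner_Integration.integral_cong[OF refl])
      fix y
      have "cis ((x - y) * \<xi>) = cis (- (\<xi> * y)) * cis (x * \<xi>)"
        by (simp add: cis_mult algebra_simps)
      then show "?k (\<xi>, y) = indicat_real {-R..R} y *\<^sub>R (complex_of_real (f y) * cis (- (\<xi> * y))) * ?h \<xi>"
        by (simp add: scaleR_conv_of_real mult.assoc)
    qed
    also have "\<dots> = truncated_fourier f R \<xi> * ?h \<xi>"
      unfolding truncated_fourier_def set_lebesgue_integral_def by (rule integral_mult_left_zero)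
    finally show "(LINT y|lborel. ?k (\<xi>, y)) = truncated_fourier f R \<xi> * ?h \<xi>" .
  qed
  finally have "(LINT \<xi>|lborel. truncated_fourier f R \<xi> * ?h \<xi>) = (LINT y|lborel. (LINT \<xi>|lborel. ?k (\<xi>, y)))"
    by simp
  also have "\<dots> = (LINT y|lborel. complex_of_real (?F y * (2 * pi * normal_density 0 e (x - y))))"
    unfolding prod.case integral_mult_right_zero gaussian_integral_cis[OF e]
    by (simp only: of_real_mult)
  also have "\<dots> = complex_of_real (LINT y|lborel. ?F y * (2 * pi * normal_density 0 e (x - y)))"
    by (rule integral_complex_of_real)
  finally show ?thesis .
qed

lemma square_integrable_normal_density:
  assumes "0 < e"
  shows "square_integrable (\<lambda>y. normal_density 0 e (x - y))"
  unfolding square_integrable_def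
proof
  have "integrable lborel (\<lambda>y. normal_density 0 e y)"
    using assms by simp
  then have "integrable lborel (\<lambda>y. normal_density 0 e (x + (-1) * y))"
    by (rule lborel_integrable_real_affine) simp
  then have "integrable lborel (\<lambda>y. 1 / sqrt (2 * pi * e\<^sup>2) * normal_density 0 e (x - y))"
    by simp
  then show "integrable lborel (\<lambda>y. (norm (normal_density 0 e (x - y)))\<^sup>2)"
  proof (rule Bochner_Integration.integrable_bound)
    have "(normal_density 0 e z)\<^sup>2 \<le> 1 / sqrt (2 * pi * e\<^sup>2) * normal_density 0 e z" for z
    proof -
      have "normal_density 0 e z \<le> 1 / sqrt (2 * pi * e\<^sup>2) * 1"
        unfolding normal_density_def by (intro mult_left_mono) auto
      then show ?thesis
        unfolding power2_eq_square by (intro mult_right_mono) auto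
    qed
    then show "AE y in lborel. norm ((norm (normal_density 0 e (x - y)))\<^sup>2) \<le> norm (1 / sqrt (2 * pi * e\<^sup>2) * normal_density 0 e (x - y))"
      by simp
  qed auto
qed auto

text \<open>The limit of the truncated identity as R grows: the left side converges by L^2 pairing,
  the right side by domination, because the product of \<open>f\<close> with the normal density is
  integrable.\<close>

lemma fourier_gaussian:
  assumes ft: "has_fourier_transform f g" and e: "0 < e"
  shows "(LINT \<xi>|lborel. g \<xi> * (complex_of_real (exp (- (e * \<xi>)\<^sup>2 / 2)) * cis (x * \<xi>))) =
    complex_of_real (2 * pi * (LINT y|lborel. f y * normal_density 0 e (x - y)))"
proof -
  have f: "square_integrable f" and [measurable]: "f \<in> borel_measurable borel"
    using ft unfolding has_fourier_transform_def square_integrable_def by auto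
  let ?h = "\<lambda>\<xi>. complex_of_real (exp (- (e * \<xi>)\<^sup>2 / 2)) * cis (x * \<xi>)"
  have fi: "integrable lborel (\<lambda>y. f y * normal_density 0 e (x - y))"
    using square_integrable_mult[OF f square_integrable_normal_density[OF e]] .
  have h1: "integrable lborel ?h"
    using integrable_gaussian[OF e] by (rule Bochner_Integration.integrable_bound) (auto simp: norm_mult)
  have "integrable lborel (\<lambda>\<xi>. (cmod (?h \<xi>))\<^sup>2)"
    using integrable_gaussian[OF e]
    by (rule Bochner_Integration.integrable_bound) (auto simp: norm_mult power2_eq_square mult_le_one)
  then have h2: "square_integrable ?h"
    unfolding square_integrable_def by simp
  have "((\<lambda>R. LINT \<xi>|lborel. truncated_fourier f R \<xi> * ?h \<xi>) \<longlongrightarrow> (LINT \<xi>|lborel. g \<xi> * ?h \<xi>)) at_top"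
    using ft h2 h1 by (rule fourier_pairing_tendsto)
  then have 1: "((\<lambda>R. complex_of_real (LINT y|lborel. indicat_real {-R..R} y * f y * (2 * pi * normal_density 0 e (x - y))))
      \<longlongrightarrow> (LINT \<xi>|lborel. g \<xi> * ?h \<xi>)) at_top"
    unfolding truncated_fourier_gaussian[OF f e] .
  have "((\<lambda>R. (LINT y|lborel. indicat_real {-R..R} y * f y * (2 * pi * normal_density 0 e (x - y))))
      \<longlongrightarrow> (LINT y|lborel. f y * (2 * pi * normal_density 0 e (x - y)))) at_top"
  proof (rule integral_dominated_convergence_at_top)
    have "integrable lborel (\<lambda>y. 2 * pi * \<bar>f y * normal_density 0 e (x - y)\<bar>)"
      using fi by (intro integrable_mult_right integrable_abs)
    then show "integrable lborel (\<lambda>y. 2 * pi * \<bar>f y * normal_density 0 e (x - y)\<bar>)" .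
    show "AE y in lborel. ((\<lambda>R. indicat_real {-R..R} y * f y * (2 * pi * normal_density 0 e (x - y))) \<longlongrightarrow> f y * (2 * pi * normal_density 0 e (x - y))) at_top"
    proof (rule AE_I2)
      fix y
      have "\<forall>\<^sub>F R in at_top. indicat_real {-R..R} y * f y * (2 * pi * normal_density 0 e (x - y)) = f y * (2 * pi * normal_density 0 e (x - y))"
        using eventually_ge_at_top[of "\<bar>y\<bar>"] by eventually_elim (auto simp: indicator_def)
      then show "((\<lambda>R. indicat_real {-R..R} y * f y * (2 * pi * normal_density 0 e (x - y))) \<longlongrightarrow> f y * (2 * pi * normal_density 0 e (x - y))) at_top"
        by (rule tendsto_eventually)
    qed
    show "\<forall>\<^sub>F R in at_top. AE y in lborel. norm (indicat_real {-R..R} y * f y * (2 * pi * normal_density 0 e (x - y))) \<le> 2 * pi * \<bar>f y * normal_density 0 e (x - y)\<bar>"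
      by (intro always_eventually allI AE_I2) (auto simp: indicator_def abs_mult)
  qed auto
  then have "((\<lambda>R. complex_of_real (LINT y|lborel. indicat_real {-R..R} y * f y * (2 * pi * normal_density 0 e (x - y))))
      \<longlongrightarrow> complex_of_real (LINT y|lborel. f y * (2 * pi * normal_density 0 e (x - y)))) at_top"
    by (rule tendsto_of_real)
  then have "(LINT \<xi>|lborel. g \<xi> * ?h \<xi>) = complex_of_real (LINT y|lborel. f y * (2 * pi * normal_density 0 e (x - y)))"
    using 1 by (intro tendsto_unique[OF _ 1]) auto
  also have "(LINT y|lborel. f y * (2 * pi * normal_density 0 e (x - y))) = (LINT y|lborel. (2 * pi) * (f y * normal_density 0 e (x - y)))"
    by (simp add: mult_ac)
  also have "\<dots> = 2 * pi * (LINT y|lborel. f y * normal_density 0 e (x - y))"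
    by (rule integral_mult_right_zero)
  finally show ?thesis .
qed

text \<open>The exponent z^2 / (2 e^2) is split into two equal halves. One gives exp (-u) \<le> 1 /
  u with u = d^2 / (4 e^2), which beats the 1 / e of the normalisation and leaves one factor e. The
  other, by e \<le> 1, is at least z^2 / 4 and provides a Gaussian weight of fixed width.\<close>

lemma normal_density_tail_le:
  assumes "0 < e" "e \<le> 1" "0 < d" "d \<le> \<bar>z\<bar>"
  shows "normal_density 0 e z \<le> (4 / (sqrt (2 * pi) * d\<^sup>2)) * e * exp (- z\<^sup>2 / 4)"
proof -
  have "d\<^sup>2 \<le> z\<^sup>2"
    using assms by (metis abs_le_square_iff abs_of_pos)
  let ?u = "d\<^sup>2 / (4 * e\<^sup>2)"
  have u: "0 < ?u" using assms by simp
  have "z\<^sup>2 / (2 * e\<^sup>2) = z\<^sup>2 / (4 * e\<^sup>2) + z\<^sup>2 / (4 * e\<^sup>2)"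
    by (simp add: field_simps)
  moreover have "?u \<le> z\<^sup>2 / (4 * e\<^sup>2)"
    using \<open>d\<^sup>2 \<le> z\<^sup>2\<close> by (intro divide_right_mono) auto
  moreover have "z\<^sup>2 / 4 \<le> z\<^sup>2 / (4 * e\<^sup>2)"
    using assms by (intro divide_left_mono) (auto simp: power_le_one)
  ultimately have "exp (- (z\<^sup>2 / (2 * e\<^sup>2))) \<le> exp (- ?u + - (z\<^sup>2 / 4))"
    unfolding exp_le_cancel_iff by linarith
  also have "\<dots> = exp (- ?u) * exp (- (z\<^sup>2 / 4))"
    by (rule exp_add)
  also have "\<dots> \<le> (1 / ?u) * exp (- (z\<^sup>2 / 4))"
  proof (rule mult_right_mono)
    have "?u \<le> exp ?u" using exp_ge_add_one_self[of ?u] by linarith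
    then show "exp (- ?u) \<le> 1 / ?u"
      using u unfolding exp_minus inverse_eq_divide by (intro divide_left_mono mult_pos_pos exp_gt_zero) (simp_all only: zero_le_one)
  qed simp
  finally have "exp (- (z\<^sup>2 / (2 * e\<^sup>2))) \<le> 4 * e\<^sup>2 / d\<^sup>2 * exp (- (z\<^sup>2 / 4))"
    by simp
  then have "1 / (sqrt (2 * pi) * e) * exp (- (z\<^sup>2 / (2 * e\<^sup>2))) \<le> 1 / (sqrt (2 * pi) * e) * (4 * e\<^sup>2 / d\<^sup>2 * exp (- (z\<^sup>2 / 4)))"
    by (rule mult_left_mono) (use assms in auto)
  moreover have "normal_density 0 e z = 1 / (sqrt (2 * pi) * e) * exp (- (z\<^sup>2 / (2 * e\<^sup>2)))"
    using assms by (simp add: normal_density_def real_sqrt_mult)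
  moreover have "1 / (sqrt (2 * pi) * e) * (4 * e\<^sup>2 / d\<^sup>2 * exp (- (z\<^sup>2 / 4))) = (4 / (sqrt (2 * pi) * d\<^sup>2)) * e * exp (- z\<^sup>2 / 4)"
    using assms by (simp add: field_simps power2_eq_square)
  ultimately show ?thesis
    by simp
qed

text \<open>\<open>f\<close> may be unbounded away from \<open>x\<close>, so continuity handles only
  |y - x| < d. Outside, the tail estimate bounds the integrand by \<open>e\<close> times the weight
  \<open>w\<close>, which is integrable and independent of \<open>e\<close>.\<close>

lemma gaussian_approximation:
  fixes f :: "real \<Rightarrow> real"
  assumes f: "square_integrable f" and cont: "isCont f x"
  shows "((\<lambda>e. LINT y|lborel. f y * normal_density 0 e (x - y)) \<longlongrightarrow> f x) (at_right 0)"
proof -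
  have [measurable]: "f \<in> borel_measurable borel"
    using f unfolding square_integrable_def by auto
  have nd: "integrable lborel (\<lambda>y. normal_density 0 e (x - y))" "(LINT y|lborel. normal_density 0 e (x - y)) = 1"
    if "0 < e" for e
  proof -
    have "integrable lborel (\<lambda>y. normal_density 0 e (x + (-1) * y))"
      using that by (intro lborel_integrable_real_affine) auto
    then show "integrable lborel (\<lambda>y. normal_density 0 e (x - y))" by simp
    have "(LINT y|lborel. normal_density 0 e y) = \<bar>-1\<bar> *\<^sub>R (LINT y|lborel. normal_density 0 e (x + (-1) * y))"
      by (rule lborel_integral_real_affine) simp
    then show "(LINT y|lborel. normal_density 0 e (x - y)) = 1"
      using that by simp
  qed
  have fn: "integrable lborel (\<lambda>y. f y * normal_density 0 e (x - y))" if "0 < e" for e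
    using f square_integrable_normal_density[OF that] by (rule square_integrable_mult)
  define w where "w y = (\<bar>f y\<bar> + \<bar>f x\<bar>) * exp (- (x - y)\<^sup>2 / 4)" for y
  \<comment> \<open>The weight of the tail estimate is an unnormalised normal density of standard
    deviation \<open>sqrt 2\<close>, hence square integrable and integrable against
    \<open>f\<close>.\<close>
  have e2: "exp (- z\<^sup>2 / 4) = 2 * sqrt pi * normal_density 0 (sqrt 2) z" for z :: real
    by (simp add: normal_density_def real_sqrt_mult)
  have w: "integrable lborel w"
  proof -
    have "integrable lborel (\<lambda>y. 2 * sqrt pi * \<bar>f y * normal_density 0 (sqrt 2) (x - y)\<bar> + 2 * sqrt pi * \<bar>f x\<bar> * normal_density 0 (sqrt 2) (x - y))"
      using fn[of "sqrt 2"] nd(1)[of "sqrt 2"]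
      by (intro Bochner_Integration.integrable_add integrable_mult_right integrable_abs) auto
    also have "(\<lambda>y. 2 * sqrt pi * \<bar>f y * normal_density 0 (sqrt 2) (x - y)\<bar> + 2 * sqrt pi * \<bar>f x\<bar> * normal_density 0 (sqrt 2) (x - y)) = w"
      unfolding w_def e2 by (auto simp: abs_mult algebra_simps)
    finally show ?thesis .
  qed
  define K where "K = (LINT y|lborel. w y)"
  have K: "0 \<le> K" unfolding K_def w_def by (intro Bochner_Integration.integral_nonneg) auto
  show ?thesis
  proof (rule tendstoI)
    fix r :: real assume r: "0 < r"
    obtain d where d: "0 < d" and near: "\<And>y. \<bar>y - x\<bar> < d \<Longrightarrow> \<bar>f y - f x\<bar> < r / 2"
      using cont r unfolding continuous_at_eps_delta dist_real_def
      by (meson half_gt_zero)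
    define C where "C = 4 / (sqrt (2 * pi) * d\<^sup>2)"
    have C: "0 < C" unfolding C_def using d by auto
    have main: "dist (LINT y|lborel. f y * normal_density 0 e (x - y)) (f x) \<le> r / 2 + C * e * K" if e: "0 < e" "e \<le> 1" for e
    proof -
      have eq0: "(LINT y|lborel. f y * normal_density 0 e (x - y)) - f x =
        (LINT y|lborel. f y * normal_density 0 e (x - y) - f x * normal_density 0 e (x - y))"
        using nd[OF e(1)] fn[OF e(1)] by simp
      have "\<bar>(LINT y|lborel. f y * normal_density 0 e (x - y)) - f x\<bar> \<le> (LINT y|lborel. \<bar>f y * normal_density 0 e (x - y) - f x * normal_density 0 e (x - y)\<bar>)"
        unfolding eq0 by (rule integral_abs_bound)
      also have "\<dots> \<le> (LINT y|lborel. r / 2 * normal_density 0 e (x - y) + C * e * w y)"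
      proof (rule integral_mono)
        show "integrable lborel (\<lambda>y. \<bar>f y * normal_density 0 e (x - y) - f x * normal_density 0 e (x - y)\<bar>)"
          by (rule integrable_abs[OF Bochner_Integration.integrable_diff[OF fn[OF e(1)] integrable_mult_right[OF nd(1)[OF e(1)]]]])
        show "integrable lborel (\<lambda>y. r / 2 * normal_density 0 e (x - y) + C * e * w y)"
          by (rule Bochner_Integration.integrable_add[OF integrable_mult_right[OF nd(1)[OF e(1)]] integrable_mult_right[OF w]])
        fix y
        have wn: "0 \<le> w y" unfolding w_def by auto
        have eq: "\<bar>f y * normal_density 0 e (x - y) - f x * normal_density 0 e (x - y)\<bar> = \<bar>f y - f x\<bar> * normal_density 0 e (x - y)"
          by (simp add: abs_mult flip: left_diff_distrib)
        show "\<bar>f y * normal_density 0 e (x - y) - f x * normal_density 0 e (x - y)\<bar> \<le> r / 2 * normal_density 0 e (x - y) + C * e * w y"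
        proof (cases "\<bar>y - x\<bar> < d")
          case True
          then have "\<bar>f y - f x\<bar> * normal_density 0 e (x - y) \<le> r / 2 * normal_density 0 e (x - y)"
            using near[OF True] by (intro mult_right_mono) auto
          moreover have "0 \<le> C * e * w y" using C e wn by simp
          ultimately show ?thesis unfolding eq by linarith
        next
          case False
          then have "normal_density 0 e (x - y) \<le> C * e * exp (- (x - y)\<^sup>2 / 4)"
            unfolding C_def using e d by (intro normal_density_tail_le) auto
          then have "\<bar>f y - f x\<bar> * normal_density 0 e (x - y) \<le> (\<bar>f y\<bar> + \<bar>f x\<bar>) * (C * e * exp (- (x - y)\<^sup>2 / 4))"
            by (intro mult_mono) auto
          also have "\<dots> = C * e * w y"
            unfolding w_def by (simp add: mult_ac)
          finally show ?thesis unfolding eq using r by (smt (verit) mult_nonneg_nonneg normal_density_nonneg half_gt_zero)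
        qed
      qed
      also have "\<dots> = r / 2 + C * e * K"
        using nd[OF e(1)] w unfolding K_def by simp
      finally show ?thesis
        by (simp add: dist_real_def)
    qed
    have "((\<lambda>e. r / 2 + C * e * K) \<longlongrightarrow> r / 2 + C * 0 * K) (at_right 0)"
      by (intro tendsto_intros)
    then have "\<forall>\<^sub>F e in at_right 0. r / 2 + C * e * K < r"
      by (rule order_tendstoD(2)) (use r in simp)
    moreover have "\<forall>\<^sub>F e in at_right (0::real). e \<le> 1 \<and> 0 < e"
      unfolding eventually_at_right_field by (rule exI[of _ 1]) auto
    ultimately show "\<forall>\<^sub>F e in at_right 0. dist (LINT y|lborel. f y * normal_density 0 e (x - y)) (f x) < r"
      by eventually_elim (use main in force)
  qed
qed

text \<open>
  Testing the transform against the Gaussian and letting the Gaussian spread out avoids the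
  Plancherel theorem.
\<close>

lemma fourier_inversion:
  assumes ft: "has_fourier_transform f g" and cont: "isCont f x" and g: "integrable lborel g"
  shows "complex_of_real (2 * pi * f x) = (LINT \<xi>|lborel. g \<xi> * cis (x * \<xi>))"
proof -
  have f: "square_integrable f"
    using ft unfolding has_fourier_transform_def by auto
  have [measurable]: "g \<in> borel_measurable borel"
    using ft unfolding has_fourier_transform_def square_integrable_def by auto
  define X where "X n = 1 / real (Suc n)" for n
  have X: "X \<longlonglongrightarrow> 0" unfolding X_def by (rule lim_const_over_n[of 1, THEN LIMSEQ_Suc])
  then have "filterlim X (at_right 0) sequentially"
    unfolding filterlim_at X_def by (auto simp: X_def)
  then have "(\<lambda>n. LINT y|lborel. f y * normal_density 0 (X n) (x - y)) \<longlonglongrightarrow> f x"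
    using gaussian_approximation[OF f cont] by (rule filterlim_compose[rotated])
  then have 1: "(\<lambda>n. complex_of_real (2 * pi * (LINT y|lborel. f y * normal_density 0 (X n) (x - y)))) \<longlonglongrightarrow> complex_of_real (2 * pi * f x)"
    by (intro tendsto_of_real tendsto_mult_left)
  have "(\<lambda>n. LINT \<xi>|lborel. g \<xi> * (complex_of_real (exp (- (X n * \<xi>)\<^sup>2 / 2)) * cis (x * \<xi>))) \<longlonglongrightarrow> (LINT \<xi>|lborel. g \<xi> * cis (x * \<xi>))"
  proof (rule integral_dominated_convergence)
    show "integrable lborel (\<lambda>\<xi>. cmod (g \<xi>))" using g by auto
    show "AE \<xi> in lborel. (\<lambda>n. g \<xi> * (complex_of_real (exp (- (X n * \<xi>)\<^sup>2 / 2)) * cis (x * \<xi>))) \<longlonglongrightarrow> g \<xi> * cis (x * \<xi>)"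
    proof (rule AE_I2)
      fix \<xi>
      have "(\<lambda>n. g \<xi> * (complex_of_real (exp (- (X n * \<xi>)\<^sup>2 / 2)) * cis (x * \<xi>))) \<longlonglongrightarrow> g \<xi> * (complex_of_real (exp (- (0 * \<xi>)\<^sup>2 / 2)) * cis (x * \<xi>))"
        by (intro tendsto_intros X) auto
      then show "(\<lambda>n. g \<xi> * (complex_of_real (exp (- (X n * \<xi>)\<^sup>2 / 2)) * cis (x * \<xi>))) \<longlonglongrightarrow> g \<xi> * cis (x * \<xi>)"
        by simp
    qed
    show "AE \<xi> in lborel. cmod (g \<xi> * (complex_of_real (exp (- (X n * \<xi>)\<^sup>2 / 2)) * cis (x * \<xi>))) \<le> cmod (g \<xi>)" for n
      by (auto simp: norm_mult intro!: mult_left_le)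
  qed auto
  moreover have "0 < X n" for n unfolding X_def by simp
  ultimately have "(\<lambda>n. complex_of_real (2 * pi * (LINT y|lborel. f y * normal_density 0 (X n) (x - y)))) \<longlonglongrightarrow> (LINT \<xi>|lborel. g \<xi> * cis (x * \<xi>))"
    by (simp only: fourier_gaussian[OF ft])
  then show ?thesis
    using 1 by (rule LIMSEQ_unique[rotated])
qed

section \<open>Sobolev embedding\<close>

text \<open>Comparison with 1 on [-1, 1] and with |\<xi>| to the power -2 \<sigma> outside. The
  threshold 1/2 is the origin of s > 1/2 for sup bounds and of s > 3/2 for bounds on the
  derivative.\<close>

lemma integrable_japanese_bracket:
  assumes "\<sigma> > 1 / 2"
  shows "integrable lborel (\<lambda>\<xi>::real. (1 + \<xi>\<^sup>2) powr (- \<sigma>))"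
proof -
  have m: "(\<lambda>\<xi>::real. \<xi> powr (- 2 * \<sigma>)) absolutely_integrable_on {1..}"
    using has_integral_powr_to_inf[of "- 2 * \<sigma>" 1] assms
    by (intro nonnegative_absolutely_integrable_1) (auto simp: has_integral_integrable)
  have p: "integrable lborel (\<lambda>\<xi>::real. indicat_real {1..} \<xi> *\<^sub>R (\<xi> powr (- 2 * \<sigma>)))"
    using m unfolding set_integrable_def by (subst (asm) integrable_completion) auto
  from lborel_integrable_real_affine[OF this, of "-1" 0]
  \<comment> \<open>The left tail is the reflection of the right one.\<close>
  have n: "integrable lborel (\<lambda>\<xi>::real. indicat_real {1..} (- \<xi>) *\<^sub>R ((- \<xi>) powr (- 2 * \<sigma>)))"
    by simp
  have i: "integrable lborel (indicat_real {-1..1::real})"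
    by (rule integrable_real_indicator) (auto simp: emeasure_lborel_Icc_eq)
  have "integrable lborel (\<lambda>\<xi>::real. indicat_real {-1..1} \<xi> + indicat_real {1..} \<xi> *\<^sub>R (\<xi> powr (- 2 * \<sigma>)) + indicat_real {1..} (- \<xi>) *\<^sub>R ((- \<xi>) powr (- 2 * \<sigma>)))"
    by (intro Bochner_Integration.integrable_add i p n)
  then show ?thesis
  proof (rule Bochner_Integration.integrable_bound)
    have b: "(1 + \<xi>\<^sup>2) powr (- \<sigma>) \<le> \<xi> powr (- 2 * \<sigma>)" if "1 \<le> \<xi>" for \<xi> :: real
    proof -
      have "(1 + \<xi>\<^sup>2) powr (- \<sigma>) \<le> (\<xi>\<^sup>2) powr (- \<sigma>)"
        using that assms by (intro powr_mono2') auto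
      also have "\<dots> = \<xi> powr (- 2 * \<sigma>)"
        using that by (simp add: powr_powr flip: powr_numeral)
      finally show ?thesis .
    qed
    have c: "(1 + \<xi>\<^sup>2) powr (- \<sigma>) \<le> 1" for \<xi> :: real
      using powr_mono2'[of "- \<sigma>" 1 "1 + \<xi>\<^sup>2"] assms by simp
    have "(1 + \<xi>\<^sup>2) powr (- \<sigma>) \<le> indicat_real {-1..1} \<xi> + indicat_real {1..} \<xi> *\<^sub>R (\<xi> powr (- 2 * \<sigma>)) + indicat_real {1..} (- \<xi>) *\<^sub>R ((- \<xi>) powr (- 2 * \<sigma>))" for \<xi>
      using b[of \<xi>] b[of "-\<xi>"] c[of \<xi>] by (auto simp: indicator_def add_nonneg_nonneg)
    then show "AE \<xi> in lborel. norm ((1 + \<xi>\<^sup>2) powr (- \<sigma>)) \<le> norm (indicat_real {-1..1} \<xi> + indicat_real {1..} \<xi> *\<^sub>R (\<xi> powr (- 2 * \<sigma>)) + indicat_real {1..} (- \<xi>) *\<^sub>R ((- \<xi>) powr (- 2 * \<sigma>)))"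
      by (intro AE_I2) (smt (verit) powr_ge_zero real_norm_def)
  qed simp
qed

text \<open>The constant that Cauchy-Schwarz produces in the embedding: inversion contributes 1 / (2
  pi), and undoing the normalisation of \<open>sobolev_norm\<close> contributes
  \<open>sqrt (2 * pi)\<close>.\<close>

definition embedding_constant :: "real \<Rightarrow> real" where
  "embedding_constant \<sigma> = sqrt (LINT \<xi>|lborel. (1 + \<xi>\<^sup>2) powr (- \<sigma>)) / sqrt (2 * pi)"

text \<open>Cauchy-Schwarz for the factorisation of the weight with exponent k / 2 into exponents
  -(s - k) / 2 and s / 2. Here \<open>k\<close> counts derivatives; only 0 and 1 are used.\<close>

lemma weighted_fourier_integrable:
  fixes g :: "real \<Rightarrow> complex"
  assumes \<sigma>: "s - k > 1 / 2"
    and [measurable]: "g \<in> borel_measurable borel"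
    and g: "integrable lborel (\<lambda>\<xi>. (1 + \<xi>\<^sup>2) powr s * (cmod (g \<xi>))\<^sup>2)"
  shows "integrable lborel (\<lambda>\<xi>. (1 + \<xi>\<^sup>2) powr (k / 2) * cmod (g \<xi>))"
    and "(LINT \<xi>|lborel. (1 + \<xi>\<^sup>2) powr (k / 2) * cmod (g \<xi>)) \<le>
      2 * pi * (embedding_constant (s - k) * sqrt ((LINT \<xi>|lborel. (1 + \<xi>\<^sup>2) powr s * (cmod (g \<xi>))\<^sup>2) / (2 * pi)))"
proof -
  let ?a = "\<lambda>\<xi>::real. (1 + \<xi>\<^sup>2) powr (- (s - k) / 2)"
  let ?b = "\<lambda>\<xi>::real. (1 + \<xi>\<^sup>2) powr (s / 2) * cmod (g \<xi>)"
  have sq: "((1 + \<xi>\<^sup>2) powr r)\<^sup>2 = (1 + \<xi>\<^sup>2) powr (2 * r)" for \<xi> r :: real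
    by (simp add: power2_eq_square flip: powr_add)
  have a2: "(?a \<xi>)\<^sup>2 = (1 + \<xi>\<^sup>2) powr (- (s - k))" for \<xi>
  proof -
    have "2 * (- (s - k) / 2) = - (s - k)" by simp
    then show ?thesis unfolding sq by (rule arg_cong)
  qed
  have b2: "(?b \<xi>)\<^sup>2 = (1 + \<xi>\<^sup>2) powr s * (cmod (g \<xi>))\<^sup>2" for \<xi>
    unfolding power_mult_distrib sq by simp
  have ab: "?a \<xi> * ?b \<xi> = (1 + \<xi>\<^sup>2) powr (k / 2) * cmod (g \<xi>)" for \<xi>
    by (simp add: diff_divide_distrib flip: powr_add mult.assoc)
  have a: "square_integrable ?a"
    unfolding square_integrable_def real_norm_def power2_abs a2
    using integrable_japanese_bracket[OF \<sigma>] by auto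
  have b: "square_integrable ?b"
    unfolding square_integrable_def real_norm_def power2_abs b2
    using g by auto
  from square_integrable_mult[OF a b]
  show "integrable lborel (\<lambda>\<xi>. (1 + \<xi>\<^sup>2) powr (k / 2) * cmod (g \<xi>))"
    unfolding ab .
  have "(LINT \<xi>|lborel. (1 + \<xi>\<^sup>2) powr (k / 2) * cmod (g \<xi>)) = (LINT \<xi>|lborel. \<bar>?a \<xi>\<bar> * \<bar>?b \<xi>\<bar>)"
    unfolding ab abs_mult[symmetric] by (simp add: abs_mult)
  also have "\<dots> \<le> sqrt (LINT \<xi>|lborel. (?a \<xi>)\<^sup>2) * sqrt (LINT \<xi>|lborel. (?b \<xi>)\<^sup>2)"
    using a b by (rule cauchy_schwarz_real_integral)
  also have "\<dots> = 2 * pi * (embedding_constant (s - k) * sqrt ((LINT \<xi>|lborel. (1 + \<xi>\<^sup>2) powr s * (cmod (g \<xi>))\<^sup>2) / (2 * pi)))"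
    unfolding embedding_constant_def a2 b2 real_sqrt_divide by (simp add: field_simps)
  finally show "(LINT \<xi>|lborel. (1 + \<xi>\<^sup>2) powr (k / 2) * cmod (g \<xi>)) \<le>
      2 * pi * (embedding_constant (s - k) * sqrt ((LINT \<xi>|lborel. (1 + \<xi>\<^sup>2) powr s * (cmod (g \<xi>))\<^sup>2) / (2 * pi)))" .
qed

lemma sobolev_space_lincomb:
  assumes "f \<in> sobolev_space s" "g \<in> sobolev_space s"
  shows "(\<lambda>x. a * f x + b * g x) \<in> sobolev_space s"
proof -
  obtain f' g' where f: "has_fourier_transform f f'" "integrable lborel (\<lambda>\<xi>. (1 + \<xi>\<^sup>2) powr s * (cmod (f' \<xi>))\<^sup>2)"
    and g: "has_fourier_transform g g'" "integrable lborel (\<lambda>\<xi>. (1 + \<xi>\<^sup>2) powr s * (cmod (g' \<xi>))\<^sup>2)"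
    using assms unfolding sobolev_space_def by auto
  have [measurable]: "f' \<in> borel_measurable borel" "g' \<in> borel_measurable borel"
    using f(1) g(1) unfolding has_fourier_transform_def square_integrable_def by auto
  let ?h = "\<lambda>\<xi>. a * f' \<xi> + b * g' \<xi>"
  have "integrable lborel (\<lambda>\<xi>. 2 * a\<^sup>2 * ((1 + \<xi>\<^sup>2) powr s * (cmod (f' \<xi>))\<^sup>2) + 2 * b\<^sup>2 * ((1 + \<xi>\<^sup>2) powr s * (cmod (g' \<xi>))\<^sup>2))"
    by (rule Bochner_Integration.integrable_add[OF integrable_mult_right[OF f(2)] integrable_mult_right[OF g(2)]])
  then have "integrable lborel (\<lambda>\<xi>. (1 + \<xi>\<^sup>2) powr s * (cmod (?h \<xi>))\<^sup>2)"
  proof (rule Bochner_Integration.integrable_bound)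
    have "(1 + \<xi>\<^sup>2) powr s * (cmod (?h \<xi>))\<^sup>2 \<le> 2 * a\<^sup>2 * ((1 + \<xi>\<^sup>2) powr s * (cmod (f' \<xi>))\<^sup>2) + 2 * b\<^sup>2 * ((1 + \<xi>\<^sup>2) powr s * (cmod (g' \<xi>))\<^sup>2)" for \<xi>
    proof -
      have "ennreal ((cmod (?h \<xi>))\<^sup>2) \<le> ennreal (2 * a\<^sup>2 * (cmod (f' \<xi>))\<^sup>2 + 2 * b\<^sup>2 * (cmod (g' \<xi>))\<^sup>2)"
        using ennreal_norm_lincomb_square_le[of a "f' \<xi>" b "g' \<xi>"]
        by (simp add: ennreal_mult)
      then have "(cmod (?h \<xi>))\<^sup>2 \<le> 2 * a\<^sup>2 * (cmod (f' \<xi>))\<^sup>2 + 2 * b\<^sup>2 * (cmod (g' \<xi>))\<^sup>2"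
        by (subst (asm) ennreal_le_iff) auto
      then have "(1 + \<xi>\<^sup>2) powr s * (cmod (?h \<xi>))\<^sup>2 \<le> (1 + \<xi>\<^sup>2) powr s * (2 * a\<^sup>2 * (cmod (f' \<xi>))\<^sup>2 + 2 * b\<^sup>2 * (cmod (g' \<xi>))\<^sup>2)"
        by (rule mult_left_mono) simp
      then show ?thesis
        by (simp add: algebra_simps)
    qed
    then show "AE \<xi> in lborel. norm ((1 + \<xi>\<^sup>2) powr s * (cmod (?h \<xi>))\<^sup>2) \<le> norm (2 * a\<^sup>2 * ((1 + \<xi>\<^sup>2) powr s * (cmod (f' \<xi>))\<^sup>2) + 2 * b\<^sup>2 * ((1 + \<xi>\<^sup>2) powr s * (cmod (g' \<xi>))\<^sup>2))"
      by (intro AE_I2) auto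
  qed measurable
  then show ?thesis
    using has_fourier_transform_lincomb[OF f(1) g(1)] unfolding sobolev_space_def by blast
qed

text \<open>Membership supplies some transform, so the \<open>SOME\<close> in
  \<open>fourier_transform\<close> picks a genuine one; uniqueness up to null sets carries the
  weighted integrability over to it.\<close>

lemma sobolev_space_fourier_transform:
  assumes "f \<in> sobolev_space s"
  shows "has_fourier_transform f (fourier_transform f)"
    and "integrable lborel (\<lambda>\<xi>. (1 + \<xi>\<^sup>2) powr s * (cmod (fourier_transform f \<xi>))\<^sup>2)"
proof -
  obtain f' where f: "has_fourier_transform f f'" "integrable lborel (\<lambda>\<xi>. (1 + \<xi>\<^sup>2) powr s * (cmod (f' \<xi>))\<^sup>2)"
    using assms unfolding sobolev_space_def by auto
  show 1: "has_fourier_transform f (fourier_transform f)"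
    unfolding fourier_transform_def by (rule someI[of "has_fourier_transform f", OF f(1)])
  have [measurable]: "f' \<in> borel_measurable borel" "fourier_transform f \<in> borel_measurable borel"
    using f(1) 1 unfolding has_fourier_transform_def square_integrable_def by auto
  have "AE \<xi> in lborel. (1 + \<xi>\<^sup>2) powr s * (cmod (f' \<xi>))\<^sup>2 = (1 + \<xi>\<^sup>2) powr s * (cmod (fourier_transform f \<xi>))\<^sup>2"
    using has_fourier_transform_unique[OF f(1) 1] by eventually_elim simp
  then show "integrable lborel (\<lambda>\<xi>. (1 + \<xi>\<^sup>2) powr s * (cmod (fourier_transform f \<xi>))\<^sup>2)"
    using f(2) by (subst (asm) integrable_cong_AE) auto
qed

text \<open>Both functions have the same set of Fourier transforms, so the \<open>SOME\<close>
  operator chooses the very same one for each, and the norms coincide exactly.\<close>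

lemma sobolev_cong_AE:
  assumes f: "f \<in> sobolev_space s" and ae: "AE x in lborel. f x = f' x"
    and f': "f' \<in> borel_measurable borel"
  shows "f' \<in> sobolev_space s" and "sobolev_norm s f' = sobolev_norm s f"
proof -
  have b: "f \<in> borel_measurable borel"
    using f unfolding sobolev_space_def has_fourier_transform_def square_integrable_def by auto
  have ae': "AE x in lborel. f' x = f x"
    using ae by eventually_elim simp
  have eq: "has_fourier_transform f g \<longleftrightarrow> has_fourier_transform f' g" for g
    using has_fourier_transform_cong_AE[OF _ ae f'] has_fourier_transform_cong_AE[OF _ ae' b] by blast
  show "f' \<in> sobolev_space s" using f by (simp add: sobolev_space_def eq)
  show "sobolev_norm s f' = sobolev_norm s f"
    by (simp add: sobolev_norm_def fourier_transform_def eq)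
qed

lemma sobolev_fourier_L1:
  assumes "f \<in> sobolev_space s" and "s - k > 1 / 2"
  shows "integrable lborel (\<lambda>\<xi>. (1 + \<xi>\<^sup>2) powr (k / 2) * cmod (fourier_transform f \<xi>))"
    and "(LINT \<xi>|lborel. (1 + \<xi>\<^sup>2) powr (k / 2) * cmod (fourier_transform f \<xi>)) \<le>
      2 * pi * (embedding_constant (s - k) * sobolev_norm s f)"
proof -
  have "fourier_transform f \<in> borel_measurable borel"
    using sobolev_space_fourier_transform[OF assms(1)]
    unfolding has_fourier_transform_def square_integrable_def by auto
  from weighted_fourier_integrable[OF assms(2) this sobolev_space_fourier_transform(2)[OF assms(1)]]
  show "integrable lborel (\<lambda>\<xi>. (1 + \<xi>\<^sup>2) powr (k / 2) * cmod (fourier_transform f \<xi>))"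
    and "(LINT \<xi>|lborel. (1 + \<xi>\<^sup>2) powr (k / 2) * cmod (fourier_transform f \<xi>)) \<le>
      2 * pi * (embedding_constant (s - k) * sobolev_norm s f)"
    unfolding sobolev_norm_def by blast+
qed

lemma sobolev_inversion:
  assumes f: "f \<in> sobolev_space s" and s: "s > 1 / 2" and cont: "isCont f x"
  shows "complex_of_real (2 * pi * f x) = (LINT \<xi>|lborel. fourier_transform f \<xi> * cis (x * \<xi>))"
    and "integrable lborel (fourier_transform f)"
proof -
  note ft = sobolev_space_fourier_transform(1)[OF f]
  have m [measurable]: "fourier_transform f \<in> borel_measurable borel"
    using ft unfolding has_fourier_transform_def square_integrable_def by auto
  have "integrable lborel (\<lambda>\<xi>. (1 + \<xi>\<^sup>2) powr (0 / 2) * cmod (fourier_transform f \<xi>))"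
    using sobolev_fourier_L1(1)[OF f, of 0] s by simp
  then show i: "integrable lborel (fourier_transform f)"
    \<comment> \<open>With k = 0 the weight is 1: the base is positive, so the exceptional value
      \<open>0 powr 0 = 0\<close> does not occur.\<close>
    by (rule Bochner_Integration.integrable_bound) (auto intro!: AE_I2 simp: powr_def add_nonneg_eq_0_iff)
  show "complex_of_real (2 * pi * f x) = (LINT \<xi>|lborel. fourier_transform f \<xi> * cis (x * \<xi>))"
    using ft cont i by (rule fourier_inversion)
qed

lemma sobolev_sup_bound:
  assumes f: "f \<in> sobolev_space s" and s: "s > 1 / 2" and cont: "isCont f x"
  shows "\<bar>f x\<bar> \<le> embedding_constant s * sobolev_norm s f"
proof -
  have "2 * pi * \<bar>f x\<bar> = cmod (complex_of_real (2 * pi * f x))"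
    by (simp only: norm_of_real abs_mult) simp
  also have "\<dots> = cmod (LINT \<xi>|lborel. fourier_transform f \<xi> * cis (x * \<xi>))"
    using sobolev_inversion(1)[OF assms] by simp
  also have "\<dots> \<le> (LINT \<xi>|lborel. (1 + \<xi>\<^sup>2) powr (0 / 2) * cmod (fourier_transform f \<xi>))"
    by (rule order_trans[OF integral_norm_bound]) (simp add: norm_mult powr_def add_nonneg_eq_0_iff)
  also have "\<dots> \<le> 2 * pi * (embedding_constant (s - 0) * sobolev_norm s f)"
    by (rule sobolev_fourier_L1(2)[OF f]) (use s in simp)
  finally show ?thesis
    by simp
qed

section \<open>Continuity and differentiation of Fourier integrals\<close>

lemma isCont_fourier_integral:
  fixes g :: "real \<Rightarrow> complex"
  assumes g: "integrable lborel g"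
  shows "isCont (\<lambda>x. LINT \<xi>|lborel. g \<xi> * cis (x * \<xi>)) x"
  unfolding continuous_at_sequentially comp_def
proof (intro allI impI)
  fix X :: "nat \<Rightarrow> real" assume X: "X \<longlonglongrightarrow> x"
  have [measurable]: "g \<in> borel_measurable borel"
    using borel_measurable_integrable[OF g] by simp
  show "(\<lambda>n. LINT \<xi>|lborel. g \<xi> * cis (X n * \<xi>)) \<longlonglongrightarrow> (LINT \<xi>|lborel. g \<xi> * cis (x * \<xi>))"
  proof (rule integral_dominated_convergence)
    show "integrable lborel (\<lambda>\<xi>. cmod (g \<xi>))" using g by auto
    show "AE \<xi> in lborel. (\<lambda>n. g \<xi> * cis (X n * \<xi>)) \<longlonglongrightarrow> g \<xi> * cis (x * \<xi>)"
      by (intro AE_I2 tendsto_intros X)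
  qed (auto simp: norm_mult)
qed

lemma cmod_cis_diff_le: "cmod (cis a - cis b) \<le> \<bar>a - b\<bar>"
proof -
  have "cis a - cis b = cis b * (iexp (a - b) - 1)"
    by (simp add: right_diff_distrib cis_mult flip: cis_conv_exp of_real_diff)
  then have "cmod (cis a - cis b) = cmod (iexp (a - b) - 1)"
    by (simp add: norm_mult)
  also have "\<dots> \<le> \<bar>a - b\<bar>"
    using iexp_approx1[of "a - b" 0] by simp
  finally show ?thesis .
qed

lemma has_vector_derivative_iff_quotient:
  "(f has_vector_derivative D) (at x within S) \<longleftrightarrow>
    ((\<lambda>y. (f y - f x) /\<^sub>R (y - x)) \<longlongrightarrow> D) (at x within S)"
proof -
  have eq: "norm ((f y - f x) - (y - x) *\<^sub>R D) / norm (y - x) = norm ((f y - f x) /\<^sub>R (y - x) - D)"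
    if "y \<noteq> x" for y
  proof -
    have "(f y - f x) - (y - x) *\<^sub>R D = (y - x) *\<^sub>R ((f y - f x) /\<^sub>R (y - x) - D)"
      using that by (simp add: scaleR_diff_right)
    then have "norm ((f y - f x) - (y - x) *\<^sub>R D) = norm (y - x) * norm ((f y - f x) /\<^sub>R (y - x) - D)"
      by (simp only: norm_scaleR real_norm_def)
    then show ?thesis
      using that by simp
  qed
  have "(f has_vector_derivative D) (at x within S) \<longleftrightarrow>
      ((\<lambda>y. norm ((f y - f x) - (y - x) *\<^sub>R D) / norm (y - x)) \<longlongrightarrow> 0) (at x within S)"
    unfolding has_vector_derivative_def has_derivative_iff_norm by (simp add: bounded_linear_scaleR_left)
  also have "\<dots> \<longleftrightarrow> ((\<lambda>y. norm ((f y - f x) /\<^sub>R (y - x) - D)) \<longlongrightarrow> 0) (at x within S)"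
    by (intro tendsto_cong, unfold eventually_at_filter, intro always_eventually allI impI, rule eq)
  also have "\<dots> \<longleftrightarrow> ((\<lambda>y. (f y - f x) /\<^sub>R (y - x)) \<longlongrightarrow> D) (at x within S)"
    by (simp add: tendsto_norm_zero_iff LIM_zero_iff)
  finally show ?thesis .
qed

text \<open>Since \<open>cis\<close> is 1-Lipschitz, the difference quotients of
  \<open>cis (x * \<xi>)\<close> in \<open>x\<close> are bounded by |\<xi>|; thus
  \<open>\<xi> * g \<xi>\<close> dominates, and the derivative passes under the integral along every
  sequence.\<close>

lemma DERIV_fourier_integral:
  fixes g :: "real \<Rightarrow> complex"
  assumes g: "integrable lborel g" and g': "integrable lborel (\<lambda>\<xi>. \<xi> * g \<xi>)"
  shows "((\<lambda>x. LINT \<xi>|lborel. g \<xi> * cis (x * \<xi>)) has_vector_derivative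
    (LINT \<xi>|lborel. \<i> * (\<xi> * g \<xi>) * cis (x * \<xi>))) (at x)"
proof -
  have [measurable]: "g \<in> borel_measurable borel"
    using borel_measurable_integrable[OF g] by simp
  let ?D = "LINT \<xi>|lborel. \<i> * (\<xi> * g \<xi>) * cis (x * \<xi>)"
  have int: "integrable lborel (\<lambda>\<xi>. g \<xi> * cis (y * \<xi>))" for y
    using g by (rule Bochner_Integration.integrable_bound) (auto simp: norm_mult)
  have "((\<lambda>y. ((LINT \<xi>|lborel. g \<xi> * cis (y * \<xi>)) - (LINT \<xi>|lborel. g \<xi> * cis (x * \<xi>))) /\<^sub>R (y - x)) \<longlongrightarrow> ?D) (at x)"
    unfolding tendsto_at_iff_sequentially comp_def
  proof (intro allI impI)
    fix X :: "nat \<Rightarrow> real" assume ne: "\<forall>i. X i \<in> UNIV - {x}" and X: "X \<longlonglongrightarrow> x"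
    have eq: "((LINT \<xi>|lborel. g \<xi> * cis (X n * \<xi>)) - (LINT \<xi>|lborel. g \<xi> * cis (x * \<xi>))) /\<^sub>R (X n - x)
       = (LINT \<xi>|lborel. g \<xi> * ((cis (X n * \<xi>) - cis (x * \<xi>)) /\<^sub>R (X n - x)))" for n
    proof -
      have "(LINT \<xi>|lborel. g \<xi> * cis (X n * \<xi>)) - (LINT \<xi>|lborel. g \<xi> * cis (x * \<xi>)) =
        (LINT \<xi>|lborel. g \<xi> * cis (X n * \<xi>) - g \<xi> * cis (x * \<xi>))"
        using int by simp
      also have "\<dots> /\<^sub>R (X n - x) = (LINT \<xi>|lborel. (g \<xi> * cis (X n * \<xi>) - g \<xi> * cis (x * \<xi>)) /\<^sub>R (X n - x))"
        by (rule integral_scaleR_right[symmetric])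
      finally show ?thesis
        by (simp add: right_diff_distrib)
    qed
    show "(\<lambda>n. ((LINT \<xi>|lborel. g \<xi> * cis (X n * \<xi>)) - (LINT \<xi>|lborel. g \<xi> * cis (x * \<xi>))) /\<^sub>R (X n - x)) \<longlonglongrightarrow> ?D"
      unfolding eq
    proof (rule integral_dominated_convergence)
      show "integrable lborel (\<lambda>\<xi>. cmod (\<xi> * g \<xi>))" using g' by auto
      show "AE \<xi> in lborel. (\<lambda>n. g \<xi> * ((cis (X n * \<xi>) - cis (x * \<xi>)) /\<^sub>R (X n - x))) \<longlonglongrightarrow> \<i> * (\<xi> * g \<xi>) * cis (x * \<xi>)"
      proof (rule AE_I2)
        fix \<xi>
        have "((\<lambda>y. cis (y * \<xi>)) has_vector_derivative (\<i> * \<xi> * cis (x * \<xi>))) (at x)"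
        proof -
          have "((\<lambda>z. exp (\<i> * complex_of_real \<xi> * z)) has_field_derivative
              \<i> * \<xi> * exp (\<i> * \<xi> * complex_of_real x)) (at (complex_of_real x))"
            by (auto intro!: derivative_eq_intros)
          from has_vector_derivative_real_field[OF this] show ?thesis
            by (simp add: cis_conv_exp mult_ac)
        qed
        then have "((\<lambda>y. (cis (y * \<xi>) - cis (x * \<xi>)) /\<^sub>R (y - x)) \<longlongrightarrow> (\<i> * \<xi> * cis (x * \<xi>))) (at x)"
          unfolding has_vector_derivative_iff_quotient .
        then have "(\<lambda>n. (cis (X n * \<xi>) - cis (x * \<xi>)) /\<^sub>R (X n - x)) \<longlonglongrightarrow> (\<i> * \<xi> * cis (x * \<xi>))"
          using ne X unfolding tendsto_at_iff_sequentially comp_def by blast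
        then have "(\<lambda>n. g \<xi> * ((cis (X n * \<xi>) - cis (x * \<xi>)) /\<^sub>R (X n - x))) \<longlonglongrightarrow> g \<xi> * (\<i> * \<xi> * cis (x * \<xi>))"
          by (rule tendsto_mult_left)
        then show "(\<lambda>n. g \<xi> * ((cis (X n * \<xi>) - cis (x * \<xi>)) /\<^sub>R (X n - x))) \<longlonglongrightarrow> \<i> * (\<xi> * g \<xi>) * cis (x * \<xi>)"
          by (simp add: mult_ac)
      qed
      show "AE \<xi> in lborel. cmod (g \<xi> * ((cis (X n * \<xi>) - cis (x * \<xi>)) /\<^sub>R (X n - x))) \<le> cmod (\<xi> * g \<xi>)" for n
      proof (rule AE_I2)
        fix \<xi>
        have pos: "0 < \<bar>X n - x\<bar>" using ne by auto
        have "cmod (cis (X n * \<xi>) - cis (x * \<xi>)) \<le> \<bar>X n - x\<bar> * \<bar>\<xi>\<bar>"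
          using cmod_cis_diff_le[of "X n * \<xi>" "x * \<xi>"] by (simp add: abs_mult flip: left_diff_distrib)
        then have "cmod ((cis (X n * \<xi>) - cis (x * \<xi>)) /\<^sub>R (X n - x)) \<le> \<bar>\<xi>\<bar>"
          using pos by (simp add: divide_simps mult.commute)
        then have "cmod (g \<xi>) * cmod ((cis (X n * \<xi>) - cis (x * \<xi>)) /\<^sub>R (X n - x)) \<le> cmod (g \<xi>) * \<bar>\<xi>\<bar>"
          by (rule mult_left_mono) simp
        then show "cmod (g \<xi> * ((cis (X n * \<xi>) - cis (x * \<xi>)) /\<^sub>R (X n - x))) \<le> cmod (\<xi> * g \<xi>)"
          by (simp only: norm_mult norm_of_real mult.commute)
      qed
    qed measurable
  qed
  then show ?thesis
    unfolding has_vector_derivative_iff_quotient .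
qed

text \<open>For s > 3/2 the weighted estimate with k = 1 makes \<xi> times the transform integrable,
  so the inversion formula can be differentiated under the integral. The same estimate bounds the
  derivative by the norm of \<open>f\<close>.\<close>

lemma sobolev_differentiable:
  assumes f: "f \<in> sobolev_space s" and s: "s > 3 / 2" and cont: "continuous_on UNIV f"
  shows "(f has_real_derivative deriv f x) (at x)"
    and "\<bar>deriv f x\<bar> \<le> embedding_constant (s - 1) * sobolev_norm s f"
    and "continuous_on UNIV (deriv f)"
proof -
  let ?g = "fourier_transform f"
  let ?I = "\<lambda>x. LINT \<xi>|lborel. \<i> * (\<xi> * ?g \<xi>) * cis (x * \<xi>)"
  have ic: "isCont f y" for y
    using cont by (simp add: continuous_on_eq_continuous_at)
  have s': "s > 1 / 2" using s by simp
  have g: "integrable lborel ?g"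
    and inv: "\<And>y. complex_of_real (2 * pi * f y) = (LINT \<xi>|lborel. ?g \<xi> * cis (y * \<xi>))"
    using sobolev_inversion[OF f s' ic] by auto
  have [measurable]: "?g \<in> borel_measurable borel"
    using borel_measurable_integrable[OF g] by simp
  have w: "integrable lborel (\<lambda>\<xi>. (1 + \<xi>\<^sup>2) powr (1 / 2) * cmod (?g \<xi>))"
    by (rule sobolev_fourier_L1(1)[OF f]) (use s in simp)
  have le: "\<bar>\<xi>\<bar> \<le> (1 + \<xi>\<^sup>2) powr (1 / 2)" for \<xi> :: real
    by (simp add: powr_half_sqrt real_le_rsqrt)
  have le': "cmod (\<xi> * ?g \<xi>) \<le> (1 + \<xi>\<^sup>2) powr (1 / 2) * cmod (?g \<xi>)" for \<xi>
    unfolding norm_mult norm_of_real by (rule mult_right_mono[OF le]) simp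
  have g': "integrable lborel (\<lambda>\<xi>. \<xi> * ?g \<xi>)"
    using w by (rule Bochner_Integration.integrable_bound) (auto intro!: AE_I2 order_trans[OF le'])
  have D: "(f has_real_derivative Re (?I y) / (2 * pi)) (at y)" for y
  proof -
    have "((\<lambda>y. Re (LINT \<xi>|lborel. ?g \<xi> * cis (y * \<xi>))) has_vector_derivative Re (?I y)) (at y)"
      by (rule bounded_linear.has_vector_derivative[OF bounded_linear_Re DERIV_fourier_integral[OF g g']])
    then have "((\<lambda>y. Re (complex_of_real (2 * pi * f y))) has_real_derivative Re (?I y)) (at y)"
      unfolding inv has_real_derivative_iff_has_vector_derivative .
    then have "((\<lambda>y. (2 * pi * f y) / (2 * pi)) has_real_derivative Re (?I y) / (2 * pi)) (at y)"
      unfolding Re_complex_of_real by (rule DERIV_cdivide)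
    then show ?thesis by simp
  qed
  have d: "deriv f y = Re (?I y) / (2 * pi)" for y
    using D by (rule DERIV_imp_deriv)
  show "(f has_real_derivative deriv f x) (at x)"
    unfolding d by (rule D)
  have "continuous_on UNIV ?I"
    unfolding continuous_on_eq_continuous_at[OF open_UNIV]
    using isCont_fourier_integral[OF integrable_mult_right[OF g', of \<i>]] by blast
  then show "continuous_on UNIV (deriv f)"
    unfolding d[abs_def] by (intro continuous_intros) auto
  have "2 * pi * \<bar>deriv f x\<bar> = \<bar>Re (?I x)\<bar>"
    unfolding d by (simp add: abs_divide)
  also have "\<dots> \<le> cmod (?I x)"
    by (rule abs_Re_le_cmod)
  also have "\<dots> \<le> (LINT \<xi>|lborel. cmod (\<i> * (\<xi> * ?g \<xi>) * cis (x * \<xi>)))"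
    by (rule integral_norm_bound)
  also have "\<dots> = (LINT \<xi>|lborel. cmod (\<xi> * ?g \<xi>))"
    by (simp add: norm_mult)
  also have "\<dots> \<le> (LINT \<xi>|lborel. (1 + \<xi>\<^sup>2) powr (1 / 2) * cmod (?g \<xi>))"
    using integrable_norm[OF g'] w le' by (rule integral_mono)
  also have "\<dots> \<le> 2 * pi * (embedding_constant (s - 1) * sobolev_norm s f)"
    by (rule sobolev_fourier_L1(2)[OF f]) (use s in simp)
  finally show "\<bar>deriv f x\<bar> \<le> embedding_constant (s - 1) * sobolev_norm s f"
    by simp
qed

section \<open>One-sided exponential means\<close>

text \<open>
  \<open>left_mean F + right_mean F\<close> is \<open>p * F\<close>, and \<open>left_mean F - right_mean F\<close> is \<open>- \<partial>\<^sub>x p * F\<close>.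
\<close>

definition left_mean :: "(real \<Rightarrow> real) \<Rightarrow> real \<Rightarrow> real" where
  "left_mean F x = (LINT z|lborel. indicat_real {0..} z * (exp (- z) * F (x - z))) / 2"

definition right_mean :: "(real \<Rightarrow> real) \<Rightarrow> real \<Rightarrow> real" where
  "right_mean F x = left_mean (\<lambda>y. F (- y)) (- x)"

lemma integrable_exp_halfline: "integrable lborel (\<lambda>z. indicat_real {0..} z * exp (- z))"
  and integral_exp_halfline: "(LINT z|lborel. indicat_real {0..} z * exp (- z)) = 1"
proof -
  have hi: "((\<lambda>z::real. exp (- z)) has_integral 1) {0..}"
    using has_integral_exp_minus_to_infinity[of 1 0] by simp
  then have "(\<lambda>z::real. exp (- z)) absolutely_integrable_on {0..}"
    by (intro nonnegative_absolutely_integrable_1) auto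
  then have s: "set_integrable lborel {0..} (\<lambda>z::real. exp (- z))"
    unfolding set_integrable_def by (subst (asm) integrable_completion) auto
  then show "integrable lborel (\<lambda>z. indicat_real {0..} z * exp (- z))"
    unfolding set_integrable_def by simp
  have "(LINT z:{0..}|lborel. exp (- z)) = integral {0..} (\<lambda>z::real. exp (- z))"
    using s by (rule set_borel_integral_eq_integral)
  then show "(LINT z|lborel. indicat_real {0..} z * exp (- z)) = 1"
    using hi unfolding set_lebesgue_integral_def by (simp add: integral_unique)
qed

lemma left_mean_integrable:
  assumes [measurable]: "F \<in> borel_measurable borel" and M: "\<And>y. \<bar>F y\<bar> \<le> M"
  shows "integrable lborel (\<lambda>z. indicat_real {0..} z * (exp (- z) * F (x - z)))"
proof (rule Bochner_Integration.integrable_bound[OF integrable_mult_right[OF integrable_exp_halfline, of M]])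
  have "0 \<le> M" using M[of 0] by linarith
  then show "AE z in lborel. norm (indicat_real {0..} z * (exp (- z) * F (x - z))) \<le> norm (M * (indicat_real {0..} z * exp (- z)))"
    using M by (intro AE_I2) (auto simp: abs_mult indicator_def mult.commute intro!: mult_left_mono)
qed measurable

lemma left_mean_diff:
  assumes "F \<in> borel_measurable borel" "\<And>y. \<bar>F y\<bar> \<le> M"
    and "G \<in> borel_measurable borel" "\<And>y. \<bar>G y\<bar> \<le> M'"
  shows "left_mean F x - left_mean G x = left_mean (\<lambda>y. F y - G y) x"
  using left_mean_integrable[OF assms(1,2), of x] left_mean_integrable[OF assms(3,4), of x]
  unfolding left_mean_def by (simp add: right_diff_distrib diff_divide_distrib)

lemma left_mean_bound:
  assumes F: "F \<in> borel_measurable borel" and M: "\<And>y. \<bar>F y\<bar> \<le> M"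
  shows "\<bar>left_mean F x\<bar> \<le> M / 2"
proof -
  let ?f = "\<lambda>z. indicat_real {0..} z * (exp (- z) * F (x - z))"
  have i: "integrable lborel ?f"
    using F M by (rule left_mean_integrable)
  have "\<bar>LINT z|lborel. ?f z\<bar> \<le> (LINT z|lborel. \<bar>?f z\<bar>)"
    by (rule integral_abs_bound)
  also have "\<dots> \<le> (LINT z|lborel. M * (indicat_real {0..} z * exp (- z)))"
    using integrable_abs[OF i] integrable_mult_right[OF integrable_exp_halfline, of M]
  proof (rule integral_mono)
    fix z
    show "\<bar>?f z\<bar> \<le> M * (indicat_real {0..} z * exp (- z))"
      using M by (auto simp: abs_mult indicator_def mult.commute intro!: mult_left_mono)
  qed
  also have "\<dots> = M"
    by (simp add: integral_exp_halfline)
  finally show ?thesis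
    unfolding left_mean_def by (simp add: abs_divide)
qed

text \<open>With \<open>F\<close> merely continuous, the shift in \<open>F (x - z)\<close> cannot be
  differentiated. The substitution y = x - z moves \<open>x\<close> into the factor
  \<open>exp (- x)\<close> and into the upper limit of the integral \<open>H\<close> of
  \<open>exp y * F y\<close>, where the fundamental theorem of calculus applies.\<close>

lemma left_mean_DERIV:
  assumes cont: "continuous_on UNIV F" and M: "\<And>y. \<bar>F y\<bar> \<le> M"
  shows "(left_mean F has_real_derivative F x / 2 - left_mean F x) (at x)"
proof -
  have F [measurable]: "F \<in> borel_measurable borel"
    using cont by (rule borel_measurable_continuous_onI)
  define \<phi> where "\<phi> y = exp y * F y" for y
  have \<phi>c: "continuous_on S \<phi>" for S
    unfolding \<phi>_def by (intro continuous_intros continuous_on_subset[OF cont]) auto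
  have [measurable]: "\<phi> \<in> borel_measurable borel"
    using \<phi>c by (rule borel_measurable_continuous_onI)
  define H where "H x = (LINT y|lborel. indicat_real {..x} y * \<phi> y)" for x
  have shift: "indicat_real {..x} (x + -1 * z) * \<phi> (x + -1 * z) = exp x * (indicat_real {0..} z * (exp (- z) * F (x - z)))" for x z
    unfolding \<phi>_def by (auto simp: indicator_def exp_diff exp_minus field_simps)
  have Hi: "integrable lborel (\<lambda>y. indicat_real {..x} y * \<phi> y)" for x
  proof -
    have "integrable lborel (\<lambda>z. indicat_real {..x} (x + -1 * z) * \<phi> (x + -1 * z))"
      unfolding shift by (intro integrable_mult_right left_mean_integrable[OF F M])
    then show ?thesis
      by (subst (asm) lborel_integrable_real_affine_iff) auto
  qed
  have left: "left_mean F x = exp (- x) * H x / 2" for x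
  proof -
    have "H x = \<bar>-1\<bar> *\<^sub>R (LINT z|lborel. indicat_real {..x} (x + -1 * z) * \<phi> (x + -1 * z))"
      unfolding H_def by (rule lborel_integral_real_affine) simp
    also have "\<dots> = exp x * (2 * left_mean F x)"
      unfolding shift left_mean_def by simp
    finally show ?thesis by (simp add: exp_minus)
  qed
  \<comment> \<open>Cutting off the part below \<open>a\<close> leaves an integral over a compact
    interval, to which the fundamental theorem applies.\<close>
  have Heq: "H y = H a + integral {a..y} \<phi>" if "a \<le> y" for a y
  proof -
    have s: "set_integrable lborel {a..y} \<phi>"
      by (rule borel_integrable_compact[of "{a..y}" \<phi>, unfolded set_integrable_def[symmetric]]) (auto intro: \<phi>c)
    have "H y = (LINT z|lborel. indicat_real {..a} z * \<phi> z + indicat_real {a..y} z *\<^sub>R \<phi> z)"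
      unfolding H_def
    proof (rule integral_cong_AE)
      show "AE z in lborel. indicat_real {..y} z * \<phi> z = indicat_real {..a} z * \<phi> z + indicat_real {a..y} z *\<^sub>R \<phi> z"
        \<comment> \<open>The point \<open>a\<close> lies in both pieces, so the splitting fails
          there; it is a null set.\<close>
        using AE_lborel_singleton[of a] by eventually_elim (use that in \<open>auto simp: indicator_def\<close>)
    qed measurable
    also have "\<dots> = H a + (LINT z:{a..y}|lborel. \<phi> z)"
      using s Hi[of a] unfolding H_def set_lebesgue_integral_def set_integrable_def by simp
    also have "(LINT z:{a..y}|lborel. \<phi> z) = integral {a..y} \<phi>"
      using s by (rule set_borel_integral_eq_integral)
    finally show ?thesis .
  qed
  have "((\<lambda>y. integral {x - 1..y} \<phi>) has_real_derivative \<phi> x) (at x within {x - 1..x + 1})"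
    by (rule integral_has_real_derivative[OF \<phi>c]) auto
  then have "((\<lambda>y. H (x - 1) + integral {x - 1..y} \<phi>) has_real_derivative 0 + \<phi> x) (at x within {x - 1..x + 1})"
    by (intro DERIV_add DERIV_const)
  then have "((\<lambda>y. H (x - 1) + integral {x - 1..y} \<phi>) has_real_derivative \<phi> x) (at x within {x - 1..x + 1})"
    by simp
  then have "(H has_real_derivative \<phi> x) (at x within {x - 1..x + 1})"
    by (rule has_field_derivative_transform_within[OF _ zero_less_one]) (auto intro!: Heq[symmetric])
  moreover have "at x within {x - 1..x + 1} = at x"
    by (intro at_within_interior) auto
  ultimately have "(H has_real_derivative \<phi> x) (at x)"
    by simp
  then have "((\<lambda>x. exp (- x) * H x / 2) has_real_derivative (- exp (- x) * H x + \<phi> x * exp (- x)) / 2) (at x)"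
    by (auto intro!: derivative_eq_intros)
  also have "(- exp (- x) * H x + \<phi> x * exp (- x)) / 2 = F x / 2 - left_mean F x"
    unfolding left \<phi>_def by (simp add: exp_minus field_simps)
  finally show ?thesis
    unfolding left[abs_def] .
qed

lemma right_mean_diff:
  assumes [measurable]: "F \<in> borel_measurable borel" and "\<And>y. \<bar>F y\<bar> \<le> M"
    and [measurable]: "G \<in> borel_measurable borel" and "\<And>y. \<bar>G y\<bar> \<le> M'"
  shows "right_mean F x - right_mean G x = right_mean (\<lambda>y. F y - G y) x"
  unfolding right_mean_def using assms(2,4) by (intro left_mean_diff[of _ M _ M']) auto

lemma right_mean_bound:
  assumes [measurable]: "F \<in> borel_measurable borel" and "\<And>y. \<bar>F y\<bar> \<le> M"
  shows "\<bar>right_mean F x\<bar> \<le> M / 2"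
  unfolding right_mean_def using assms(2) by (intro left_mean_bound) auto

lemma right_mean_DERIV:
  assumes cont: "continuous_on UNIV F" and M: "\<And>y. \<bar>F y\<bar> \<le> M"
  shows "(right_mean F has_real_derivative right_mean F x - F x / 2) (at x)"
proof -
  have "continuous_on UNIV (\<lambda>y. F (- y))"
    by (rule continuous_on_compose2[OF cont]) (auto intro!: continuous_intros)
  then have "(left_mean (\<lambda>y. F (- y)) has_real_derivative F (- (- x)) / 2 - left_mean (\<lambda>y. F (- y)) (- x)) (at (- x))"
    using M by (intro left_mean_DERIV) auto
  then have "((\<lambda>x. left_mean (\<lambda>y. F (- y)) (- x)) has_real_derivative (F (- (- x)) / 2 - left_mean (\<lambda>y. F (- y)) (- x)) * -1) (at x)"
    by (rule DERIV_chain2) (auto intro!: derivative_eq_intros)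
  then show ?thesis
    unfolding right_mean_def[abs_def] by simp
qed

section \<open>The differentiated kernel in terms of the one-sided means\<close>

lemma rod_kernel_deriv:
  "z > 0 \<Longrightarrow> deriv rod_kernel z = - exp (- z) / 2" "z < 0 \<Longrightarrow> deriv rod_kernel z = exp z / 2"
proof -
  assume z: "z > 0"
  have "((\<lambda>z. exp (- z) / 2) has_real_derivative - exp (- z) / 2) (at z)"
    by (auto intro!: derivative_eq_intros)
  then have "(rod_kernel has_real_derivative - exp (- z) / 2) (at z)"
    by (rule has_field_derivative_transform_within_open[where S = "{0<..}"]) (use z in \<open>auto simp: rod_kernel_def\<close>)
  then show "deriv rod_kernel z = - exp (- z) / 2"
    by (rule DERIV_imp_deriv)
next
  assume z: "z < 0"
  have "((\<lambda>z. exp z / 2) has_real_derivative exp z / 2) (at z)"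
    by (auto intro!: derivative_eq_intros)
  then have "(rod_kernel has_real_derivative exp z / 2) (at z)"
    by (rule has_field_derivative_transform_within_open[where S = "{..<0}"]) (use z in \<open>auto simp: rod_kernel_def\<close>)
  then show "deriv rod_kernel z = exp z / 2"
    by (rule DERIV_imp_deriv)
qed

text \<open>The derivative of p is -p on the positive and p on the negative half-line. After
  substitution, positive \<open>z\<close> sees the values of \<open>F\<close> to the left of
  \<open>x\<close>, so the left mean enters with the minus sign.\<close>

lemma convolution_deriv_rod_kernel:
  assumes F [measurable]: "F \<in> borel_measurable borel" and M: "\<And>y. \<bar>F y\<bar> \<le> M"
  shows "Defs.convolution (deriv rod_kernel) F x = right_mean F x - left_mean F x"
proof -
  let ?l = "\<lambda>z. indicat_real {0..} z * (exp (- z) * F (x - z))"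
  let ?r = "\<lambda>z. indicat_real {0..} z * (exp (- z) * F (- (- x - z)))"
  have l: "integrable lborel ?l"
    using F M by (rule left_mean_integrable)
  have r: "integrable lborel ?r"
    by (rule left_mean_integrable[of "\<lambda>y. F (- y)" M]) (use M in auto)
  have r': "integrable lborel (\<lambda>z. ?r (0 + -1 * z))"
    using r by (rule lborel_integrable_real_affine) simp
  have r'': "(LINT z|lborel. ?r (0 + -1 * z)) = (LINT z|lborel. ?r z)"
    using lborel_integral_real_affine[of "-1" ?r 0] by simp
  \<comment> \<open>The value at 0 is left unspecified and kept as a constant; the explicit case
    form serves to show measurability.\<close>
  have k: "deriv rod_kernel = (\<lambda>z. if z = 0 then deriv rod_kernel 0 else if z > 0 then - exp (- z) / 2 else exp z / 2)"
    by (auto simp: fun_eq_iff rod_kernel_deriv)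
  have [measurable]: "deriv rod_kernel \<in> borel_measurable borel"
    by (subst k) measurable
  have "Defs.convolution (deriv rod_kernel) F x = \<bar>-1\<bar> *\<^sub>R (LINT z|lborel. deriv rod_kernel (x - (x + -1 * z)) * F (x + -1 * z))"
    unfolding Defs.convolution_def by (rule lborel_integral_real_affine) simp
  also have "\<dots> = (LINT z|lborel. deriv rod_kernel z * F (x - z))"
    by simp
  also have "\<dots> = (LINT z|lborel. ?r (0 + -1 * z) / 2 - ?l z / 2)"
  proof (rule integral_cong_AE)
    show "AE z in lborel. deriv rod_kernel z * F (x - z) = ?r (0 + -1 * z) / 2 - ?l z / 2"
      using AE_lborel_singleton[of 0]
    proof eventually_elim
      case (elim z)
      then show ?case
        by (cases "0 < z") (auto simp: rod_kernel_deriv indicator_def)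
    qed
  qed measurable
  also have "\<dots> = (LINT z|lborel. ?r (0 + -1 * z)) / 2 - (LINT z|lborel. ?l z) / 2"
    using l r' by simp
  also have "\<dots> = right_mean F x - left_mean F x"
    unfolding r'' right_mean_def left_mean_def by simp
  finally show ?thesis .
qed

text \<open>
  With \<open>a = \<kappa>\<^sup>2 + \<kappa>\<close> one has
  \<open>e\<^sup>y (a v\<^sup>2 + v'\<^sup>2) - (\<kappa> e\<^sup>y v\<^sup>2)' = e\<^sup>y (v' - \<kappa> v)\<^sup>2 \<ge> 0\<close>, and \<open>e\<^sup>y v\<^sup>2\<close> vanishes at \<open>-\<infinity>\<close>.
\<close>

lemma left_mean_lower_bound:
  fixes v v' :: "real \<Rightarrow> real"
  assumes v: "\<And>y. (v has_real_derivative v' y) (at y)" and cont: "continuous_on UNIV v'"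
    and b: "\<And>y. \<bar>v y\<bar> \<le> C" "\<And>y. \<bar>v' y\<bar> \<le> C"
    and \<gamma>: "0 \<le> \<gamma>" and \<kappa>: "\<gamma> * (\<kappa>\<^sup>2 + \<kappa>) = 3 - \<gamma>"
  shows "\<gamma> * \<kappa> / 4 * (v x)\<^sup>2 \<le> left_mean (\<lambda>y. (3 - \<gamma>) / 2 * (v y)\<^sup>2 + \<gamma> / 2 * (v' y)\<^sup>2) x"
proof -
  let ?F = "\<lambda>y. (3 - \<gamma>) / 2 * (v y)\<^sup>2 + \<gamma> / 2 * (v' y)\<^sup>2"
  have vc: "continuous_on UNIV v"
    by (rule DERIV_continuous_on) (use v in auto)
  have Fc: "continuous_on UNIV ?F"
    by (intro continuous_intros vc cont)
  \<comment> \<open>The coefficient 3 - \<gamma> may be negative, hence the absolute value.\<close>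
  define M where "M = \<bar>3 - \<gamma>\<bar> / 2 * C\<^sup>2 + \<gamma> / 2 * C\<^sup>2"
  have FM: "\<bar>?F y\<bar> \<le> M" for y
  proof -
    have "(v y)\<^sup>2 \<le> C\<^sup>2" "(v' y)\<^sup>2 \<le> C\<^sup>2"
      using power_mono[OF b(1)[of y], of 2] power_mono[OF b(2)[of y], of 2] by auto
    then have "\<bar>3 - \<gamma>\<bar> / 2 * (v y)\<^sup>2 + \<gamma> / 2 * (v' y)\<^sup>2 \<le> M"
      unfolding M_def using \<gamma> by (intro add_mono mult_left_mono) auto
    moreover have "\<bar>?F y\<bar> \<le> \<bar>(3 - \<gamma>) / 2 * (v y)\<^sup>2\<bar> + \<bar>\<gamma> / 2 * (v' y)\<^sup>2\<bar>"
      by (rule abs_triangle_ineq)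
    ultimately show ?thesis
      using \<gamma> by (simp add: abs_mult)
  qed
  note lm = left_mean_DERIV[OF Fc FM]
  \<comment> \<open>Twice \<open>exp y\<close> times the gap between the two sides of the claim. It
    is nondecreasing and tends to 0 at minus infinity, hence is nonnegative.\<close>
  define E where "E y = exp y * (2 * left_mean ?F y - \<gamma> * \<kappa> / 2 * (v y)\<^sup>2)" for y
  have E': "(E has_real_derivative exp y * (\<gamma> / 2 * (v' y - \<kappa> * v y)\<^sup>2)) (at y)" for y
  proof -
    have "(E has_real_derivative exp y * (2 * left_mean ?F y - \<gamma> * \<kappa> / 2 * (v y)\<^sup>2) +
        (2 * (?F y / 2 - left_mean ?F y) - \<gamma> * \<kappa> / 2 * (2 * v y * v' y)) * exp y) (at y)"
    proof -
      have "((\<lambda>y. 2 * left_mean ?F y - \<gamma> * \<kappa> / 2 * (v y)\<^sup>2) has_real_derivative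
          2 * (?F y / 2 - left_mean ?F y) - \<gamma> * \<kappa> / 2 * (2 * v y * v' y)) (at y)"
        by (rule DERIV_diff[OF DERIV_cmult[OF lm] DERIV_cmult]) (auto intro!: derivative_eq_intros v)
      from DERIV_mult[OF DERIV_exp this] show ?thesis
        unfolding E_def .
    qed
    also have "exp y * (2 * left_mean ?F y - \<gamma> * \<kappa> / 2 * (v y)\<^sup>2) +
        (2 * (?F y / 2 - left_mean ?F y) - \<gamma> * \<kappa> / 2 * (2 * v y * v' y)) * exp y
       = exp y * (?F y - \<gamma> * \<kappa> / 2 * (v y)\<^sup>2 - \<gamma> * \<kappa> * v y * v' y)"
      by (simp add: algebra_simps)
    \<comment> \<open>Replacing 3 - \<gamma> by \<gamma> (\<kappa>^2 + \<kappa>) leaves the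
      coefficient \<gamma> \<kappa>^2 / 2 in front of v^2, which is what completes the
      square.\<close>
    also have "?F y - \<gamma> * \<kappa> / 2 * (v y)\<^sup>2 - \<gamma> * \<kappa> * v y * v' y = \<gamma> / 2 * (v' y - \<kappa> * v y)\<^sup>2"
      unfolding \<kappa>[symmetric] by (simp add: power2_eq_square field_simps)
    finally show ?thesis .
  qed
  have "E y \<le> E x" if "y \<le> x" for y
    by (rule DERIV_nonneg_imp_nondecreasing[OF that]) (use E' \<gamma> in \<open>auto intro!: exI\<close>)
  then have ev: "\<forall>\<^sub>F y in at_bot. E y \<le> E x"
    by (auto simp: eventually_at_bot_linorder)
  have "(E \<longlongrightarrow> 0) at_bot"
    unfolding E_def
  proof (rule Lim_null_comparison)
    show "((\<lambda>y. exp y * (M + \<bar>\<gamma> * \<kappa> / 2\<bar> * C\<^sup>2)) \<longlongrightarrow> 0) at_bot"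
      by (rule tendsto_mult_left_zero[OF exp_at_bot])
    have "norm (exp y * (2 * left_mean ?F y - \<gamma> * \<kappa> / 2 * (v y)\<^sup>2)) \<le> exp y * (M + \<bar>\<gamma> * \<kappa> / 2\<bar> * C\<^sup>2)" for y
    proof -
      have 1: "\<bar>2 * left_mean ?F y\<bar> \<le> M"
        using left_mean_bound[OF borel_measurable_continuous_onI[OF Fc] FM, of y] by simp
      have "(v y)\<^sup>2 \<le> C\<^sup>2"
        using power_mono[OF b(1)[of y], of 2] by auto
      then have 2: "\<bar>\<gamma> * \<kappa> / 2 * (v y)\<^sup>2\<bar> \<le> \<bar>\<gamma> * \<kappa> / 2\<bar> * C\<^sup>2"
        unfolding abs_mult by (intro mult_left_mono) auto
      have "\<bar>2 * left_mean ?F y - \<gamma> * \<kappa> / 2 * (v y)\<^sup>2\<bar> \<le> M + \<bar>\<gamma> * \<kappa> / 2\<bar> * C\<^sup>2"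
        using 1 2 by linarith
      then show ?thesis
        unfolding real_norm_def abs_mult[of "exp y"] abs_exp_cancel by (rule mult_left_mono) simp
    qed
    then show "\<forall>\<^sub>F y in at_bot. norm (exp y * (2 * left_mean ?F y - \<gamma> * \<kappa> / 2 * (v y)\<^sup>2)) \<le> exp y * (M + \<bar>\<gamma> * \<kappa> / 2\<bar> * C\<^sup>2)"
      by (intro always_eventually allI)
  qed
  then have "0 \<le> E x"
    using ev by (rule tendsto_upperbound) simp
  then have "0 \<le> 2 * left_mean ?F x - \<gamma> * \<kappa> / 2 * (v x)\<^sup>2"
    unfolding E_def by (simp add: zero_le_mult_iff)
  then show ?thesis
    by simp
qed

text \<open>Reflection turns the right mean into a left mean and changes the sign of
  \<open>v'\<close>, which enters only squared; the same \<kappa> therefore serves both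
  sides.\<close>

lemma right_mean_lower_bound:
  fixes v v' :: "real \<Rightarrow> real"
  assumes v: "\<And>y. (v has_real_derivative v' y) (at y)" and cont: "continuous_on UNIV v'"
    and b: "\<And>y. \<bar>v y\<bar> \<le> C" "\<And>y. \<bar>v' y\<bar> \<le> C"
    and \<gamma>: "0 \<le> \<gamma>" and \<kappa>: "\<gamma> * (\<kappa>\<^sup>2 + \<kappa>) = 3 - \<gamma>"
  shows "\<gamma> * \<kappa> / 4 * (v x)\<^sup>2 \<le> right_mean (\<lambda>y. (3 - \<gamma>) / 2 * (v y)\<^sup>2 + \<gamma> / 2 * (v' y)\<^sup>2) x"
proof -
  have "((\<lambda>y. v (- y)) has_real_derivative v' (- y) * -1) (at y)" for y
    by (rule DERIV_chain2[OF v]) (auto intro!: derivative_eq_intros)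
  moreover have "continuous_on UNIV (\<lambda>y. v' (- y) * -1)"
    by (intro continuous_intros continuous_on_compose2[OF cont]) auto
  ultimately have "\<gamma> * \<kappa> / 4 * (v (- (- x)))\<^sup>2 \<le> left_mean (\<lambda>y. (3 - \<gamma>) / 2 * (v (- y))\<^sup>2 + \<gamma> / 2 * (v' (- y) * -1)\<^sup>2) (- x)"
    using b \<gamma> \<kappa> by (intro left_mean_lower_bound[where C = C]) auto
  then show ?thesis
    unfolding right_mean_def by simp
qed

section \<open>Characteristics and a pair of Riccati inequalities\<close>

text \<open>The hypotheses say that \<open>f\<close> is a continuous path in the Banach space of
  bounded continuous functions; its image over a compact set of times is compact, hence bounded in
  the sup norm.\<close>

lemma uniform_path_bounded:
  fixes f :: "real \<Rightarrow> real \<Rightarrow> real"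
  assumes cont: "\<And>t. t \<in> S \<Longrightarrow> continuous_on UNIV (f t)"
    and bdd: "\<And>t. t \<in> S \<Longrightarrow> bounded (range (f t))"
    and lim: "\<And>t. t \<in> S \<Longrightarrow> uniform_limit UNIV f (f t) (at t within S)"
    and S: "compact S"
  obtains M where "0 \<le> M" "\<And>t x. t \<in> S \<Longrightarrow> \<bar>f t x\<bar> \<le> M"
proof -
  \<comment> \<open>\<open>Bcontfun\<close> is the inverse of \<open>apply_bcontfun\<close> only on
    bounded continuous functions, so \<open>U\<close> carries meaning for \<open>t\<close> in
    \<open>S\<close>.\<close>
  define U where "U t = Bcontfun (f t)" for t
  have U: "apply_bcontfun (U t) = f t" if "t \<in> S" for t
    unfolding U_def using cont[OF that] bdd[OF that] by (intro Bcontfun_inverse) (auto simp: bcontfun_def)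
  have "continuous_on S U"
    unfolding continuous_on_def
  proof (intro ballI tendstoI)
    fix t e :: real assume t: "t \<in> S" and e: "0 < e"
    have "\<forall>\<^sub>F r in at t within S. \<forall>x\<in>UNIV. dist (f r x) (f t x) < e / 2"
      using lim[OF t, unfolded uniform_limit_iff, rule_format, of "e / 2"] e by simp
    moreover have "\<forall>\<^sub>F r in at t within S. r \<in> S"
      by (simp add: eventually_at_filter)
    ultimately show "\<forall>\<^sub>F r in at t within S. dist (U r) (U t) < e"
    proof eventually_elim
      case (elim r)
      then have "dist (U r) (U t) \<le> e / 2"
        using U[OF t] U[of r] by (intro dist_bound) (auto intro: less_imp_le)
      then show ?case using e by simp
    qed
  qed
  then have "bounded (U ` S)"
    using S by (intro compact_imp_bounded compact_continuous_image)
  then obtain M where M: "0 < M" "\<And>t. t \<in> S \<Longrightarrow> norm (U t) \<le> M"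
    unfolding bounded_pos by auto
  have "\<bar>f t x\<bar> \<le> M" if "t \<in> S" for t x
    using norm_bounded[of "U t" x] M(2)[OF that] U[OF that] by simp
  then show ?thesis using M(1) that[of M] by simp
qed

lemma uniform_path_tendsto:
  fixes f :: "real \<Rightarrow> real \<Rightarrow> real"
  assumes cont: "isCont (f t) y"
    and lim: "uniform_limit UNIV f (f t) F"
    and q: "(q \<longlongrightarrow> y) F"
  shows "((\<lambda>r. f r (q r)) \<longlongrightarrow> f t y) F"
proof -
  have 1: "((\<lambda>r. f r (q r) - f t (q r)) \<longlongrightarrow> 0) F"
  proof (rule tendstoI)
    fix e :: real assume "0 < e"
    then have "\<forall>\<^sub>F r in F. \<forall>x\<in>UNIV. dist (f r x) (f t x) < e"
      using lim unfolding uniform_limit_iff by blast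
    then show "\<forall>\<^sub>F r in F. dist (f r (q r) - f t (q r)) 0 < e"
      by eventually_elim (simp add: dist_norm)
  qed
  have "((\<lambda>r. f t (q r)) \<longlongrightarrow> f t y) F"
    using cont q by (rule isCont_tendsto_compose)
  from tendsto_add[OF 1 this] show ?thesis by simp
qed

lemma uniform_path_continuous:
  fixes f :: "real \<Rightarrow> real \<Rightarrow> real"
  assumes cont: "\<And>t. t \<in> S \<Longrightarrow> continuous_on UNIV (f t)"
    and lim: "\<And>t. t \<in> S \<Longrightarrow> uniform_limit UNIV f (f t) (at t within S)"
    and q: "continuous_on S q"
  shows "continuous_on S (\<lambda>t. f t (q t))"
  unfolding continuous_on_def
proof
  fix t assume t: "t \<in> S"
  have "isCont (f t) (q t)"
    using cont[OF t] by (simp add: continuous_on_eq_continuous_at)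
  moreover have "(q \<longlongrightarrow> q t) (at t within S)"
    using q t unfolding continuous_on_def by blast
  ultimately show "((\<lambda>t. f t (q t)) \<longlongrightarrow> f t (q t)) (at t within S)"
    by (rule uniform_path_tendsto[where f = f, OF _ lim[OF t]])
qed

section \<open>Integral curves of a Lipschitz velocity field\<close>

lemma integral_exp_le:
  fixes L c :: real
  assumes "0 < L" "0 \<le> c"
  shows "(\<lambda>t. exp (L * t)) integrable_on {0..c}" "integral {0..c} (\<lambda>t. exp (L * t)) \<le> exp (L * c) / L"
proof -
  have "((\<lambda>t. exp (L * t)) has_integral (exp (L * c) / L - exp (L * 0) / L)) {0..c}"
  proof (rule fundamental_theorem_of_calculus[OF assms(2)])
    fix t
    have "((\<lambda>t. exp (L * t) / L) has_real_derivative exp (L * t) * L / L) (at t within {0..c})"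
      by (rule DERIV_cdivide) (auto intro!: derivative_eq_intros)
    then show "((\<lambda>t. exp (L * t) / L) has_vector_derivative exp (L * t)) (at t within {0..c})"
      using assms by (simp add: has_real_derivative_iff_has_vector_derivative)
  qed
  then show "(\<lambda>t. exp (L * t)) integrable_on {0..c}" "integral {0..c} (\<lambda>t. exp (L * t)) \<le> exp (L * c) / L"
    using assms by (auto simp: has_integral_iff)
qed

text \<open>The fixed point is sought for w(t) = exp (-L t) q(t). In this exponentially weighted
  norm the integral operator contracts on all of [0, T] at once, so no gluing of short time
  intervals is needed.\<close>

lemma picard_lindelof_uniform:
  fixes b :: "real \<Rightarrow> real \<Rightarrow> real"
  assumes T: "0 \<le> T"
    and cont: "\<And>t. t \<in> {0..T} \<Longrightarrow> continuous_on UNIV (b t)"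
    and lim: "\<And>t. t \<in> {0..T} \<Longrightarrow> uniform_limit UNIV b (b t) (at t within {0..T})"
    and K: "0 \<le> K" "\<And>t x y. t \<in> {0..T} \<Longrightarrow> \<bar>b t x - b t y\<bar> \<le> K * \<bar>x - y\<bar>"
  obtains q where "q 0 = x\<^sub>0" "\<And>t. t \<in> {0..T} \<Longrightarrow> (q has_real_derivative b t (q t)) (at t within {0..T})"
proof -
  \<comment> \<open>Any L > 0 with L \<ge> 2 K gives contraction factor K / L \<le> 1/2; the added 1
    keeps L positive when K = 0.\<close>
  define L where "L = 2 * K + 1"
  have L: "0 < L" "K / L \<le> 1 / 2" using K(1) unfolding L_def by (auto simp: field_simps)
  \<comment> \<open>Clamping time to [0, T] extends functions on the interval to bounded continuous
    functions on the line, where the type \<open>bcontfun\<close> provides completeness.\<close>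
  define cl where "cl t = max 0 (min T t)" for t
  have cl: "cl t \<in> {0..T}" for t unfolding cl_def using T by auto
  define g where "g w t = b t (exp (L * t) * apply_bcontfun w t)" for w t
  define J where "J w t = exp (- L * t) * (x\<^sub>0 + integral {0..t} (g w))" for w t
  have g: "continuous_on {0..T} (g w)" for w
    unfolding g_def
    by (rule uniform_path_continuous[where f = b, OF cont lim]) (auto intro!: continuous_intros)
  have gi: "g w integrable_on {0..t}" if "t \<in> {0..T}" for w t
    using that by (intro integrable_continuous_interval continuous_on_subset[OF g]) auto
  have J: "continuous_on {0..T} (J w)" for w
  proof -
    have "continuous_on {0..T} (\<lambda>t. integral {0..t} (g w))"
      using gi[of T w] T by (intro indefinite_integral_continuous_1) auto
    then show ?thesis
      unfolding J_def by (intro continuous_on_mult continuous_on_add continuous_on_const continuous_on_exp continuous_on_id)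
  qed
  have Jb: "(\<lambda>t. J w (cl t)) \<in> bcontfun" for w
    unfolding bcontfun_def
  proof (intro CollectI conjI)
    show "continuous_on UNIV (\<lambda>t. J w (cl t))"
      by (rule continuous_on_compose2[OF J]) (use cl in \<open>auto intro!: continuous_intros simp: cl_def[abs_def]\<close>)
    have "bounded (J w ` {0..T})"
      by (intro compact_imp_bounded compact_continuous_image J) auto
    then show "bounded (range (\<lambda>t. J w (cl t)))"
      by (rule bounded_subset) (use cl in auto)
  qed
  define \<Phi> where "\<Phi> w = Bcontfun (\<lambda>t. J w (cl t))" for w
  have \<Phi>: "apply_bcontfun (\<Phi> w) t = J w (cl t)" for w t
    unfolding \<Phi>_def by (simp add: Bcontfun_inverse[OF Jb])
  have contr: "dist (\<Phi> w) (\<Phi> w') \<le> 1 / 2 * dist w w'" for w w'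
  proof (rule dist_bound)
    fix t
    let ?c = "cl t"
    have c: "?c \<in> {0..T}" "0 \<le> ?c" using cl[of t] by auto
    have "norm (integral {0..?c} (\<lambda>\<tau>. g w \<tau> - g w' \<tau>)) \<le> integral {0..?c} (\<lambda>\<tau>. K * dist w w' * exp (L * \<tau>))"
    proof (rule integral_norm_bound_integral)
      show "(\<lambda>\<tau>. g w \<tau> - g w' \<tau>) integrable_on {0..?c}"
        by (intro Henstock_Kurzweil_Integration.integrable_diff gi c)
      show "(\<lambda>\<tau>. K * dist w w' * exp (L * \<tau>)) integrable_on {0..?c}"
        by (intro integrable_on_mult_right integral_exp_le L c)
      fix \<tau> assume "\<tau> \<in> {0..?c}"
      then have \<tau>: "\<tau> \<in> {0..T}" using c by auto
      have "\<bar>g w \<tau> - g w' \<tau>\<bar> \<le> K * \<bar>exp (L * \<tau>) * apply_bcontfun w \<tau> - exp (L * \<tau>) * apply_bcontfun w' \<tau>\<bar>"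
        unfolding g_def by (rule K(2)[OF \<tau>])
      also have "\<dots> = K * (exp (L * \<tau>) * dist (apply_bcontfun w \<tau>) (apply_bcontfun w' \<tau>))"
        by (simp add: dist_real_def abs_mult flip: right_diff_distrib)
      also have "\<dots> \<le> K * (exp (L * \<tau>) * dist w w')"
        using K(1) by (intro mult_left_mono dist_bounded) auto
      finally show "norm (g w \<tau> - g w' \<tau>) \<le> K * dist w w' * exp (L * \<tau>)"
        by (simp add: mult_ac)
    qed
    also have "\<dots> = K * dist w w' * integral {0..?c} (\<lambda>\<tau>. exp (L * \<tau>))"
      by simp
    also have "\<dots> \<le> K * dist w w' * (exp (L * ?c) / L)"
      using K(1) by (intro mult_left_mono integral_exp_le L c) auto
    finally have le: "norm (integral {0..?c} (\<lambda>\<tau>. g w \<tau> - g w' \<tau>)) \<le> K * dist w w' * (exp (L * ?c) / L)" .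
    have "integral {0..?c} (\<lambda>\<tau>. g w \<tau> - g w' \<tau>) = integral {0..?c} (g w) - integral {0..?c} (g w')"
      by (intro Henstock_Kurzweil_Integration.integral_diff gi c)
    then have "dist (apply_bcontfun (\<Phi> w) t) (apply_bcontfun (\<Phi> w') t) = exp (- L * ?c) * norm (integral {0..?c} (\<lambda>\<tau>. g w \<tau> - g w' \<tau>))"
      unfolding \<Phi> J_def dist_real_def by (simp add: abs_mult flip: right_diff_distrib)
    also have "\<dots> \<le> exp (- L * ?c) * (K * dist w w' * (exp (L * ?c) / L))"
      by (intro mult_left_mono le) auto
    also have "\<dots> = K / L * dist w w'"
      by (simp add: exp_minus field_simps)
    also have "\<dots> \<le> 1 / 2 * dist w w'"
      by (intro mult_right_mono L) auto
    finally show "dist (apply_bcontfun (\<Phi> w) t) (apply_bcontfun (\<Phi> w') t) \<le> 1 / 2 * dist w w'" .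
  qed
  have "\<exists>!w. \<Phi> w = w"
    by (rule banach_fix_type[of "1/2"]) (use contr in auto)
  then obtain w where w: "\<Phi> w = w" by blast
  define q where "q t = exp (L * t) * apply_bcontfun w t" for t
  have q: "q t = x\<^sub>0 + integral {0..t} (g w)" if "t \<in> {0..T}" for t
  proof -
    have "cl t = t" using that unfolding cl_def by auto
    then have "apply_bcontfun w t = J w t"
      using \<Phi>[of w t] unfolding w by simp
    then show ?thesis
      unfolding q_def J_def by (simp add: exp_minus)
  qed
  show ?thesis
  proof
    show "q 0 = x\<^sub>0" using q[of 0] T by simp
    fix t assume t: "t \<in> {0..T}"
    have "((\<lambda>t. integral {0..t} (g w)) has_real_derivative g w t) (at t within {0..T})"
      using g t by (rule integral_has_real_derivative)
    then have "((\<lambda>t. x\<^sub>0 + integral {0..t} (g w)) has_real_derivative g w t) (at t within {0..T})"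
      by (auto intro!: derivative_eq_intros)
    then have "(q has_real_derivative g w t) (at t within {0..T})"
      by (rule has_field_derivative_transform_within[OF _ zero_less_one t]) (use q in auto)
    then show "(q has_real_derivative b t (q t)) (at t within {0..T})"
      unfolding g_def q_def .
  qed
qed

text \<open>The increment splits into a change of time at the new position \<open>q r\<close> and a
  change of position at the fixed time \<open>t\<close>. Uniform convergence of the time quotients,
  with continuity of \<open>W\<close>, compensates for evaluating at the moving point.\<close>

lemma DERIV_uniform_chain:
  fixes u :: "real \<Rightarrow> real \<Rightarrow> real"
  assumes lim: "uniform_limit UNIV (\<lambda>r x. (u r x - u t x) / (r - t)) W (at t within S)"
    and W: "isCont W (q t)"
    and ux: "(u t has_real_derivative D) (at (q t))"
    and q: "(q has_real_derivative c) (at t within S)"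
  shows "((\<lambda>r. u r (q r)) has_real_derivative W (q t) + D * c) (at t within S)"
proof -
  have qc: "(q \<longlongrightarrow> q t) (at t within S)"
    using DERIV_continuous[OF q] unfolding continuous_within .
  have 1: "((\<lambda>r. (u r (q r) - u t (q r)) / (r - t)) \<longlongrightarrow> W (q t)) (at t within S)"
  proof -
    have "((\<lambda>r. (u r (q r) - u t (q r)) / (r - t) - W (q r)) \<longlongrightarrow> 0) (at t within S)"
    proof (rule tendstoI)
      fix e :: real assume "0 < e"
      then have "\<forall>\<^sub>F r in at t within S. \<forall>x\<in>UNIV. dist ((u r x - u t x) / (r - t)) (W x) < e"
        using lim unfolding uniform_limit_iff by blast
      then show "\<forall>\<^sub>F r in at t within S. dist ((u r (q r) - u t (q r)) / (r - t) - W (q r)) 0 < e"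
        by eventually_elim (simp add: dist_norm)
    qed
    from tendsto_add[OF this isCont_tendsto_compose[OF W qc]] show ?thesis by simp
  qed
  have "((\<lambda>r. u t (q r)) has_real_derivative D * c) (at t within S)"
    using DERIV_chain2[OF ux q] .
  then have 2: "((\<lambda>r. (u t (q r) - u t (q t)) / (r - t)) \<longlongrightarrow> D * c) (at t within S)"
    unfolding has_field_derivative_iff .
  have "((\<lambda>r. (u r (q r) - u t (q r)) / (r - t) + (u t (q r) - u t (q t)) / (r - t)) \<longlongrightarrow> W (q t) + D * c) (at t within S)"
    by (rule tendsto_add[OF 1 2])
  then show ?thesis
    unfolding has_field_derivative_iff by (simp flip: add_divide_distrib)
qed

text \<open>While \<open>A\<close> and \<open>B\<close> are both positive the lower bound on their
  derivatives is positive too, so neither can fall to 0. The sum of reciprocals then stays positive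
  although it decreases at a rate of at least 2 c, and this limits \<open>T\<close>.\<close>

lemma riccati_pair_blowup:
  fixes A B A' B' :: "real \<Rightarrow> real"
  assumes T: "0 \<le> T" and c: "0 < c"
    and A: "\<And>t. t \<in> {0..T} \<Longrightarrow> (A has_real_derivative A' t) (at t within {0..T})"
    and B: "\<And>t. t \<in> {0..T} \<Longrightarrow> (B has_real_derivative B' t) (at t within {0..T})"
    and A': "\<And>t. t \<in> {0..T} \<Longrightarrow> A' t \<ge> c * (A t * B t)"
    and B': "\<And>t. t \<in> {0..T} \<Longrightarrow> B' t \<ge> c * (A t * B t)"
    and A0: "0 < A 0" and B0: "0 < B 0"
  shows "2 * c * T < 1 / A 0 + 1 / B 0"
proof -
  have contA: "continuous_on {0..T} A"
    by (rule DERIV_continuous_on[OF A])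
  have contB: "continuous_on {0..T} B"
    by (rule DERIV_continuous_on[OF B])
  \<comment> \<open>The sign of the derivative is required only strictly between 0 and
    \<open>s\<close>, since below it is known only before the first time at which positivity could
    fail.\<close>
  have incr: "f 0 \<le> f s"
    if s: "s \<in> {0..T}" and f: "\<And>t. t \<in> {0..T} \<Longrightarrow> (f has_real_derivative f' t) (at t within {0..T})"
      and pos: "\<And>t. 0 < t \<Longrightarrow> t < s \<Longrightarrow> 0 \<le> f' t" for f f' :: "real \<Rightarrow> real" and s
  proof (cases "s = 0")
    case False
    then have s0: "0 < s" using s by auto
    show ?thesis
    proof (rule DERIV_nonneg_imp_increasing_open[of 0 s])
      show "0 \<le> s" using s0 by simp
      show "continuous_on {0..s} f"
        by (rule continuous_on_subset[OF DERIV_continuous_on[OF f]]) (use s in auto)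
      fix t assume t: "0 < t" "t < s"
      then have "(f has_real_derivative f' t) (at t within {0..T})" using f s by auto
      moreover have "at t within {0..T} = at t" using t s by (intro at_within_interior) auto
      ultimately show "\<exists>y. (f has_real_derivative y) (at t) \<and> 0 \<le> y"
        using pos t by auto
    qed
  qed simp
  have pos: "0 < A s \<and> 0 < B s" if s: "s \<in> {0..T}" for s
  proof (rule ccontr)
    assume neg: "\<not> (0 < A s \<and> 0 < B s)"
    \<comment> \<open>The times at which positivity fails. \<open>Z\<close> is closed, so
      \<open>Inf Z\<close> is the first such time; monotonicity up to it forces \<open>A\<close> and
      \<open>B\<close> to be at least their initial values there.\<close>
    define Z where "Z = {t \<in> {0..T}. min (A t) (B t) \<le> 0}"
    have "closed Z"
      unfolding Z_def by (intro continuous_closed_preimage_constant continuous_on_closed_Collect_le closed_atLeastAtMost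
          continuous_intros contA contB)
    moreover have "bdd_below Z" unfolding Z_def by (auto intro!: bdd_belowI[of _ 0])
    moreover have ne: "Z \<noteq> {}" using s neg unfolding Z_def by (auto simp: min_def)
    ultimately have inf: "Inf Z \<in> Z" by (intro closed_contains_Inf)
    then have i: "Inf Z \<in> {0..T}" "min (A (Inf Z)) (B (Inf Z)) \<le> 0" unfolding Z_def by auto
    have before: "0 < A t \<and> 0 < B t" if "0 \<le> t" "t < Inf Z" for t
    proof -
      have "t \<notin> Z" using that(2) cInf_lower[OF _ \<open>bdd_below Z\<close>, of t] by auto
      then show ?thesis using that i unfolding Z_def by auto
    qed
    have "A 0 \<le> A (Inf Z)"
    proof (rule incr[OF i(1) A])
      fix t assume t: "0 < t" "t < Inf Z"
      then have "0 < c * (A t * B t)" using before[of t] c by simp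
      then show "0 \<le> A' t" using A'[of t] t i by auto
    qed
    moreover have "B 0 \<le> B (Inf Z)"
    proof (rule incr[OF i(1) B])
      fix t assume t: "0 < t" "t < Inf Z"
      then have "0 < c * (A t * B t)" using before[of t] c by simp
      then show "0 \<le> B' t" using B'[of t] t i by auto
    qed
    ultimately show False using i(2) A0 B0 by auto
  qed
  txt \<open>\<open>(1/A + 1/B)' \<le> - c (A/B + B/A) \<le> - 2 c\<close>\<close>
  let ?f = "\<lambda>t. - (1 / A t + 1 / B t + 2 * c * t)"
  have "?f 0 \<le> ?f T"
  proof (rule incr)
    show "T \<in> {0..T}" using T by simp
    fix t assume t: "t \<in> {0..T}"
    show "(?f has_real_derivative A' t / (A t)\<^sup>2 + B' t / (B t)\<^sup>2 - 2 * c) (at t within {0..T})"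
    proof -
      have nz: "A t \<noteq> 0" "B t \<noteq> 0" using pos[OF t] by auto
      have "(?f has_real_derivative - ((0 * A t - 1 * A' t) / (A t * A t) + (0 * B t - 1 * B' t) / (B t * B t) + 2 * c))
          (at t within {0..T})"
        by (intro DERIV_minus DERIV_add DERIV_divide DERIV_const DERIV_cmult_Id A[OF t] B[OF t] nz)
      then show ?thesis
        by (simp add: power2_eq_square add.commute)
    qed
  next
    fix t assume "0 < t" "t < T"
    then have t: "t \<in> {0..T}" by auto
    have p: "0 < A t" "0 < B t" using pos[OF t] by auto
    have "c * (A t * B t) / (A t)\<^sup>2 + c * (A t * B t) / (B t)\<^sup>2 \<le> A' t / (A t)\<^sup>2 + B' t / (B t)\<^sup>2"
      using A'[OF t] B'[OF t] by (intro add_mono divide_right_mono) auto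
    moreover have "c * (A t * B t) / (A t)\<^sup>2 + c * (A t * B t) / (B t)\<^sup>2 - 2 * c = c * (A t - B t)\<^sup>2 / (A t * B t)"
      using p by (simp add: field_simps power2_eq_square)
    moreover have "0 \<le> c * (A t - B t)\<^sup>2 / (A t * B t)"
      using p c by simp
    ultimately show "0 \<le> A' t / (A t)\<^sup>2 + B' t / (B t)\<^sup>2 - 2 * c"
      by linarith
  qed
  moreover have "0 < 1 / A T + 1 / B T"
    using pos[of T] T by (simp add: add_pos_pos)
  ultimately show ?thesis by simp
qed

section \<open>Blow-up\<close>

text \<open>
  For \<open>s\<close> close to \<open>3/2\<close> the second derivative of \<open>u\<close> is not available pointwise, so \<open>w = u\<^sub>x\<close> cannot be
  differentiated along a characteristic directly.  Instead the quotient
  \<open>R\<^sub>h = (u(t, q + h) - u(t, q)) / h\<close> satisfies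
  \<open>R\<^sub>h' = (G(t, q + h) - G(t, q)) / h - \<gamma> R\<^sub>h w(t, q + h)\<close>, in integrated form, with \<open>h\<close> tending to \<open>0\<close>.
\<close>

lemma rod_gradient_along_characteristic:
  fixes u w G g :: "real \<Rightarrow> real \<Rightarrow> real"
  assumes T: "0 \<le> T"
    and ux: "\<And>t x. t \<in> {0..T} \<Longrightarrow> (u t has_real_derivative w t x) (at x)"
    and Gx: "\<And>t x. t \<in> {0..T} \<Longrightarrow> (G t has_real_derivative g t x) (at x)"
    and wc: "\<And>t. t \<in> {0..T} \<Longrightarrow> continuous_on UNIV (w t)"
    and gc: "\<And>t. t \<in> {0..T} \<Longrightarrow> continuous_on UNIV (g t)"
    and wb: "\<And>t. t \<in> {0..T} \<Longrightarrow> bounded (range (w t))"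
    and gb: "\<And>t. t \<in> {0..T} \<Longrightarrow> bounded (range (g t))"
    and ul: "\<And>t. t \<in> {0..T} \<Longrightarrow> uniform_limit UNIV u (u t) (at t within {0..T})"
    and wl: "\<And>t. t \<in> {0..T} \<Longrightarrow> uniform_limit UNIV w (w t) (at t within {0..T})"
    and gl: "\<And>t. t \<in> {0..T} \<Longrightarrow> uniform_limit UNIV g (g t) (at t within {0..T})"
    and ut: "\<And>t. t \<in> {0..T} \<Longrightarrow> uniform_limit UNIV (\<lambda>r x. (u r x - u t x) / (r - t))
      (\<lambda>x. G t x - \<gamma> * u t x * w t x) (at t within {0..T})"
  obtains q where "q 0 = x\<^sub>0"
    and "\<And>t. t \<in> {0..T} \<Longrightarrow> ((\<lambda>t. u t (q t)) has_real_derivative G t (q t)) (at t within {0..T})"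
    and "\<And>t. t \<in> {0..T} \<Longrightarrow>
      ((\<lambda>t. w t (q t)) has_real_derivative g t (q t) - \<gamma> * (w t (q t))\<^sup>2) (at t within {0..T})"
proof -
  obtain M1 where M1: "0 \<le> M1" "\<And>t x. t \<in> {0..T} \<Longrightarrow> \<bar>w t x\<bar> \<le> M1"
    using uniform_path_bounded[OF wc wb wl compact_Icc] by blast
  obtain M2 where M2: "0 \<le> M2" "\<And>t x. t \<in> {0..T} \<Longrightarrow> \<bar>g t x\<bar> \<le> M2"
    using uniform_path_bounded[OF gc gb gl compact_Icc] by blast
  have lipu: "\<bar>u t x - u t y\<bar> \<le> M1 * \<bar>x - y\<bar>" if "t \<in> {0..T}" for t x y
    using field_differentiable_bound[OF convex_UNIV, of "u t" "w t" M1 x y] ux[OF that] M1(2)[OF that] by auto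
  have lipG: "\<bar>G t x - G t y\<bar> \<le> M2 * \<bar>x - y\<bar>" if "t \<in> {0..T}" for t x y
    using field_differentiable_bound[OF convex_UNIV, of "G t" "g t" M2 x y] Gx[OF that] M2(2)[OF that] by auto
  have uc: "continuous_on UNIV (u t)" if "t \<in> {0..T}" for t
    by (rule DERIV_continuous_on) (use ux[OF that] in auto)
  have Gc: "continuous_on UNIV (G t)" if "t \<in> {0..T}" for t
    by (rule DERIV_continuous_on) (use Gx[OF that] in auto)
  obtain q where q0: "q 0 = x\<^sub>0" and q: "\<And>t. t \<in> {0..T} \<Longrightarrow> (q has_real_derivative \<gamma> * u t (q t)) (at t within {0..T})"
  proof (rule picard_lindelof_uniform[where b = "\<lambda>t x. \<gamma> * u t x" and K = "\<bar>\<gamma>\<bar> * M1" and x\<^sub>0 = x\<^sub>0, OF T])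
    fix t assume t: "t \<in> {0..T}"
    show "continuous_on UNIV (\<lambda>x. \<gamma> * u t x)"
      by (intro continuous_intros uc t)
    show "uniform_limit UNIV (\<lambda>t x. \<gamma> * u t x) (\<lambda>x. \<gamma> * u t x) (at t within {0..T})"
      by (rule bounded_linear.uniform_limit[OF bounded_linear_mult_right ul[OF t]])
    fix x y
    have "\<bar>\<gamma>\<bar> * \<bar>u t x - u t y\<bar> \<le> \<bar>\<gamma>\<bar> * (M1 * \<bar>x - y\<bar>)"
      by (rule mult_left_mono[OF lipu[OF t]]) simp
    then show "\<bar>\<gamma> * u t x - \<gamma> * u t y\<bar> \<le> \<bar>\<gamma>\<bar> * M1 * \<bar>x - y\<bar>"
      by (simp add: mult.assoc flip: right_diff_distrib abs_mult)
  qed (use M1 that in auto)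
  \<comment> \<open>The shifted curve moves with the speed at \<open>q t\<close>, not with the speed
    at \<open>q t + h\<close>; this mismatch is the term with the factor \<gamma>, and for h = 0 it
    disappears.\<close>
  have shift: "((\<lambda>t. u t (q t + h)) has_real_derivative G t (q t + h) - \<gamma> * (u t (q t + h) - u t (q t)) * w t (q t + h)) (at t within {0..T})"
    if t: "t \<in> {0..T}" for t h
  proof -
    have qh: "((\<lambda>t. q t + h) has_real_derivative \<gamma> * u t (q t)) (at t within {0..T})"
      using DERIV_add[OF q[OF t] DERIV_const[of h]] by simp
    have "continuous_on UNIV (\<lambda>x. G t x - \<gamma> * u t x * w t x)"
      by (intro continuous_intros Gc uc wc t)
    then have "isCont (\<lambda>x. G t x - \<gamma> * u t x * w t x) (q t + h)"
      by (simp add: continuous_on_eq_continuous_at)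
    from DERIV_uniform_chain[where q = "\<lambda>t. q t + h", OF ut[OF t] this ux[OF t] qh]
    show ?thesis by (simp add: algebra_simps)
  qed
  \<comment> \<open>The expected derivative of u_x along the curve, that is, the limit of
    \<open>R' n\<close>.\<close>
  define Z where "Z t = g t (q t) - \<gamma> * (w t (q t))\<^sup>2" for t
  have qc: "continuous_on {0..T} q"
    by (rule DERIV_continuous_on[OF q])
  have Zc: "continuous_on {0..T} Z"
    unfolding Z_def using uniform_path_continuous[OF wc wl qc] uniform_path_continuous[OF gc gl qc]
    by (intro continuous_on_diff continuous_on_mult continuous_on_const continuous_on_power)
  define h where "h n = 1 / real (Suc n)" for n
  have h: "h n \<noteq> 0" "0 < h n" for n unfolding h_def by auto
  have h0: "h \<longlonglongrightarrow> 0" unfolding h_def by (rule lim_const_over_n[of 1, THEN LIMSEQ_Suc])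
  have hat: "filterlim h (at 0) sequentially"
    unfolding filterlim_at using h0 h by auto
  define R where "R n t = (u t (q t + h n) - u t (q t)) / h n" for n t
  define R' where "R' n t = (G t (q t + h n) - G t (q t)) / h n - \<gamma> * R n t * w t (q t + h n)" for n t
  have R: "(R n has_real_derivative R' n t) (at t within {0..T})" if t: "t \<in> {0..T}" for n t
  proof -
    have "(R n has_real_derivative ((G t (q t + h n) - \<gamma> * (u t (q t + h n) - u t (q t)) * w t (q t + h n)) - G t (q t)) / h n) (at t within {0..T})"
      unfolding R_def using DERIV_cdivide[OF DERIV_diff[OF shift[OF t, of "h n"] shift[OF t, of 0]], of "h n"] by simp
    also have "((G t (q t + h n) - \<gamma> * (u t (q t + h n) - u t (q t)) * w t (q t + h n)) - G t (q t)) / h n = R' n t"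
      unfolding R'_def R_def using h[of n] by (simp add: field_simps)
    finally show ?thesis .
  qed
  have Rlim: "(\<lambda>n. R n t) \<longlonglongrightarrow> w t (q t)" if t: "t \<in> {0..T}" for t
    using filterlim_compose[OF ux[OF t, of "q t", unfolded DERIV_def] hat] unfolding R_def .
  have R'lim: "(\<lambda>n. R' n t) \<longlonglongrightarrow> Z t" if t: "t \<in> {0..T}" for t
  proof -
    have G: "(\<lambda>n. (G t (q t + h n) - G t (q t)) / h n) \<longlonglongrightarrow> g t (q t)"
      using filterlim_compose[OF Gx[OF t, of "q t", unfolded DERIV_def] hat] .
    have "(\<lambda>n. q t + h n) \<longlonglongrightarrow> q t + 0"
      by (intro tendsto_intros h0)
    moreover have "isCont (w t) (q t)"
      using wc[OF t] by (simp add: continuous_on_eq_continuous_at)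
    ultimately have "(\<lambda>n. w t (q t + h n)) \<longlonglongrightarrow> w t (q t)"
      by (intro isCont_tendsto_compose[where g = "w t"]) auto
    then have "(\<lambda>n. R' n t) \<longlonglongrightarrow> g t (q t) - \<gamma> * w t (q t) * w t (q t)"
      unfolding R'_def by (intro tendsto_diff tendsto_mult G Rlim[OF t] tendsto_const)
    then show ?thesis unfolding Z_def by (simp add: power2_eq_square mult.assoc)
  qed
  \<comment> \<open>The Lipschitz constants of \<open>G t\<close> and \<open>u t\<close>, uniform in
    time, bound the quotients independently of \<open>n\<close>; this gives a constant dominating
    function.\<close>
  have R'b: "\<bar>R' n t\<bar> \<le> M2 + \<bar>\<gamma>\<bar> * M1 * M1" if t: "t \<in> {0..T}" for n t
  proof -
    have "\<bar>(G t (q t + h n) - G t (q t)) / h n\<bar> \<le> M2"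
      using lipG[OF t, of "q t + h n" "q t"] h[of n] by (simp add: abs_divide field_simps)
    moreover have "\<bar>R n t\<bar> \<le> M1"
      unfolding R_def using lipu[OF t, of "q t + h n" "q t"] h[of n] by (simp add: abs_divide field_simps)
    then have "\<bar>\<gamma> * R n t * w t (q t + h n)\<bar> \<le> \<bar>\<gamma>\<bar> * M1 * M1"
      unfolding abs_mult using M1 t by (intro mult_mono) auto
    ultimately show ?thesis
      unfolding R'_def by linarith
  qed
  \<comment> \<open>Only the integrated identity passes to the limit. Since \<open>Z\<close> is
    continuous, the integral formula can afterwards be differentiated again.\<close>
  have wq: "w t (q t) = w 0 (q 0) + integral {0..t} Z" if t: "t \<in> {0..T}" for t
  proof -
    have hi: "(R' n has_integral R n t - R n 0) {0..t}" for n
    proof (rule fundamental_theorem_of_calculus)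
      show "0 \<le> t" using t by simp
      fix x assume "x \<in> {0..t}"
      then have "(R n has_vector_derivative R' n x) (at x within {0..T})"
        using R[of x n] t by (simp add: has_real_derivative_iff_has_vector_derivative)
      then show "(R n has_vector_derivative R' n x) (at x within {0..t})"
        by (rule has_vector_derivative_within_subset) (use t in auto)
    qed
    have "(\<lambda>n. integral {0..t} (R' n)) \<longlonglongrightarrow> integral {0..t} Z"
    proof (rule dominated_convergence(2))
      show "R' n integrable_on {0..t}" for n using hi by blast
      show "(\<lambda>_. M2 + \<bar>\<gamma>\<bar> * M1 * M1) integrable_on {0..t}" by (rule integrable_const_ivl)
      show "norm (R' n x) \<le> M2 + \<bar>\<gamma>\<bar> * M1 * M1" if "x \<in> {0..t}" for n x
        unfolding real_norm_def by (rule R'b) (use that t in auto)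
      show "(\<lambda>n. R' n x) \<longlonglongrightarrow> Z x" if "x \<in> {0..t}" for x
        by (rule R'lim) (use that t in auto)
    qed
    moreover have "integral {0..t} (R' n) = R n t - R n 0" for n
      using hi by (rule integral_unique)
    moreover have "(\<lambda>n. R n t - R n 0) \<longlonglongrightarrow> w t (q t) - w 0 (q 0)"
      by (intro tendsto_diff Rlim) (use t T in auto)
    ultimately have "w t (q t) - w 0 (q 0) = integral {0..t} Z"
      using LIMSEQ_unique by auto
    then show ?thesis by simp
  qed
  show ?thesis
  proof
    show "q 0 = x\<^sub>0" by fact
    fix t assume t: "t \<in> {0..T}"
    show "((\<lambda>t. u t (q t)) has_real_derivative G t (q t)) (at t within {0..T})"
      using shift[OF t, of 0] by simp
    have "((\<lambda>t. w 0 (q 0) + integral {0..t} Z) has_real_derivative 0 + Z t) (at t within {0..T})"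
      by (intro DERIV_add DERIV_const integral_has_real_derivative Zc t)
    then have "((\<lambda>t. w 0 (q 0) + integral {0..t} Z) has_real_derivative Z t) (at t within {0..T})"
      by simp
    then have "((\<lambda>t. w t (q t)) has_real_derivative Z t) (at t within {0..T})"
      by (rule has_field_derivative_transform_within[OF _ zero_less_one t]) (auto intro!: wq[symmetric])
    then show "((\<lambda>t. w t (q t)) has_real_derivative g t (q t) - \<gamma> * (w t (q t))\<^sup>2) (at t within {0..T})"
      unfolding Z_def .
  qed
qed

section \<open>Uniform convergence from norm bounds\<close>

lemma uniform_limit_by_bound:
  fixes f :: "'a \<Rightarrow> 'b \<Rightarrow> real"
  assumes ev: "\<forall>\<^sub>F r in F. \<forall>x\<in>S. \<bar>f r x - l x\<bar> \<le> n r" and n: "(n \<longlongrightarrow> 0) F"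
  shows "uniform_limit S f l F"
  unfolding uniform_limit_iff
proof (intro allI impI)
  fix e :: real assume "0 < e"
  then have "\<forall>\<^sub>F r in F. n r < e"
    using n by (rule order_tendstoD(2)[rotated])
  with ev show "\<forall>\<^sub>F r in F. \<forall>x\<in>S. dist (f r x) (l x) < e"
    by eventually_elim (force simp: dist_real_def)
qed

lemma sobolev_diff_scaled:
  assumes "f \<in> sobolev_space s" "g \<in> sobolev_space s"
  shows "(\<lambda>x. f x - g x) \<in> sobolev_space s" "(\<lambda>x. (f x - g x) / c) \<in> sobolev_space s"
  using sobolev_space_lincomb[OF assms, of 1 "-1"] sobolev_space_lincomb[OF assms, of "1/c" "-1/c"]
  by (simp_all add: diff_divide_distrib)

text \<open>Each one-sided kernel has total mass 1/2, so a uniform error \<open>e\<close> in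
  \<open>F\<close> becomes at most \<open>e / 2\<close> in the means.\<close>

lemma uniform_limit_left_mean:
  assumes lim: "uniform_limit UNIV F (F t) (at t within S)" and t: "t \<in> S"
    and cont: "\<And>r. r \<in> S \<Longrightarrow> continuous_on UNIV (F r)"
    and b: "\<And>r. r \<in> S \<Longrightarrow> bounded (range (F r))"
  shows "uniform_limit UNIV (\<lambda>r. left_mean (F r)) (left_mean (F t)) (at t within S)"
    and "uniform_limit UNIV (\<lambda>r. right_mean (F r)) (right_mean (F t)) (at t within S)"
proof -
  have m: "F r \<in> borel_measurable borel" if "r \<in> S" for r
    using cont[OF that] by (rule borel_measurable_continuous_onI)
  have bd: "\<exists>M. \<forall>y. \<bar>F r y\<bar> \<le> M" if "r \<in> S" for r
    using b[OF that] unfolding bounded_iff by auto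
  obtain Mt where Mt: "\<And>y. \<bar>F t y\<bar> \<le> Mt" using bd[OF t] by blast
  have key: "\<forall>\<^sub>F r in at t within S. \<forall>x\<in>UNIV. dist (left_mean (F r) x) (left_mean (F t) x) < e \<and> dist (right_mean (F r) x) (right_mean (F t) x) < e"
    if e: "0 < e" for e
  proof -
    have "\<forall>\<^sub>F r in at t within S. \<forall>x\<in>UNIV. dist (F r x) (F t x) < e"
      using lim e unfolding uniform_limit_iff by blast
    moreover have "\<forall>\<^sub>F r in at t within S. r \<in> S"
      by (simp add: eventually_at_filter)
    ultimately show ?thesis
    proof eventually_elim
      case (elim r)
      obtain Mr where Mr: "\<And>y. \<bar>F r y\<bar> \<le> Mr" using bd[OF elim(2)] by blast
      have d: "(\<lambda>y. F r y - F t y) \<in> borel_measurable borel"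
        using m[OF elim(2)] m[OF t] by measurable
      have le: "\<bar>F r y - F t y\<bar> \<le> e" for y
        using elim(1) by (simp add: dist_real_def less_imp_le)
      show ?case
      proof
        fix x
        have "\<bar>left_mean (F r) x - left_mean (F t) x\<bar> \<le> e / 2"
          unfolding left_mean_diff[OF m[OF elim(2)] Mr m[OF t] Mt] by (rule left_mean_bound[OF d le])
        moreover have "\<bar>right_mean (F r) x - right_mean (F t) x\<bar> \<le> e / 2"
          unfolding right_mean_diff[OF m[OF elim(2)] Mr m[OF t] Mt] by (rule right_mean_bound[OF d le])
        ultimately show "dist (left_mean (F r) x) (left_mean (F t) x) < e \<and> dist (right_mean (F r) x) (right_mean (F t) x) < e"
          using e by (simp add: dist_real_def)
      qed
    qed
  qed
  show "uniform_limit UNIV (\<lambda>r. left_mean (F r)) (left_mean (F t)) (at t within S)"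
    "uniform_limit UNIV (\<lambda>r. right_mean (F r)) (right_mean (F t)) (at t within S)"
    unfolding uniform_limit_iff by (intro allI impI, rule eventually_mono[OF key], assumption, blast)+
qed

text \<open>Here \<open>\<kappa> = (\<omega> - 1) / 2\<close> with \<open>\<omega>\<^sup>2 = 12 / \<gamma> - 3\<close>, the larger root of \<open>\<kappa>\<^sup>2 + \<kappa> = (3 - \<gamma>) / \<gamma>\<close>.\<close>

lemma rod_beta_eq:
  assumes "1 \<le> \<gamma>" "\<gamma> \<le> 4"
  obtains \<kappa> where "rod_beta \<gamma> = \<bar>\<kappa>\<bar>" "\<bar>\<kappa>\<bar> \<le> 1" "\<gamma> * (\<kappa>\<^sup>2 + \<kappa>) = 3 - \<gamma>"
proof -
  define w where "w = sqrt (12 / \<gamma> - 3)"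
  have w2: "w\<^sup>2 = 12 / \<gamma> - 3"
    unfolding w_def using assms by (intro real_sqrt_pow2) (simp add: field_simps)
  have w: "0 \<le> w" "w \<le> 3"
  proof -
    show "0 \<le> w" unfolding w_def using assms by (simp add: field_simps)
    \<comment> \<open>For positive \<gamma> this is equivalent to 1 \<le> \<gamma>, and it yields
      \<kappa> \<le> 1.\<close>
    have "12 / \<gamma> - 3 \<le> 3\<^sup>2" using assms by (simp add: field_simps)
    then show "w \<le> 3" unfolding w_def by (intro real_le_lsqrt) auto
  qed
  have s: "sqrt (12 - 3 * \<gamma>) / (2 * sqrt \<gamma>) = w / 2"
  proof -
    have "12 / \<gamma> - 3 = (12 - 3 * \<gamma>) / \<gamma>" using assms by (simp add: field_simps)
    then show ?thesis unfolding w_def by (simp add: real_sqrt_divide)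
  qed
  define \<kappa> where "\<kappa> = (w - 1) / 2"
  have g: "3 / \<gamma> = (w\<^sup>2 + 3) / 4" using w2 by simp
  \<comment> \<open>Expressed through \<open>w\<close>, the radicand of \<open>rod_beta\<close> is
    the perfect square (w - 1)^2 / 4.\<close>
  have "- 1 / 2 + 3 / \<gamma> - sqrt (12 - 3 * \<gamma>) / (2 * sqrt \<gamma>) = \<kappa>\<^sup>2"
    unfolding s g \<kappa>_def by (simp add: power2_eq_square field_simps)
  then have "rod_beta \<gamma> = \<bar>\<kappa>\<bar>"
    unfolding rod_beta_def by simp
  moreover have "\<bar>\<kappa>\<bar> \<le> 1" unfolding \<kappa>_def using w by (simp add: abs_le_iff field_simps)
  moreover have "\<gamma> * (\<kappa>\<^sup>2 + \<kappa>) = 3 - \<gamma>"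
  proof -
    have "\<kappa>\<^sup>2 + \<kappa> = (w\<^sup>2 - 1) / 4" unfolding \<kappa>_def by (simp add: power2_eq_square field_simps)
    then show ?thesis unfolding w2 using assms by (simp add: field_simps)
  qed
  ultimately show ?thesis by (rule that)
qed


text \<open>The blow-up argument separated from Sobolev spaces: all regularity enters as uniform
  limits, and the equation appears as the uniform limit of the time quotients of
  \<open>u\<close>.\<close>

lemma rod_characteristic_blowup:
  fixes u w :: "real \<Rightarrow> real \<Rightarrow> real" and \<gamma> :: real
  defines "F \<equiv> \<lambda>t y. (3 - \<gamma>) / 2 * (u t y)\<^sup>2 + \<gamma> / 2 * (w t y)\<^sup>2"
  assumes \<gamma>: "1 \<le> \<gamma>" "\<gamma> \<le> 4"
    and ux: "\<And>t x. 0 \<le> t \<Longrightarrow> (u t has_real_derivative w t x) (at x)"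
    and wc: "\<And>t. 0 \<le> t \<Longrightarrow> continuous_on UNIV (w t)"
    and ub: "\<And>t. 0 \<le> t \<Longrightarrow> bounded (range (u t))"
    and wb: "\<And>t. 0 \<le> t \<Longrightarrow> bounded (range (w t))"
    and ul: "\<And>t. 0 \<le> t \<Longrightarrow> uniform_limit UNIV u (u t) (at t within {0..})"
    and wl: "\<And>t. 0 \<le> t \<Longrightarrow> uniform_limit UNIV w (w t) (at t within {0..})"
    and ut: "\<And>t. 0 \<le> t \<Longrightarrow> uniform_limit UNIV (\<lambda>r x. (u r x - u t x) / (r - t))
      (\<lambda>x. left_mean (F t) x - right_mean (F t) x - \<gamma> * u t x * w t x) (at t within {0..})"
  shows "w 0 x\<^sub>0 \<ge> - rod_beta \<gamma> * \<bar>u 0 x\<^sub>0\<bar>"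
proof (rule ccontr)
  assume "\<not> w 0 x\<^sub>0 \<ge> - rod_beta \<gamma> * \<bar>u 0 x\<^sub>0\<bar>"
  then have init: "w 0 x\<^sub>0 < - rod_beta \<gamma> * \<bar>u 0 x\<^sub>0\<bar>" by simp
  obtain \<kappa> where \<kappa>: "rod_beta \<gamma> = \<bar>\<kappa>\<bar>" "\<bar>\<kappa>\<bar> \<le> 1" "\<gamma> * (\<kappa>\<^sup>2 + \<kappa>) = 3 - \<gamma>"
    using rod_beta_eq[OF \<gamma>] by blast
  define \<beta> where "\<beta> = \<bar>\<kappa>\<bar>"
  have \<beta>: "0 \<le> \<beta>" "\<beta> \<le> 1" "\<beta>\<^sup>2 = \<kappa>\<^sup>2" using \<kappa> unfolding \<beta>_def by auto
  have uc: "continuous_on UNIV (u t)" if "0 \<le> t" for t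
    by (rule DERIV_continuous_on) (use ux[OF that] in auto)
  have Fc: "continuous_on UNIV (F t)" if "0 \<le> t" for t
    unfolding F_def by (intro continuous_intros uc wc that)
  have bsq: "bounded (range (\<lambda>x. (f x)\<^sup>2))" if "bounded (range f)" for f :: "real \<Rightarrow> real"
  proof -
    obtain M where M: "\<And>x. \<bar>f x\<bar> \<le> M" using \<open>bounded (range f)\<close> unfolding bounded_iff by auto
    then have "norm ((f x)\<^sup>2) \<le> M\<^sup>2" for x
      using power_mono[OF M[of x], of 2] by simp
    then show ?thesis unfolding bounded_iff by blast
  qed
  have bcm: "bounded (range (\<lambda>x. c * f x))" if "bounded (range f)" for f :: "real \<Rightarrow> real" and c
    using bounded_scaling[OF that, of c] by (simp add: image_image)
  have badd: "bounded (range (\<lambda>x. f x + g x))" "bounded (range (\<lambda>x. f x - g x))"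
    if "bounded (range f)" "bounded (range g)" for f g :: "real \<Rightarrow> real"
    using that by (auto intro: bounded_plus_comp bounded_minus_comp)
  have Fb: "bounded (range (F t))" if "0 \<le> t" for t
    unfolding F_def by (intro badd bcm bsq ub wb that)
  have lim_sq: "uniform_limit UNIV (\<lambda>t x. (f t x)\<^sup>2) (\<lambda>x. (f t x)\<^sup>2) A"
    if "uniform_limit UNIV f (f t) A" "bounded (range (f t))" for f :: "real \<Rightarrow> real \<Rightarrow> real" and t A
    unfolding power2_eq_square using that by (intro uniform_lim_mult)
  have lim_cm: "uniform_limit UNIV (\<lambda>t x. c * f t x) (\<lambda>x. c * l x) A"
    if "uniform_limit UNIV f l A" for f :: "real \<Rightarrow> real \<Rightarrow> real" and l c A
    by (rule bounded_linear.uniform_limit[OF bounded_linear_mult_right that])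
  have Fl: "uniform_limit UNIV F (F t) (at t within {0..})" if "0 \<le> t" for t
    unfolding F_def by (intro uniform_limit_add lim_cm lim_sq ul wl ub wb that)
  define P N where "P t = left_mean (F t)" and "N t = right_mean (F t)" for t
  \<comment> \<open>\<open>G\<close> is minus the space derivative of p * F, and \<open>g\<close> is
    the space derivative of \<open>G\<close>. Since p - p'' is the Dirac mass, the second derivative
    of p * F equals p * F - F, so \<open>g\<close> involves no derivative of
    \<open>F\<close>.\<close>
  define G g where "G t x = P t x - N t x" and "g t x = F t x - P t x - N t x" for t x
  have Pl: "uniform_limit UNIV P (P t) (at t within {0..})"
    and Nl: "uniform_limit UNIV N (N t) (at t within {0..})" if "0 \<le> t" for t
    unfolding P_def[abs_def] N_def[abs_def] using uniform_limit_left_mean[of F t "{0..}", OF Fl[OF that]] that Fc Fb by auto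
  have Fm: "\<exists>M. \<forall>y. \<bar>F t y\<bar> \<le> M" if "0 \<le> t" for t
    using Fb[OF that] unfolding bounded_iff by auto
  have Px: "(P t has_real_derivative F t x / 2 - P t x) (at x)"
    and Nx: "(N t has_real_derivative N t x - F t x / 2) (at x)" if "0 \<le> t" for t x
    unfolding P_def N_def using Fm[OF that] left_mean_DERIV[OF Fc[OF that]] right_mean_DERIV[OF Fc[OF that]] by blast+
  have Pb: "bounded (range (P t))" and Nb: "bounded (range (N t))" if t: "0 \<le> t" for t
  proof -
    obtain M where M: "\<And>y. \<bar>F t y\<bar> \<le> M" using Fm[OF t] by blast
    note Fmeas = borel_measurable_continuous_onI[OF Fc[OF t]]
    have "\<bar>P t x\<bar> \<le> M / 2" "\<bar>N t x\<bar> \<le> M / 2" for x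
      unfolding P_def N_def by (rule left_mean_bound[OF Fmeas M], rule right_mean_bound[OF Fmeas M])
    then show "bounded (range (P t))" "bounded (range (N t))"
      unfolding bounded_iff by (auto intro!: exI[of _ "M / 2"])
  qed
  have Pc: "continuous_on UNIV (P t)" and Nc: "continuous_on UNIV (N t)" if "0 \<le> t" for t
    by (rule DERIV_continuous_on, use Px[OF that] in auto) (rule DERIV_continuous_on, use Nx[OF that] in auto)
  have Gx: "(G t has_real_derivative g t x) (at x)" if "0 \<le> t" for t x
    unfolding G_def g_def using DERIV_diff[OF Px[OF that] Nx[OF that], of x] by (simp add: algebra_simps)
  have gc: "continuous_on UNIV (g t)" if "0 \<le> t" for t
    unfolding g_def by (intro continuous_on_diff Fc Pc Nc that)
  have gb: "bounded (range (g t))" if "0 \<le> t" for t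
    unfolding g_def by (intro badd Fb Pb Nb that)
  have gl: "uniform_limit UNIV g (g t) (at t within {0..})" if "0 \<le> t" for t
    unfolding g_def[abs_def] by (intro uniform_limit_minus Fl Pl Nl that)
  have ut': "uniform_limit UNIV (\<lambda>r x. (u r x - u t x) / (r - t)) (\<lambda>x. G t x - \<gamma> * u t x * w t x) (at t within {0..})"
    if "0 \<le> t" for t
    using ut[OF that] unfolding G_def P_def N_def .
  have within: "uniform_limit UNIV f l (at t within {0..T})" if "uniform_limit UNIV f l (at t within {0..})"
    for f :: "real \<Rightarrow> real \<Rightarrow> real" and l t T
    using that by (rule filterlim_mono[OF _ order_refl at_le]) auto
  \<comment> \<open>The initial values of A and B; their positivity together is the assumption u_x <
    -\<beta> |u| at x_0.\<close>
  define a b where "a = \<beta> * u 0 x\<^sub>0 - w 0 x\<^sub>0" and "b = - (\<beta> * u 0 x\<^sub>0 + w 0 x\<^sub>0)"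
  have ab: "0 < a" "0 < b"
  proof -
    have "\<bar>\<beta> * u 0 x\<^sub>0\<bar> = \<beta> * \<bar>u 0 x\<^sub>0\<bar>" using \<beta> by (simp add: abs_mult)
    then show "0 < a" "0 < b"
      using init unfolding a_def b_def \<kappa>(1) \<beta>_def[symmetric] by linarith+
  qed
  \<comment> \<open>With c = \<gamma>/2 the Riccati lemma gives \<gamma> T < 1/a + 1/b; this
    \<open>T\<close> turns the strict inequality into an equality, hence a contradiction.\<close>
  define T where "T = (1 / a + 1 / b) / \<gamma>"
  have T: "0 \<le> T" unfolding T_def using ab \<gamma> by simp
  obtain q where q0: "q 0 = x\<^sub>0"
    and U: "\<And>t. t \<in> {0..T} \<Longrightarrow> ((\<lambda>t. u t (q t)) has_real_derivative G t (q t)) (at t within {0..T})"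
    and W: "\<And>t. t \<in> {0..T} \<Longrightarrow>
      ((\<lambda>t. w t (q t)) has_real_derivative g t (q t) - \<gamma> * (w t (q t))\<^sup>2) (at t within {0..T})"
    by (rule rod_gradient_along_characteristic[of T u w G g \<gamma> x\<^sub>0, OF T])
      (use ux Gx wc gc wb gb within[OF ul] within[OF wl] within[OF gl] within[OF ut'] in \<open>auto\<close>)
  have mean: "\<gamma> * \<kappa> / 4 * (u t x)\<^sup>2 \<le> P t x" "\<gamma> * \<kappa> / 4 * (u t x)\<^sup>2 \<le> N t x" if t: "0 \<le> t" for t x
  proof -
    obtain M1 M2 where "\<And>x. \<bar>u t x\<bar> \<le> M1" "\<And>x. \<bar>w t x\<bar> \<le> M2"
      using ub[OF t] wb[OF t] unfolding bounded_iff by auto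
    then have M: "\<And>x. \<bar>u t x\<bar> \<le> max M1 M2" "\<And>x. \<bar>w t x\<bar> \<le> max M1 M2"
      by (auto intro: max.coboundedI1 max.coboundedI2)
    have "0 \<le> \<gamma>" using \<gamma> by simp
    show "\<gamma> * \<kappa> / 4 * (u t x)\<^sup>2 \<le> P t x"
      unfolding P_def F_def by (rule left_mean_lower_bound[OF ux[OF t] wc[OF t] M \<open>0 \<le> \<gamma>\<close> \<kappa>(3)])
    show "\<gamma> * \<kappa> / 4 * (u t x)\<^sup>2 \<le> N t x"
      unfolding N_def F_def by (rule right_mean_lower_bound[OF ux[OF t] wc[OF t] M \<open>0 \<le> \<gamma>\<close> \<kappa>(3)])
  qed
  \<comment> \<open>One estimate for both functions: \<sigma> = \<beta> gives the derivative of A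
    and \<sigma> = -\<beta> that of B. The bound |\<sigma>| \<le> 1 keeps the weights 1 + \<sigma>
    and 1 - \<sigma> of \<open>P\<close> and \<open>N\<close> nonnegative, so that the lower bounds
    on the means may be inserted.\<close>
  have ineq: "\<sigma> * G t x - (g t x - \<gamma> * (w t x)\<^sup>2) \<ge> \<gamma> / 2 * ((w t x)\<^sup>2 - \<beta>\<^sup>2 * (u t x)\<^sup>2)"
    if t: "0 \<le> t" and \<sigma>: "\<bar>\<sigma>\<bar> \<le> 1" for \<sigma> t x
  proof -
    have "(1 + \<sigma>) * (\<gamma> * \<kappa> / 4 * (u t x)\<^sup>2) + (1 - \<sigma>) * (\<gamma> * \<kappa> / 4 * (u t x)\<^sup>2) \<le> (1 + \<sigma>) * P t x + (1 - \<sigma>) * N t x"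
      using \<sigma> by (intro add_mono mult_left_mono mean t) auto
    moreover have \<gamma>\<beta>: "\<gamma> * \<beta>\<^sup>2 = 3 - \<gamma> - \<gamma> * \<kappa>"
      using \<kappa>(3) \<beta>(3) by (simp add: algebra_simps)
    have "\<gamma> / 2 * ((w t x)\<^sup>2 - \<beta>\<^sup>2 * (u t x)\<^sup>2) = \<gamma> / 2 * (w t x)\<^sup>2 - (3 - \<gamma> - \<gamma> * \<kappa>) / 2 * (u t x)\<^sup>2"
      unfolding \<gamma>\<beta>[symmetric] by (simp add: algebra_simps)
    moreover have "(1 + \<sigma>) * (\<gamma> * \<kappa> / 4 * (u t x)\<^sup>2) + (1 - \<sigma>) * (\<gamma> * \<kappa> / 4 * (u t x)\<^sup>2) = \<gamma> * \<kappa> / 2 * (u t x)\<^sup>2"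
      by (simp add: field_simps)
    moreover have "(3 - \<gamma> - \<gamma> * \<kappa>) / 2 * (u t x)\<^sup>2 = (3 - \<gamma>) / 2 * (u t x)\<^sup>2 - \<gamma> * \<kappa> / 2 * (u t x)\<^sup>2"
      by (simp add: diff_divide_distrib left_diff_distrib)
    moreover have "\<sigma> * G t x - (g t x - \<gamma> * (w t x)\<^sup>2) =
        (1 + \<sigma>) * P t x + (1 - \<sigma>) * N t x - (3 - \<gamma>) / 2 * (u t x)\<^sup>2 + \<gamma> / 2 * (w t x)\<^sup>2"
      unfolding G_def g_def F_def by (simp add: field_simps)
    ultimately show ?thesis
      by linarith
  qed
  have "2 * (\<gamma> / 2) * T < 1 / (\<beta> * u 0 (q 0) - w 0 (q 0)) + 1 / (- (\<beta> * u 0 (q 0) + w 0 (q 0)))"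
  proof (rule riccati_pair_blowup[OF T, where A = "\<lambda>t. \<beta> * u t (q t) - w t (q t)" and B = "\<lambda>t. - (\<beta> * u t (q t) + w t (q t))"])
    show "0 < \<gamma> / 2" using \<gamma> by simp
    show "0 < \<beta> * u 0 (q 0) - w 0 (q 0)" "0 < - (\<beta> * u 0 (q 0) + w 0 (q 0))"
      using ab unfolding q0 a_def b_def by auto
    fix t assume t: "t \<in> {0..T}"
    then have t0: "0 \<le> t" by simp
    show "((\<lambda>t. \<beta> * u t (q t) - w t (q t)) has_real_derivative \<beta> * G t (q t) - (g t (q t) - \<gamma> * (w t (q t))\<^sup>2)) (at t within {0..T})"
      by (intro DERIV_diff DERIV_cmult U W t)
    show "((\<lambda>t. - (\<beta> * u t (q t) + w t (q t))) has_real_derivative - (\<beta> * G t (q t) + (g t (q t) - \<gamma> * (w t (q t))\<^sup>2))) (at t within {0..T})"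
      by (intro DERIV_minus DERIV_add DERIV_cmult U W t)
    have AB: "(\<beta> * u t (q t) - w t (q t)) * (- (\<beta> * u t (q t) + w t (q t))) = (w t (q t))\<^sup>2 - \<beta>\<^sup>2 * (u t (q t))\<^sup>2"
      by (simp add: power2_eq_square algebra_simps)
    show "\<gamma> / 2 * ((\<beta> * u t (q t) - w t (q t)) * (- (\<beta> * u t (q t) + w t (q t)))) \<le> \<beta> * G t (q t) - (g t (q t) - \<gamma> * (w t (q t))\<^sup>2)"
      unfolding AB using \<beta> by (intro ineq t0) auto
    show "\<gamma> / 2 * ((\<beta> * u t (q t) - w t (q t)) * (- (\<beta> * u t (q t) + w t (q t)))) \<le> - (\<beta> * G t (q t) + (g t (q t) - \<gamma> * (w t (q t))\<^sup>2))"
      unfolding AB using ineq[OF t0, of "- \<beta>" "q t"] \<beta> by simp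
  qed
  then show False
    unfolding q0 a_def[symmetric] b_def[symmetric] T_def using \<gamma> by simp
qed

text \<open>Translation of the solution concept into uniform limits. The embedding is applied to
  u(r) - u(t) in H^s, for \<open>u\<close> and u_x, and to the time quotient minus its limit in
  H^(s-1), where s - 1 > 1/2 suffices for a sup bound.\<close>

lemma global_rod_solution_gradient:
  assumes \<gamma>: "1 \<le> \<gamma>" "\<gamma> \<le> 4" and s: "s > 3 / 2" and sol: "rod_solution \<gamma> s u\<^sub>0 \<infinity> u"
  shows "deriv u\<^sub>0 x\<^sub>0 \<ge> - rod_beta \<gamma> * \<bar>u\<^sub>0 x\<^sub>0\<bar>"
proof -
  have I: "rod_interval \<infinity> = {0..}"
    unfolding rod_interval_def by auto
  obtain v where cont: "\<And>t. 0 \<le> t \<Longrightarrow> continuous_on UNIV (u t)"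
    and sc: "sobolev_continuous s {0..} u"
    and sd: "sobolev_time_derivative (s - 1) {0..} u v"
    and pde: "\<And>t. 0 \<le> t \<Longrightarrow> AE x in lborel. v t x + \<gamma> * u t x * deriv (u t) x =
               - Defs.convolution (deriv rod_kernel)
                   (\<lambda>y. (3 - \<gamma>) / 2 * (u t y)\<^sup>2 + \<gamma> / 2 * (deriv (u t) y)\<^sup>2) x"
    and u0: "u 0 = u\<^sub>0"
    using sol unfolding rod_solution_def I by (auto simp: fun_eq_iff)
  define w where "w t = deriv (u t)" for t
  define F where "F t y = (3 - \<gamma>) / 2 * (u t y)\<^sup>2 + \<gamma> / 2 * (w t y)\<^sup>2" for t y
  have us: "u t \<in> sobolev_space s" if "0 \<le> t" for t
    using sc that unfolding sobolev_continuous_def by simp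
  have ux: "(u t has_real_derivative w t x) (at x)"
    and wle: "\<bar>w t x\<bar> \<le> embedding_constant (s - 1) * sobolev_norm s (u t)"
    and wc: "continuous_on UNIV (w t)" if "0 \<le> t" for t x
    unfolding w_def using sobolev_differentiable[OF us[OF that] s cont[OF that]] by auto
  have ic: "isCont (u t) x" if "0 \<le> t" for t x
    using ux[OF that] by (rule DERIV_isCont)
  have ule: "\<bar>u t x\<bar> \<le> embedding_constant s * sobolev_norm s (u t)" if "0 \<le> t" for t x
    using sobolev_sup_bound[OF us[OF that] _ ic[OF that]] s by simp
  have ub: "bounded (range (u t))" and wb: "bounded (range (w t))" if "0 \<le> t" for t
    using ule[OF that] wle[OF that] unfolding bounded_iff by auto
  have n0: "((\<lambda>r. sobolev_norm s (\<lambda>x. u r x - u t x)) \<longlongrightarrow> 0) (at t within {0..})" if "0 \<le> t" for t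
    using sc that unfolding sobolev_continuous_def by simp
  have ev: "\<forall>\<^sub>F r in at t within {0..}. 0 \<le> r \<and> r \<noteq> t" for t :: real
    by (simp add: eventually_at_filter)
  have ul: "uniform_limit UNIV u (u t) (at t within {0..})" if t: "0 \<le> t" for t
  proof (rule uniform_limit_by_bound)
    show "((\<lambda>r. embedding_constant s * sobolev_norm s (\<lambda>x. u r x - u t x)) \<longlongrightarrow> 0) (at t within {0..})"
      by (rule tendsto_mult_right_zero[OF n0[OF t]])
    show "\<forall>\<^sub>F r in at t within {0..}. \<forall>x\<in>UNIV. \<bar>u r x - u t x\<bar> \<le> embedding_constant s * sobolev_norm s (\<lambda>x. u r x - u t x)"
      using ev
    proof (eventually_elim, intro ballI)
      fix r x assume "0 \<le> r \<and> r \<noteq> t"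
      then have r: "0 \<le> r" by simp
      show "\<bar>u r x - u t x\<bar> \<le> embedding_constant s * sobolev_norm s (\<lambda>x. u r x - u t x)"
        using s by (intro sobolev_sup_bound sobolev_diff_scaled us r t continuous_diff ic) auto
    qed
  qed
  have wl: "uniform_limit UNIV w (w t) (at t within {0..})" if t: "0 \<le> t" for t
  proof (rule uniform_limit_by_bound)
    show "((\<lambda>r. embedding_constant (s - 1) * sobolev_norm s (\<lambda>x. u r x - u t x)) \<longlongrightarrow> 0) (at t within {0..})"
      by (rule tendsto_mult_right_zero[OF n0[OF t]])
    show "\<forall>\<^sub>F r in at t within {0..}. \<forall>x\<in>UNIV. \<bar>w r x - w t x\<bar> \<le> embedding_constant (s - 1) * sobolev_norm s (\<lambda>x. u r x - u t x)"
      using ev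
    proof (eventually_elim, intro ballI)
      fix r x assume "0 \<le> r \<and> r \<noteq> t"
      then have r: "0 \<le> r" by simp
      have "deriv (\<lambda>x. u r x - u t x) x = w r x - w t x"
        by (intro DERIV_imp_deriv DERIV_diff ux r t)
      moreover have "\<bar>deriv (\<lambda>x. u r x - u t x) x\<bar> \<le> embedding_constant (s - 1) * sobolev_norm s (\<lambda>x. u r x - u t x)"
        by (intro sobolev_differentiable s sobolev_diff_scaled us r t continuous_on_diff cont)
      ultimately show "\<bar>w r x - w t x\<bar> \<le> embedding_constant (s - 1) * sobolev_norm s (\<lambda>x. u r x - u t x)"
        by simp
    qed
  qed
  txt \<open>
    The function \<open>v t\<close> need not be continuous; the equation provides a continuous function equal to
    it almost everywhere, to which the pointwise Sobolev bound applies.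
  \<close>
  define V where "V t x = left_mean (F t) x - right_mean (F t) x - \<gamma> * u t x * w t x" for t x
  have Fc: "continuous_on UNIV (F t)" if "0 \<le> t" for t
    unfolding F_def by (intro continuous_intros cont wc that)
  have Fm: "\<exists>M. \<forall>y. \<bar>F t y\<bar> \<le> M" if t: "0 \<le> t" for t
  proof -
    obtain M1 M2 where M: "\<And>x. \<bar>u t x\<bar> \<le> M1" "\<And>x. \<bar>w t x\<bar> \<le> M2"
      using ub[OF t] wb[OF t] unfolding bounded_iff by auto
    have "\<bar>F t y\<bar> \<le> \<bar>(3 - \<gamma>) / 2\<bar> * M1\<^sup>2 + \<bar>\<gamma> / 2\<bar> * M2\<^sup>2" for y
    proof -
      have "(u t y)\<^sup>2 \<le> M1\<^sup>2" "(w t y)\<^sup>2 \<le> M2\<^sup>2"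
        using power_mono[OF M(1)[of y], of 2] power_mono[OF M(2)[of y], of 2] by auto
      then have "\<bar>(3 - \<gamma>) / 2 * (u t y)\<^sup>2\<bar> \<le> \<bar>(3 - \<gamma>) / 2\<bar> * M1\<^sup>2" "\<bar>\<gamma> / 2 * (w t y)\<^sup>2\<bar> \<le> \<bar>\<gamma> / 2\<bar> * M2\<^sup>2"
        unfolding abs_mult[of _ "_\<^sup>2"] by (auto intro!: mult_left_mono)
      then show ?thesis unfolding F_def by linarith
    qed
    then show ?thesis by blast
  qed
  have Vc: "continuous_on UNIV (V t)" if t: "0 \<le> t" for t
  proof -
    obtain M where M: "\<And>y. \<bar>F t y\<bar> \<le> M" using Fm[OF t] by blast
    have "continuous_on UNIV (left_mean (F t))" "continuous_on UNIV (right_mean (F t))"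
      by (rule DERIV_continuous_on, use left_mean_DERIV[OF Fc[OF t] M] in auto)
        (rule DERIV_continuous_on, use right_mean_DERIV[OF Fc[OF t] M] in auto)
    then show ?thesis
      unfolding V_def by (intro continuous_intros cont wc t)
  qed
  have vV: "AE x in lborel. v t x = V t x" if t: "0 \<le> t" for t
  proof -
    obtain M where M: "\<And>y. \<bar>F t y\<bar> \<le> M" using Fm[OF t] by blast
    have "Defs.convolution (deriv rod_kernel) (F t) x = right_mean (F t) x - left_mean (F t) x" for x
      by (rule convolution_deriv_rod_kernel[OF borel_measurable_continuous_onI[OF Fc[OF t]] M])
    moreover have "(\<lambda>y. (3 - \<gamma>) / 2 * (u t y)\<^sup>2 + \<gamma> / 2 * (deriv (u t) y)\<^sup>2) = F t"
      unfolding F_def w_def ..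
    ultimately show ?thesis
      using pde[OF t] unfolding V_def w_def by (auto elim!: eventually_mono)
  qed
  have ut: "uniform_limit UNIV (\<lambda>r x. (u r x - u t x) / (r - t)) (V t) (at t within {0..})" if t: "0 \<le> t" for t
  proof (rule uniform_limit_by_bound)
    let ?n = "\<lambda>r. sobolev_norm (s - 1) (\<lambda>x. (u r x - u t x) / (r - t) - v t x)"
    have n: "(?n \<longlongrightarrow> 0) (at t within {0..})"
      using sd t unfolding sobolev_time_derivative_def by simp
    then show "((\<lambda>r. embedding_constant (s - 1) * ?n r) \<longlongrightarrow> 0) (at t within {0..})"
      by (rule tendsto_mult_right_zero)
    show "\<forall>\<^sub>F r in at t within {0..}. \<forall>x\<in>UNIV. \<bar>(u r x - u t x) / (r - t) - V t x\<bar> \<le> embedding_constant (s - 1) * ?n r"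
      using ev
    proof (eventually_elim, intro ballI)
      fix r x assume "0 \<le> r \<and> r \<noteq> t"
      then have r: "0 \<le> r" "r \<noteq> t" by auto
      let ?d = "\<lambda>x. (u r x - u t x) / (r - t) - v t x" and ?d' = "\<lambda>x. (u r x - u t x) / (r - t) - V t x"
      have mem: "?d \<in> sobolev_space (s - 1)"
        using sd r t unfolding sobolev_time_derivative_def by (intro sobolev_diff_scaled) auto
      have c: "continuous_on UNIV ?d'"
        by (intro continuous_intros cont r t Vc) (use r in auto)
      have ae: "AE x in lborel. ?d x = ?d' x"
        using vV[OF t] by eventually_elim simp
      have "?d' \<in> sobolev_space (s - 1)" "sobolev_norm (s - 1) ?d' = sobolev_norm (s - 1) ?d"
        using sobolev_cong_AE[OF mem ae borel_measurable_continuous_onI[OF c]] by auto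
      moreover have "isCont ?d' x"
        using c by (simp add: continuous_on_eq_continuous_at)
      ultimately show "\<bar>(u r x - u t x) / (r - t) - V t x\<bar> \<le> embedding_constant (s - 1) * ?n r"
        using sobolev_sup_bound[of ?d' "s - 1" x] s by simp
    qed
  qed
  have "w 0 x\<^sub>0 \<ge> - rod_beta \<gamma> * \<bar>u 0 x\<^sub>0\<bar>"
    using ut unfolding V_def[abs_def] F_def[abs_def]
    by (intro rod_characteristic_blowup[of \<gamma> u w] \<gamma> ux wc ub wb ul wl) auto
  then show ?thesis
    unfolding w_def u0 .
qed

theorem theorem2p1:
  fixes \<gamma> s x\<^sub>0 :: real
    and u\<^sub>0 :: "real \<Rightarrow> real"
    and u :: "real \<Rightarrow> real \<Rightarrow> real"
    and Tstar :: ereal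
  assumes "1 \<le> \<gamma>" and "\<gamma> \<le> 4"
    and "s > 3 / 2"
    and "u\<^sub>0 \<in> sobolev_space s" and "continuous_on UNIV u\<^sub>0"
    and "0 < Tstar"
    and "Tstar = rod_max_time \<gamma> s u\<^sub>0"
    and "rod_solution \<gamma> s u\<^sub>0 Tstar u"
    and "deriv u\<^sub>0 x\<^sub>0 < - rod_beta \<gamma> * \<bar>u\<^sub>0 x\<^sub>0\<bar>"
  shows "Tstar < \<infinity>"
proof (rule ccontr)
  assume "\<not> Tstar < \<infinity>"
  \<comment> \<open>In \<open>ereal\<close> the negated claim means
    \<open>Tstar = \<infinity>\<close>, so the given solution itself is global.\<close>
  then have "rod_solution \<gamma> s u\<^sub>0 \<infinity> u"
    using assms(8) by simp
  from global_rod_solution_gradient[OF assms(1-3) this, of x\<^sub>0] assms(9)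
  show False by simp
qed

end
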